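(* Let $0<\alpha<1$ and $p,q>0$. (1) The following conditions are equivalent: (i) $\widetilde{SG}_{\alpha,p}(A,B)\prec_{\log}R_{\alpha,q}(A,B)$ for all $A,B\ge0$ with $s(A)\ge s(B)$; (ii) $\widetilde{SG}_{\alpha,p}(A,B)\prec_{\log}R_{\alpha,q}(A,B)$ for all $A,B\in\mathbb{M}_2^{++}$; (iii) $p/q\le\alpha$. (2) If $\alpha\le1/2$ and $q\le p$, then $R_{\alpha,q}(A,B)\prec_{\log}\widetilde{SG}_{\alpha,p}(A,B)$ holds for all $A,B\ge0$ with $s(A)\ge s(B)$. (3) Assume that $R_{\alpha,q}(A,B)\prec_{\log}\widetilde{SG}_{\alpha,p}(A,B)$ holds for all $A,B\in\mathbb{M}_2^{++}$. Then $\alpha\le1/2$ and $p/q\ge1/2$.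
   Context: Notation: $\mathbb{M}_n$ is the set of $n\times n$ complex matrices, $\mathbb{M}_n^+$ (resp. $\mathbb{M}_n^{++}$) the positive semidefinite (resp. positive definite) ones. $A\ge0$ (resp. $A>0$) means $A\in\mathbb{M}_n^+$ (resp. $A\in\mathbb{M}_n^{++}$) for some $n\in\mathbb{N}$; matrices appearing together have the same size. $s(A)$ is the support projection of $A\ge0$. $A^{-1}$ denotes the generalized inverse (the inverse on the support of $A$, zero on the kernel), and $A^r:=(A^{-1})^{-r}$ for $r<0$. For $A,B\ge0$ with $s(A)\ge s(B)$, $A\#_\alpha B:=A^{1/2}(A^{-1/2}BA^{-1/2})^{\alpha}A^{1/2}$. For $s(A)\ge s(B)$, $\widetilde{SG}_{\alpha,p}(A,B):=\bigl((A^{-p}\#_\alpha B^p)^{1/2}A^{2(1-\alpha)p}(A^{-p}\#_\alpha B^p)^{1/2}\bigr)^{1/p}$. The Rényi mean is $R_{\alpha,p}(A,B):=\bigl(A^{\frac{1-\alpha}{2}p}B^{\alpha p}A^{\frac{1-\alpha}{2}p}\bigr)^{1/p}$. Log-majorization: for $X,Y\in\mathbb{M}_n^+$ with eigenvalues $\lambda_1(\cdot)\ge\dots\ge\lambda_n(\cdot)$ counted with multiplicity, $X\prec_{\log}Y$ means $\prod_{i=1}^k\lambda_i(X)\le\prod_{i=1}^k\lambda_i(Y)$ for $1\le k\le n$, with equality for $k=n$. *)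

theory Defs
  imports
    "HOL-Library.Multiset"
    "HOL-Computational_Algebra.Polynomial"
    "Jordan_Normal_Form.Schur_Decomposition"
    "Jordan_Normal_Form.Matrix_Kernel"
begin

definition psd_mats :: "nat \<Rightarrow> complex mat set" where
  "psd_mats n = {A \<in> carrier_mat n n. mat_adjoint A = A \<and>
     (\<forall>v \<in> carrier_vec n. 0 \<le> Re ((A *\<^sub>v v) \<bullet>c v))}"

definition pd_mats :: "nat \<Rightarrow> complex mat set" where
  "pd_mats n = {A \<in> carrier_mat n n. mat_adjoint A = A \<and>
     (\<forall>v \<in> carrier_vec n. v \<noteq> 0\<^sub>v n \<longrightarrow> 0 < Re ((A *\<^sub>v v) \<bullet>c v))}"

text \<open>The Loewner order. (The order that the matrix library puts on type mat is entrywise.)\<close>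

definition loewner_le :: "complex mat \<Rightarrow> complex mat \<Rightarrow> bool" where
  "loewner_le A B \<longleftrightarrow> dim_row A = dim_row B \<and> B - A \<in> psd_mats (dim_row A)"

text \<open>The support projection is the orthogonal projection onto the orthogonal complement of
  the kernel, i.e. the self-adjoint idempotent with the same kernel.\<close>

definition support_proj :: "complex mat \<Rightarrow> complex mat" where
  "support_proj A = (THE P. P \<in> carrier_mat (dim_row A) (dim_row A) \<and> mat_adjoint P = P \<and>
     P * P = P \<and> mat_kernel P = mat_kernel A)"

text \<open>\<open>unitary_diag n U d A\<close> says that \<open>A = U diag(d\<^sub>0, \<dots>, d\<^sub>n\<^sub>-\<^sub>1) U*\<close> with \<open>U\<close> unitary and \<open>d\<close> real.
  The functional calculus below replaces \<open>d\<close> by \<open>f \<circ> d\<close>; for Hermitian \<open>A\<close> a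
  diagonalization exists, and the result does not depend on which one is taken.\<close>

definition unitary_diag :: "nat \<Rightarrow> complex mat \<Rightarrow> (nat \<Rightarrow> real) \<Rightarrow> complex mat \<Rightarrow> bool" where
  "unitary_diag n U d A \<longleftrightarrow> U \<in> carrier_mat n n \<and> mat_adjoint U * U = 1\<^sub>m n \<and>
     A = U * mat_diag n (\<lambda>i. complex_of_real (d i)) * mat_adjoint U"

definition fun_calc :: "(real \<Rightarrow> real) \<Rightarrow> complex mat \<Rightarrow> complex mat" where
  "fun_calc f A = (THE B. \<exists>U d. unitary_diag (dim_row A) U d A \<and>
     unitary_diag (dim_row A) U (\<lambda>i. f (d i)) B)"

text \<open>Since \<open>inverse 0 = 0\<close>, this is the inverse on the support and zero on the kernel.\<close>

definition gen_inv :: "complex mat \<Rightarrow> complex mat" where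
  "gen_inv A = fun_calc inverse A"

definition mat_powr :: "complex mat \<Rightarrow> real \<Rightarrow> complex mat" where
  "mat_powr A r = (if r < 0 then fun_calc (\<lambda>x. x powr (- r)) (gen_inv A)
     else fun_calc (\<lambda>x. x powr r) A)"

definition geo_mean :: "real \<Rightarrow> complex mat \<Rightarrow> complex mat \<Rightarrow> complex mat" where
  "geo_mean \<alpha> A B = mat_powr A (1/2) *
     mat_powr (mat_powr A (- (1/2)) * B * mat_powr A (- (1/2))) \<alpha> * mat_powr A (1/2)"

definition SG_tilde :: "real \<Rightarrow> real \<Rightarrow> complex mat \<Rightarrow> complex mat \<Rightarrow> complex mat" where
  "SG_tilde \<alpha> p A B =
     (let G = geo_mean \<alpha> (mat_powr A (- p)) (mat_powr B p)
      in mat_powr (mat_powr G (1/2) * mat_powr A (2 * (1 - \<alpha>) * p) * mat_powr G (1/2)) (1/p))"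

definition renyi_mean :: "real \<Rightarrow> real \<Rightarrow> complex mat \<Rightarrow> complex mat \<Rightarrow> complex mat" where
  "renyi_mean \<alpha> p A B =
     mat_powr (mat_powr A ((1 - \<alpha>) / 2 * p) * mat_powr B (\<alpha> * p) * mat_powr A ((1 - \<alpha>) / 2 * p))
       (1/p)"

text \<open>\<open>eigval X i\<close> for \<open>i = 1, \<dots>, n\<close> is the \<open>i\<close>-th largest eigenvalue of a Hermitian \<open>n \<times> n\<close>
  matrix, counted with multiplicity; its eigenvalues are real, so nothing is lost by \<open>Re\<close>.\<close>

definition eigval :: "complex mat \<Rightarrow> nat \<Rightarrow> real" where
  "eigval X i = rev (sorted_list_of_multiset (image_mset Re (proots (char_poly X)))) ! (i - 1)"

definition log_maj :: "nat \<Rightarrow> complex mat \<Rightarrow> complex mat \<Rightarrow> bool" where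
  "log_maj n X Y \<longleftrightarrow> X \<in> psd_mats n \<and> Y \<in> psd_mats n \<and>
     (\<forall>k \<in> {1..n}. (\<Prod>i=1..k. eigval X i) \<le> (\<Prod>i=1..k. eigval Y i)) \<and>
     (\<Prod>i=1..n. eigval X i) = (\<Prod>i=1..n. eigval Y i)"

end

(*
Up to unitary equivalence the p-th power of the first mean is A^((1/2-a)p) Y^a A^((1/2-a)p) with
Y = A^(p/2) B^p A^(p/2).  Compound matrices turn products of the k largest eigenvalues into largest
eigenvalues and commute with products and powers, hence with both means, so a log-majorization
reduces to equal determinants and to implications of the form "one mean is at most c, hence so is
the other" in every dimension.  For p/q <= a this is the Loewner-Heinz inequality applied twice
(Araki's inequality); for a <= 1/2 and q <= p it is a Furuta-type inequality, obtained by iterating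
B <= A ==> (A^(r/2) B^p A^(r/2))^(1/p) <= A^(1+r/p) from the case r <= 1, followed by
Loewner-Heinz.  A singular A is replaced by A plus the projection onto its kernel.
The necessary conditions come from A = diag(x, 1) and B near a rank-one projection v v*, where both
means are explicit in the moments <v, A^s v>; x tends to 0 for (1), and to infinity with weight
x^(-m) on the first coordinate for (3).
*)

theory Submission
  imports Defs "HOL-Analysis.Elementary_Metric_Spaces"
begin

text \<open>A bound A^x B A^x <= c becomes useful as B <= c A^(-2x), to which Loewner-Heinz applies;
  hence the need for an invertible \<open>A\<close>. A singular \<open>B\<close> is an obstacle only
  in Furuta's inequality, where inverse powers occur. The unitary equivalence is between the two
  products of K = A^((1-a)p) G^(1/2) with its adjoint, G being the inner geometric mean.

  For a < 1/2 and p = 1 the hypothesis says Q <= P with Q = Y^a / c and P = A^(2a-1). The exponents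
  1/a and r = 1/(1-2a) in Furuta's inequality are those that turn Q back into a multiple of Y and
  P^(r/2) into A^(-1/2), so that \<open>B\<close> reappears. At a = 1/2 the second one is infinite
  and Araki's inequality takes over.

  In the converse direction \<open>B\<close> must be invertible, so a projection, all of whose
  positive powers agree, gets a small eigenvalue on its kernel. Only largest eigenvalues are
  compared. For (1), with equal weights, every moment tends to 1/2 and 2^(p/q) <= 2^a remains. For
  (3), m between 2(1-a)p and p refutes a > 1/2, and m between 2(1-a)p and (1-a)q refutes q >
  2p.\<close>

section \<open>Adjoints, norms and quadratic forms\<close>

lemma mat_adjoint_dim [simp]:
  "dim_row (mat_adjoint A) = dim_col A" "dim_col (mat_adjoint A) = dim_row A"
  by (simp_all add: mat_adjoint_def)

lemma mat_adjoint_index [simp]: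
  assumes "i < dim_col A" "j < dim_row A"
  shows "mat_adjoint A $$ (i, j) = conjugate (A $$ (j, i))"
  using assms by (simp add: mat_adjoint_def mat_of_rows_def)

lemma mat_adjoint_carrier [simp, intro]:
  "A \<in> carrier_mat n m \<Longrightarrow> mat_adjoint A \<in> carrier_mat m n"
  by (metis carrier_matD carrier_matI mat_adjoint_dim)

lemma mat_adjoint_adjoint [simp]: "mat_adjoint (mat_adjoint A) = (A :: complex mat)"
  by (rule eq_matI) auto

lemma mat_adjoint_mult:
  assumes "A \<in> carrier_mat n m" "B \<in> carrier_mat m l"
  shows "mat_adjoint (A * B) = mat_adjoint B * mat_adjoint (A :: complex mat)"
  by (rule eq_matI) (use assms in \<open>auto simp: scalar_prod_def mult.commute intro!: sum.cong\<close>)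

lemma mat_adjoint_one [simp]: "mat_adjoint (1\<^sub>m n) = (1\<^sub>m n :: complex mat)"
  by (rule eq_matI) auto

lemma mat_adjoint_minus:
  assumes "A \<in> carrier_mat n m" "B \<in> carrier_mat n m"
  shows "mat_adjoint (A - B) = mat_adjoint A - mat_adjoint (B :: complex mat)"
  by (rule eq_matI) (use assms in auto)

lemma mat_adjoint_diag [simp]:
  "mat_adjoint (mat_diag n (\<lambda>i. complex_of_real (d i))) = mat_diag n (\<lambda>i. complex_of_real (d i))"
  by (rule eq_matI) (auto simp: mat_diag_def)

lemma mat_adjoint_scalar_prod:
  assumes "A \<in> carrier_mat n m" "v \<in> carrier_vec m" "w \<in> carrier_vec n"
  shows "(A *\<^sub>v v) \<bullet>c w = v \<bullet>c (mat_adjoint A *\<^sub>v (w :: complex vec))"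
proof -
  have "(A *\<^sub>v v) \<bullet>c w = (\<Sum>i<n. \<Sum>j<m. A $$ (i, j) * v $ j * cnj (w $ i))"
    using assms by (auto simp: scalar_prod_def sum_distrib_right atLeast0LessThan intro!: sum.cong)
  also have "\<dots> = (\<Sum>j<m. \<Sum>i<n. A $$ (i, j) * v $ j * cnj (w $ i))"
    by (rule sum.swap)
  also have "\<dots> = v \<bullet>c (mat_adjoint A *\<^sub>v w)"
    using assms
    by (auto simp: scalar_prod_def sum_distrib_left atLeast0LessThan mult_ac intro!: sum.cong)
  finally show ?thesis .
qed

definition sqnorm :: "complex vec \<Rightarrow> real" where
  "sqnorm v = Re (v \<bullet>c v)"

lemma sqnorm_eq: "v \<in> carrier_vec n \<Longrightarrow> sqnorm v = (\<Sum>i<n. (cmod (v $ i))\<^sup>2)"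
  by (simp add: sqnorm_def scalar_prod_def atLeast0LessThan complex_mult_cnj cmod_power2)

lemma sqnorm_nonneg [simp]: "0 \<le> sqnorm v"
  using sqnorm_eq[of v "dim_vec v"] by (simp add: sum_nonneg)

lemma sqnorm_eq_0_iff:
  assumes v: "v \<in> carrier_vec n"
  shows "sqnorm v = 0 \<longleftrightarrow> v = 0\<^sub>v n"
proof -
  have "sqnorm v = 0 \<longleftrightarrow> (\<forall>i<n. v $ i = 0)"
    using sqnorm_eq[OF v] by (simp add: sum_nonneg_eq_0_iff Ball_def)
  thus ?thesis using v by (auto intro: eq_vecI)
qed

text \<open>AM-GM in each coordinate. In \<open>form_le_midpoint\<close> it does the work of
  Cauchy-Schwarz: both vectors there have squared norm at most \<open>sqnorm w\<close>, so their
  mean is bounded by the same number.\<close>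

lemma Re_scalar_prod_le:
  assumes "v \<in> carrier_vec n" "w \<in> carrier_vec n"
  shows "Re (v \<bullet>c w) \<le> (sqnorm v + sqnorm w) / 2"
proof -
  have *: "Re (a * cnj b) \<le> ((cmod a)\<^sup>2 + (cmod b)\<^sup>2) / 2" for a b
    using sum_squares_bound[of "cmod a" "cmod b"] complex_Re_le_cmod[of "a * cnj b"]
    by (simp add: norm_mult)
  have "Re (v \<bullet>c w) = (\<Sum>i<n. Re (v $ i * cnj (w $ i)))"
    using assms by (simp add: scalar_prod_def atLeast0LessThan)
  also have "\<dots> \<le> (\<Sum>i<n. ((cmod (v $ i))\<^sup>2 + (cmod (w $ i))\<^sup>2) / 2)"
    by (intro sum_mono *)
  also have "\<dots> = (sqnorm v + sqnorm w) / 2"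
    using assms by (simp add: sqnorm_eq sum.distrib flip: sum_divide_distrib)
  finally show ?thesis .
qed

definition qform :: "complex mat \<Rightarrow> complex vec \<Rightarrow> real" where
  "qform A v = Re ((A *\<^sub>v v) \<bullet>c v)"

definition hermitian_mats :: "nat \<Rightarrow> complex mat set" where
  "hermitian_mats n = {A \<in> carrier_mat n n. mat_adjoint A = A}"

lemma psd_mats_iff: "A \<in> psd_mats n \<longleftrightarrow> A \<in> hermitian_mats n \<and> (\<forall>v\<in>carrier_vec n. 0 \<le> qform A v)"
  by (auto simp: psd_mats_def hermitian_mats_def qform_def)

lemma pd_mats_iff:
  "A \<in> pd_mats n \<longleftrightarrow> A \<in> hermitian_mats n \<and> (\<forall>v\<in>carrier_vec n. v \<noteq> 0\<^sub>v n \<longrightarrow> 0 < qform A v)"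
  by (auto simp: pd_mats_def hermitian_mats_def qform_def)

lemma hermitian_carrier [simp]: "A \<in> hermitian_mats n \<Longrightarrow> A \<in> carrier_mat n n"
  and hermitian_adjoint: "A \<in> hermitian_mats n \<Longrightarrow> mat_adjoint A = A"
  and hermitian_matsI: "A \<in> carrier_mat n n \<Longrightarrow> mat_adjoint A = A \<Longrightarrow> A \<in> hermitian_mats n"
  by (auto simp: hermitian_mats_def)

lemma psd_hermitian [simp]: "A \<in> psd_mats n \<Longrightarrow> A \<in> hermitian_mats n"
  by (simp add: psd_mats_iff)

lemma psd_carrier [simp]: "A \<in> psd_mats n \<Longrightarrow> A \<in> carrier_mat n n"
  by simp

lemma pd_psd [simp]: "A \<in> pd_mats n \<Longrightarrow> A \<in> psd_mats n"
proof -
  assume A: "A \<in> pd_mats n"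
  have "0 \<le> qform A v" if "v \<in> carrier_vec n" for v
  proof (cases "v = 0\<^sub>v n")
    case True
    have "A *\<^sub>v v \<in> carrier_vec n"
      using A that by (intro mult_mat_vec_carrier[of _ n n]) (simp_all add: pd_mats_def)
    thus ?thesis using True by (simp add: qform_def)
  next
    case False
    thus ?thesis using A that by (auto simp: pd_mats_iff intro: less_imp_le)
  qed
  thus ?thesis using A by (simp add: pd_mats_iff psd_mats_iff)
qed

lemma pd_carrier [simp]: "A \<in> pd_mats n \<Longrightarrow> A \<in> carrier_mat n n"
  by simp

subsection \<open>The spectral theorem\<close>

lemma mat_diag_dims [simp]: "dim_row (mat_diag n d) = n" "dim_col (mat_diag n d) = n"
  by (simp_all add: mat_diag_def)

lemma mat_diag_index: "i < n \<Longrightarrow> j < n \<Longrightarrow> mat_diag n d $$ (i, j) = (if i = j then d j else 0)"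
  by (simp add: mat_diag_def)

text \<open>Prepares deflation, where an eigenvector has to become the first column of a unitary.
  Gram-Schmidt started at \<open>v\<close> keeps \<open>v\<close> and yields orthogonal nonzero
  vectors; the factors \<open>s\<close> normalize them, which is where the scalar \<open>c\<close>
  comes from.\<close>

lemma unitary_completion:
  assumes v: "v \<in> carrier_vec n" "v \<noteq> 0\<^sub>v n"
  shows "\<exists>W :: complex mat. \<exists>c. W \<in> carrier_mat n n \<and> mat_adjoint W * W = 1\<^sub>m n \<and> col W 0 = c \<cdot>\<^sub>v v"
proof -
  interpret cof_vec_space n "TYPE(complex)" .
  have n: "n > 0" using v by (cases n) auto
  define b where "b = basis_completion v"
  define ws where "ws = gram_schmidt n b"
  from basis_completion[OF v, folded b_def]
  have span_b: "span (set b) = carrier_vec n" and dist_b: "distinct b" 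
    and indep: "\<not> lin_dep (set b)" and b: "set b \<subseteq> carrier_vec n" and hdb: "hd b = v" 
    and len_b: "length b = n" by auto
  from hdb len_b n obtain vs where bv: "b = v # vs" by (cases b, auto)
  from gram_schmidt_result[OF b dist_b indep refl, folded ws_def]
  have ws: "set ws \<subseteq> carrier_vec n" "corthogonal ws" "length ws = n" 
    by (auto simp: len_b)
  from gram_schmidt_hd[OF v(1), of vs, folded bv] have hdws: "hd ws = v" unfolding ws_def .
  have wsi: "ws ! i \<in> carrier_vec n" if "i < n" for i
    using that ws by auto
  have pos: "sqnorm (ws ! i) > 0" if "i < n" for i
  proof -
    have "ws ! i \<bullet>c ws ! i \<noteq> 0"
      using ws corthogonalD[of ws i i] that by auto
    hence "sqnorm (ws ! i) \<noteq> 0"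
      using wsi[OF that] conjugate_square_eq_0_vec[of "ws ! i" n] sqnorm_eq_0_iff[of "ws ! i" n]
      by auto
    thus ?thesis using sqnorm_nonneg[of "ws ! i"] by linarith
  qed
  define s where "s = (\<lambda>i. complex_of_real (1 / sqrt (sqnorm (ws ! i))))"
  define W where "W = mat n n (\<lambda>(i, j). s j * ws ! j $ i)"
  have W: "W \<in> carrier_mat n n" by (simp add: W_def)
  have "(mat_adjoint W * W) $$ (i, j) = (1\<^sub>m n) $$ (i, j)" if ij: "i < n" "j < n" for i j
  proof -
    have "(mat_adjoint W * W) $$ (i, j) = (\<Sum>k<n. cnj (W $$ (k, i)) * W $$ (k, j))"
      using W ij by (simp add: scalar_prod_def atLeast0LessThan)
    also have "\<dots> = cnj (s i) * s j * (\<Sum>k<n. ws ! j $ k * cnj (ws ! i $ k))"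
      unfolding sum_distrib_left
      using ij by (intro sum.cong) (auto simp: W_def)
    also have "(\<Sum>k<n. ws ! j $ k * cnj (ws ! i $ k)) = ws ! j \<bullet>c ws ! i"
      using wsi[OF ij(1)] wsi[OF ij(2)] by (simp add: scalar_prod_def atLeast0LessThan)
    also have "cnj (s i) * s j * (ws ! j \<bullet>c ws ! i) = (1\<^sub>m n) $$ (i, j)"
    proof (cases "i = j")
      case True
      have "Im (ws ! j \<bullet>c ws ! j) = 0"
        using conjugate_square_ge_0_vec[of "ws ! j"] by (simp add: less_eq_complex_def)
      hence "ws ! j \<bullet>c ws ! j = complex_of_real (sqnorm (ws ! j))"
        by (simp add: complex_eq_iff sqnorm_def)
      moreover have "1 / sqrt (sqnorm (ws ! j)) * (1 / sqrt (sqnorm (ws ! j))) * sqnorm (ws ! j) = 1"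
        using pos[OF ij(2)] by (simp add: field_simps)
      ultimately have "cnj (s j) * s j * (ws ! j \<bullet>c ws ! j) = 1"
        unfolding s_def complex_cnj_complex_of_real by (metis of_real_1 of_real_mult)
      thus ?thesis using True ij by simp
    next
      case False
      hence "ws ! j \<bullet>c ws ! i = 0"
        using ws corthogonalD[of ws j i] ij by auto
      thus ?thesis using False ij by simp
    qed
    finally show ?thesis .
  qed
  hence "mat_adjoint W * W = 1\<^sub>m n"
    using W by (intro eq_matI) auto
  moreover have "col W 0 = s 0 \<cdot>\<^sub>v v"
  proof -
    have "ws ! 0 = v" using n hdws ws by (cases ws) auto
    thus ?thesis using n v by (intro eq_vecI) (auto simp: W_def)
  qed
  ultimately show ?thesis using W by blast
qed

lemma unitary_right:
  assumes "U \<in> carrier_mat n n" "mat_adjoint U * U = 1\<^sub>m n"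
  shows "U * mat_adjoint U = (1\<^sub>m n :: complex mat)"
  using assms mat_mult_left_right_inverse[of "mat_adjoint U" n U] by simp

lemma complex_eigenvalue_exists:
  assumes A: "(A :: complex mat) \<in> carrier_mat n n" and n: "n > 0"
  shows "\<exists>v c. v \<in> carrier_vec n \<and> v \<noteq> 0\<^sub>v n \<and> A *\<^sub>v v = c \<cdot>\<^sub>v v"
proof -
  have "degree (char_poly A) = n" using degree_monic_char_poly[OF A] by simp
  hence "\<exists>c. poly (char_poly A) c = 0"
    using n fundamental_theorem_of_algebra[of "char_poly A"] by (simp add: constant_degree)
  then obtain c where "eigenvalue A c" using eigenvalue_root_char_poly[OF A] by auto
  thus ?thesis using A by (auto simp: eigenvalue_def eigenvector_def)
qed

lemma one_by_one_block:
  assumes A: "A \<in> carrier_mat (Suc m) (Suc m)"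
    and 0: "\<And>j. 0 < j \<Longrightarrow> j < Suc m \<Longrightarrow> A $$ (0, j) = (0::complex)"
      "\<And>j. 0 < j \<Longrightarrow> j < Suc m \<Longrightarrow> A $$ (j, 0) = 0"
  shows "A = four_block_mat (mat 1 1 (\<lambda>_. A $$ (0, 0))) (0\<^sub>m 1 m) (0\<^sub>m m 1)
     (mat m m (\<lambda>(i, j). A $$ (Suc i, Suc j)))"
  using A by (intro eq_matI) (auto simp: 0 Suc_diff_Suc)

text \<open>Deflation by induction on the size. After conjugation by a unitary whose first column is
  an eigenvector, the first column of \<open>B\<close> is \<open>c\<close> times a unit vector;
  symmetry clears the first row and makes \<open>c\<close> real, and the induction hypothesis
  diagonalizes the remaining block \<open>B3\<close>.\<close>

theorem hermitian_unitary_diag: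
  assumes "A \<in> hermitian_mats n"
  shows "\<exists>U d. unitary_diag n U d A"
  using assms
proof (induction n arbitrary: A)
  case 0
  have "unitary_diag 0 (1\<^sub>m 0) (\<lambda>_. 0) A"
    unfolding unitary_diag_def using carrier_matD[OF hermitian_carrier[OF 0]]
    by (intro conjI eq_matI) simp_all
  thus ?case by (intro exI)
next
  case (Suc m A)
  let ?n = "Suc m"
  have A: "A \<in> carrier_mat ?n ?n" and hA: "mat_adjoint A = A"
    using Suc.prems hermitian_adjoint by auto
  obtain v c where v: "v \<in> carrier_vec ?n" "v \<noteq> 0\<^sub>v ?n" "A *\<^sub>v v = c \<cdot>\<^sub>v v"
    using complex_eigenvalue_exists[OF A] by auto
  obtain W s where W: "W \<in> carrier_mat ?n ?n" "mat_adjoint W * W = 1\<^sub>m ?n" "col W 0 = s \<cdot>\<^sub>v v"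
    using unitary_completion[OF v(1,2)] by auto
  define B where "B = mat_adjoint W * A * W"
  have B: "B \<in> carrier_mat ?n ?n" using A W by (auto simp: B_def)
  have hB: "mat_adjoint B = B"
    using A W hA unfolding B_def
    by (simp add: mat_adjoint_mult[of _ ?n ?n _ ?n] assoc_mult_mat[of _ ?n ?n _ ?n _ ?n])
  have colB: "col B 0 = c \<cdot>\<^sub>v unit_vec ?n 0"
  proof -
    have "col B 0 = mat_adjoint W * A *\<^sub>v col W 0"
      unfolding B_def using A W by (subst col_mult2[of _ ?n ?n _ ?n]) auto
    also have "\<dots> = mat_adjoint W *\<^sub>v (A *\<^sub>v col W 0)"
      using A W v(1) by (subst assoc_mult_mat_vec[of _ ?n ?n _ ?n]) auto
    also have "A *\<^sub>v col W 0 = c \<cdot>\<^sub>v col W 0"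
      using v A W by (simp add: mult_mat_vec[of _ ?n ?n] smult_smult_assoc mult.commute)
    also have "mat_adjoint W *\<^sub>v (c \<cdot>\<^sub>v col W 0) = c \<cdot>\<^sub>v (mat_adjoint W *\<^sub>v col W 0)"
      using W v(1) by (intro mult_mat_vec[of _ ?n ?n]) auto
    also have "mat_adjoint W *\<^sub>v col W 0 = col (mat_adjoint W * W) 0"
      using W by (subst col_mult2[of _ ?n ?n _ ?n]) auto
    also have "\<dots> = unit_vec ?n 0" using W by simp
    finally show ?thesis .
  qed
  have B0: "B $$ (j, 0) = (if j = 0 then c else 0)" if "j < ?n" for j
    using arg_cong[OF colB, of "\<lambda>v. v $ j"] B that by (auto simp: unit_vec_def)
  have B0': "B $$ (0, j) = 0" if "j < ?n" "0 < j" for j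
    using arg_cong[OF hB, of "\<lambda>M. M $$ (0, j)"] B B0[of j] that by auto
  have cr: "cnj c = c"
    using arg_cong[OF hB, of "\<lambda>M. M $$ (0, 0)"] B B0[of 0] by auto
  define B3 where "B3 = mat m m (\<lambda>(i, j). B $$ (Suc i, Suc j))"
  have B3: "B3 \<in> hermitian_mats m"
  proof -
    have "cnj (B $$ (Suc j, Suc i)) = B $$ (Suc i, Suc j)" if "i < m" "j < m" for i j
      using arg_cong[OF hB, of "\<lambda>M. M $$ (Suc i, Suc j)"] B that by simp
    hence "mat_adjoint B3 = B3" by (intro eq_matI) (auto simp: B3_def)
    thus ?thesis by (simp add: hermitian_matsI B3_def)
  qed
  have Bblock: "B = four_block_mat (mat 1 1 (\<lambda>_. c)) (0\<^sub>m 1 m) (0\<^sub>m m 1) B3"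
    using one_by_one_block[OF B] B0' B0 unfolding B3_def by simp
  obtain V e where V: "V \<in> carrier_mat m m" "mat_adjoint V * V = 1\<^sub>m m"
    "B3 = V * mat_diag m (\<lambda>i. complex_of_real (e i)) * mat_adjoint V"
    using Suc.IH[OF B3] by (auto simp: unitary_diag_def)
  define V' where "V' = four_block_mat (1\<^sub>m 1) (0\<^sub>m 1 m) (0\<^sub>m m 1) V"
  have V': "V' \<in> carrier_mat ?n ?n"
    using V unfolding V'_def by (metis four_block_carrier_mat one_carrier_mat plus_1_eq_Suc)
  have V'a: "mat_adjoint V' = four_block_mat (1\<^sub>m 1) (0\<^sub>m 1 m) (0\<^sub>m m 1) (mat_adjoint V)"
    using V unfolding V'_def by (intro eq_matI) auto
  define d where "d = (\<lambda>i. case i of 0 \<Rightarrow> Re c | Suc j \<Rightarrow> e j)"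
  have D: "mat_diag ?n (\<lambda>i. complex_of_real (d i)) = four_block_mat (mat 1 1 (\<lambda>_. c))
     (0\<^sub>m 1 m) (0\<^sub>m m 1) (mat_diag m (\<lambda>i. complex_of_real (e i)))"
    using cr by (intro eq_matI) (auto simp: mat_diag_def d_def complex_eq_iff split: nat.splits)
  have Va: "mat_adjoint V \<in> carrier_mat m m" using V by simp
  have V'V': "mat_adjoint V' * V' = 1\<^sub>m ?n"
    unfolding V'a unfolding V'_def
    using V Va by (subst mult_four_block_mat[of _ 1 1 _ m _ m _ _ 1 _ m]) auto
  have BV: "B = V' * mat_diag ?n (\<lambda>i. complex_of_real (d i)) * mat_adjoint V'"
    unfolding V'a D unfolding V'_def
    using V Va
    by (subst mult_four_block_mat[of _ 1 1 _ m _ m _ _ 1 _ m],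
        simp_all add: mult_carrier_mat[of _ m m _ m])
      (subst mult_four_block_mat[of _ 1 1 _ m _ m _ _ 1 _ m],
        simp_all add: Bblock mult_carrier_mat[of _ m m _ m] left_mult_zero_mat[of _ m]
          right_mult_zero_mat[of _ m m])
  define U where "U = W * V'"
  have WW: "W * mat_adjoint W = 1\<^sub>m ?n" using unitary_right[OF W(1,2)] .
  have U: "U \<in> carrier_mat ?n ?n" using W V' by (simp add: U_def)
  note as = assoc_mult_mat[of _ ?n ?n _ ?n _ ?n]
  have Ua: "mat_adjoint U = mat_adjoint V' * mat_adjoint W"
    unfolding U_def using W V' by (intro mat_adjoint_mult) auto
  have canc: "mat_adjoint W * (W * X) = X" "W * (mat_adjoint W * X) = X"
    if "X \<in> carrier_mat ?n ?n" for X
    using that W WW V' by (simp_all add: as[symmetric])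
  have "mat_adjoint U * U = 1\<^sub>m ?n"
    unfolding Ua unfolding U_def using W V' V'V' by (simp add: as canc)
  moreover have "A = W * B * mat_adjoint W"
    unfolding B_def using W WW A by (simp add: as canc)
  hence "A = U * mat_diag ?n (\<lambda>i. complex_of_real (d i)) * mat_adjoint U"
    unfolding BV Ua using U_def W V' by (simp add: as mult_carrier_mat[of _ ?n ?n _ ?n])
  ultimately show ?case using U by (auto simp: unitary_diag_def)
qed

subsection \<open>Quadratic forms and functional calculus\<close>

lemma square_mult_closed:
  fixes A B :: "complex mat"
  shows "A \<in> carrier_mat n n \<Longrightarrow> B \<in> carrier_mat n n \<Longrightarrow> A * B \<in> carrier_mat n n"
  by simp

lemma square_mult_assoc:
  fixes A B C :: "complex mat"
  shows "A \<in> carrier_mat n n \<Longrightarrow> B \<in> carrier_mat n n \<Longrightarrow> C \<in> carrier_mat n n \<Longrightarrow> A * B * C = A * (B * C)"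
  by simp

lemma square_adjoint_mult:
  fixes A B :: "complex mat"
  shows "A \<in> carrier_mat n n \<Longrightarrow> B \<in> carrier_mat n n \<Longrightarrow> mat_adjoint (A * B) = mat_adjoint B * mat_adjoint A"
  by (rule mat_adjoint_mult)

lemma square_mult_vec_closed:
  fixes A :: "complex mat"
  shows "A \<in> carrier_mat n n \<Longrightarrow> v \<in> carrier_vec n \<Longrightarrow> A *\<^sub>v v \<in> carrier_vec n"
  by (rule mult_mat_vec_carrier)

lemma square_mult_vec_assoc:
  fixes A B :: "complex mat"
  shows "A \<in> carrier_mat n n \<Longrightarrow> B \<in> carrier_mat n n \<Longrightarrow> v \<in> carrier_vec n \<Longrightarrow> A * B *\<^sub>v v = A *\<^sub>v (B *\<^sub>v v)"
  by (rule assoc_mult_mat_vec)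

lemmas square_simps = square_mult_closed square_mult_assoc square_adjoint_mult
  square_mult_vec_closed square_mult_vec_assoc

lemma unitary_diagD:
  assumes "unitary_diag n U d A"
  shows "U \<in> carrier_mat n n" "A \<in> carrier_mat n n" "mat_adjoint U * U = 1\<^sub>m n"
    "U * mat_adjoint U = 1\<^sub>m n"
    "A = U * mat_diag n (\<lambda>i. complex_of_real (d i)) * mat_adjoint U"
proof -
  show *: "U \<in> carrier_mat n n" "mat_adjoint U * U = 1\<^sub>m n"
    "A = U * mat_diag n (\<lambda>i. complex_of_real (d i)) * mat_adjoint U"
    using assms by (simp_all add: unitary_diag_def)
  show "A \<in> carrier_mat n n" unfolding *(3)
    using *(1) by (intro mult_carrier_mat[of _ n n]) auto
  show "U * mat_adjoint U = 1\<^sub>m n" using unitary_right *(1,2) .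
qed

lemma unitary_cancel:
  assumes "U \<in> carrier_mat n n" "mat_adjoint U * U = 1\<^sub>m n" "X \<in> carrier_mat n n"
  shows "mat_adjoint U * (U * X) = X" "U * (mat_adjoint U * X) = (X :: complex mat)"
  using assms unitary_right[OF assms(1,2)]
  by (simp_all flip: assoc_mult_mat[of _ n n _ n _ n])

lemma unitary_diag_hermitian:
  assumes "unitary_diag n U d A"
  shows "A \<in> hermitian_mats n"
proof -
  note U = unitary_diagD[OF assms]
  have "mat_adjoint A = A"
    unfolding U(5) using U(1)
    by (simp add: square_simps[where n=n])
  thus ?thesis using U(2) by (intro hermitian_matsI)
qed

lemma mat_diag_mult_vec:
  assumes "v \<in> carrier_vec n" "i < n"
  shows "(mat_diag n d *\<^sub>v v) $ i = d i * (v $ i :: complex)"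
proof -
  have "(mat_diag n d *\<^sub>v v) $ i = (\<Sum>j<n. mat_diag n d $$ (i, j) * v $ j)"
    using assms by (simp add: scalar_prod_def atLeast0LessThan)
  also have "\<dots> = (\<Sum>j<n. if i = j then d j * v $ j else 0)"
    using assms by (intro sum.cong) (auto simp: mat_diag_index)
  finally show ?thesis using assms by simp
qed

text \<open>All functions of one matrix have forms with the same nonnegative weights, so comparing
  two of them reduces to a termwise comparison of eigenvalues.\<close>

lemma qform_unitary_diag:
  assumes "unitary_diag n U d A" "v \<in> carrier_vec n"
  shows "qform A v = (\<Sum>i<n. d i * (cmod ((mat_adjoint U *\<^sub>v v) $ i))\<^sup>2)"
proof -
  note U = unitary_diagD[OF assms(1)]
  let ?D = "mat_diag n (\<lambda>i. complex_of_real (d i))"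
  define w where "w = mat_adjoint U *\<^sub>v v"
  have w: "w \<in> carrier_vec n"
    unfolding w_def using U assms by (intro mult_mat_vec_carrier[of _ n n]) auto
  have D: "?D \<in> carrier_mat n n" by simp
  have Dw: "?D *\<^sub>v w \<in> carrier_vec n"
    using D w by (rule mult_mat_vec_carrier)
  have "A *\<^sub>v v = U *\<^sub>v (?D *\<^sub>v w)"
    unfolding U(5) w_def using U(1) assms(2) D
    by (subst assoc_mult_mat_vec[of _ n n _ n], simp_all add: mult_carrier_mat[of _ n n _ n])
       (subst assoc_mult_mat_vec[of _ n n _ n], simp_all add: mult_mat_vec_carrier[of _ n n])
  hence "(A *\<^sub>v v) \<bullet>c v = (?D *\<^sub>v w) \<bullet>c w"
    using mat_adjoint_scalar_prod[OF U(1) Dw assms(2)] by (simp add: w_def)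
  also have "\<dots> = (\<Sum>i<n. complex_of_real (d i * (cmod (w $ i))\<^sup>2))"
    using w carrier_vecD[OF Dw]
    by (simp add: scalar_prod_def atLeast0LessThan mat_diag_mult_vec complex_mult_cnj cmod_power2
        mult.assoc del: index_mult_mat_vec)
  finally show ?thesis by (simp add: qform_def w_def)
qed

lemma qform_one: "v \<in> carrier_vec n \<Longrightarrow> qform (1\<^sub>m n) v = sqnorm v"
  by (simp add: qform_def sqnorm_def)

lemma unitary_diag_one:
  assumes "unitary_diag n U d A"
  shows "unitary_diag n U (\<lambda>_. 1) (1\<^sub>m n)"
  using unitary_diagD[OF assms] by (simp add: unitary_diag_def)

lemma unitary_diag_col:
  assumes "unitary_diag n U d A" "i < n"
  shows "col U i \<in> carrier_vec n" "qform A (col U i) = d i" "sqnorm (col U i) = 1"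
    "A *\<^sub>v col U i = complex_of_real (d i) \<cdot>\<^sub>v col U i"
proof -
  note U = unitary_diagD[OF assms(1)]
  show c: "col U i \<in> carrier_vec n" using U by auto
  have e: "mat_adjoint U *\<^sub>v col U i = unit_vec n i"
    using U assms(2) col_mult2[of "mat_adjoint U" n n U n i] by simp
  have *: "(\<Sum>j<n. e j * (cmod ((mat_adjoint U *\<^sub>v col U i) $ j))\<^sup>2) = e i" for e :: "nat \<Rightarrow> real"
  proof -
    have "(\<Sum>j<n. e j * (cmod ((mat_adjoint U *\<^sub>v col U i) $ j))\<^sup>2) = (\<Sum>j<n. if i = j then e j else 0)"
      unfolding e by (intro sum.cong) (auto simp: unit_vec_def)
    thus ?thesis using assms(2) by simp
  qed
  show "qform A (col U i) = d i"
    using qform_unitary_diag[OF assms(1) c] * by simp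
  show "sqnorm (col U i) = 1"
    using qform_unitary_diag[OF unitary_diag_one[OF assms(1)] c] *[of "\<lambda>_. 1"] qform_one[OF c] by simp
  let ?D = "mat_diag n (\<lambda>i. complex_of_real (d i))"
  have D: "?D \<in> carrier_mat n n" by simp
  have "A *\<^sub>v col U i = U *\<^sub>v (?D *\<^sub>v unit_vec n i)"
    unfolding U(5) e[symmetric] using U(1) c D
    by (subst assoc_mult_mat_vec[of _ n n _ n], simp_all add: mult_carrier_mat[of _ n n _ n])
       (subst assoc_mult_mat_vec[of _ n n _ n], simp_all add: mult_mat_vec_carrier[of _ n n])
  also have "?D *\<^sub>v unit_vec n i = complex_of_real (d i) \<cdot>\<^sub>v unit_vec n i"
    using carrier_matD[OF D]
    by (intro eq_vecI) (auto simp: mat_diag_mult_vec unit_vec_def simp del: index_mult_mat_vec)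
  also have "U *\<^sub>v (complex_of_real (d i) \<cdot>\<^sub>v unit_vec n i) = complex_of_real (d i) \<cdot>\<^sub>v (U *\<^sub>v unit_vec n i)"
    using U(1) by (intro mult_mat_vec[of _ n n]) auto
  also have "U *\<^sub>v unit_vec n i = col U i"
    using U(1) assms(2) by (intro eq_vecI) auto
  finally show "A *\<^sub>v col U i = complex_of_real (d i) \<cdot>\<^sub>v col U i" .
qed

lemma unitary_diag_psd_iff:
  assumes "unitary_diag n U d A"
  shows "A \<in> psd_mats n \<longleftrightarrow> (\<forall>i<n. 0 \<le> d i)"
proof
  assume "A \<in> psd_mats n"
  thus "\<forall>i<n. 0 \<le> d i"
    using unitary_diag_col[OF assms] by (force simp: psd_mats_iff)
next
  assume "\<forall>i<n. 0 \<le> d i"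
  thus "A \<in> psd_mats n"
    using unitary_diag_hermitian[OF assms] qform_unitary_diag[OF assms]
    by (auto simp: psd_mats_iff intro!: sum_nonneg)
qed

lemma unitary_diag_pd_iff:
  assumes "unitary_diag n U d A"
  shows "A \<in> pd_mats n \<longleftrightarrow> (\<forall>i<n. 0 < d i)"
proof
  assume A: "A \<in> pd_mats n"
  show "\<forall>i<n. 0 < d i"
  proof (intro allI impI)
    fix i assume "i < n"
    note c = unitary_diag_col[OF assms this]
    hence "col U i \<noteq> 0\<^sub>v n" using sqnorm_eq_0_iff[OF c(1)] by simp
    thus "0 < d i" using A c by (force simp: pd_mats_iff)
  qed
next
  assume d: "\<forall>i<n. 0 < d i"
  have "0 < qform A v" if v: "v \<in> carrier_vec n" "v \<noteq> 0\<^sub>v n" for v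
  proof -
    note s = qform_unitary_diag[OF unitary_diag_one[OF assms] v(1), unfolded qform_one[OF v(1)]]
    have "sqnorm v \<noteq> 0" using v sqnorm_eq_0_iff by blast
    then obtain i where i: "i < n" "(cmod ((mat_adjoint U *\<^sub>v v) $ i))\<^sup>2 \<noteq> 0"
      unfolding s by (metis (no_types, lifting) lessThan_iff mult_1 sum.not_neutral_contains_not_neutral)
    have "0 < d i * (cmod ((mat_adjoint U *\<^sub>v v) $ i))\<^sup>2" using i d by simp
    also have "\<dots> \<le> qform A v"
      unfolding qform_unitary_diag[OF assms v(1)]
      using i d by (intro member_le_sum) (auto intro: less_imp_le)
    finally show ?thesis .
  qed
  thus "A \<in> pd_mats n" using unitary_diag_hermitian[OF assms] by (auto simp: pd_mats_iff)
qed

text \<open>In the two eigenbases \<open>K\<close> becomes \<open>W\<close>, and the hypothesis says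
  that the entry (i, j) of \<open>W\<close> times \<open>d j\<close> equals \<open>e i\<close> times
  that entry. Where the entry is nonzero, \<open>d j = e i\<close> and so
  \<open>f (d j) = f (e i)\<close>.\<close>

lemma unitary_diag_intertwine:
  assumes A: "unitary_diag n U d A" and B: "unitary_diag n V e B"
    and K: "K \<in> carrier_mat n n" "K * A = B * K"
    and A': "unitary_diag n U (\<lambda>i. f (d i)) A'" and B': "unitary_diag n V (\<lambda>i. f (e i)) B'"
  shows "K * A' = B' * K"
proof -
  note U = unitary_diagD[OF A] and V = unitary_diagD[OF B]
  note U' = unitary_diagD[OF A'] and V' = unitary_diagD[OF B']
  note as = square_simps[where n=n]
  note cu = unitary_cancel[OF U(1,3)] and cv = unitary_cancel[OF V(1,3)]
  let ?D = "mat_diag n (\<lambda>i. complex_of_real (d i))" and ?E = "mat_diag n (\<lambda>i. complex_of_real (e i))"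
  let ?D' = "mat_diag n (\<lambda>i. complex_of_real (f (d i)))" and ?E' = "mat_diag n (\<lambda>i. complex_of_real (f (e i)))"
  define W where "W = mat_adjoint V * K * U"
  have W: "W \<in> carrier_mat n n" using U V K by (auto simp: W_def)
  have "W * ?D = mat_adjoint V * (K * A) * U"
    unfolding U(5) W_def using U(1,3) V(1) K by (simp add: as)
  also have "\<dots> = ?E * W"
    unfolding K(2) unfolding V(5) W_def using U(1) V(1) K by (simp add: as cv)
  finally have WD: "W * ?D = ?E * W" .
  have "W * ?D' = ?E' * W"
  proof (rule eq_matI)
    fix i j assume "i < dim_row (?E' * W)" "j < dim_col (?E' * W)"
    hence ij: "i < n" "j < n" using W carrier_matD[OF mat_diag_dim[of n]] by auto
    have "(W * mat_diag n (\<lambda>i. complex_of_real (d i))) $$ (i, j) = W $$ (i, j) * complex_of_real (d j)" for d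
      using ij W by (simp add: mat_diag_mult_right[OF W])
    moreover have "(mat_diag n (\<lambda>i. complex_of_real (e i)) * W) $$ (i, j) = complex_of_real (e i) * W $$ (i, j)" for e
      using ij W by (simp add: mat_diag_mult_left[OF W])
    ultimately show "(W * ?D') $$ (i, j) = (?E' * W) $$ (i, j)"
      using ij W arg_cong[OF WD, of "\<lambda>M. M $$ (i, j)"]
      by (cases "W $$ (i, j) = 0")
        (auto simp: mat_diag_mult_right[OF W] mat_diag_mult_left[OF W])
  qed (use W in auto)
  have "K * A' = V * (W * ?D') * mat_adjoint U"
    unfolding U'(5) W_def using U(1) V(1) K by (simp add: as cv)
  also have "\<dots> = B' * K"
    unfolding \<open>W * ?D' = ?E' * W\<close> unfolding V'(5) W_def using U(1,4) V(1) K by (simp add: as)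
  finally show ?thesis .
qed

lemma unitary_diag_map:
  assumes "unitary_diag n U d A"
  shows "unitary_diag n U (\<lambda>i. f (d i)) (U * mat_diag n (\<lambda>i. complex_of_real (f (d i))) * mat_adjoint U)"
  using assms by (simp add: unitary_diag_def)

text \<open>Makes the definite description usable: intertwining with the identity matrix shows that
  two diagonalizations of \<open>A\<close> lead to the same value of \<open>f\<close> at
  \<open>A\<close>.\<close>

lemma fun_calc_unitary_diag:
  assumes A: "unitary_diag n U d A"
  shows "unitary_diag n U (\<lambda>i. f (d i)) (fun_calc f A)"
proof -
  let ?B = "U * mat_diag n (\<lambda>i. complex_of_real (f (d i))) * mat_adjoint U"
  have n: "dim_row A = n" using unitary_diagD[OF A] by simp
  have "fun_calc f A = ?B"
    unfolding fun_calc_def n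
  proof (rule the_equality)
    show "\<exists>U d. unitary_diag n U d A \<and> unitary_diag n U (\<lambda>i. f (d i)) ?B"
      using A unitary_diag_map[OF A] by blast
    fix B assume "\<exists>U d. unitary_diag n U d A \<and> unitary_diag n U (\<lambda>i. f (d i)) B"
    then obtain V e where V: "unitary_diag n V e A" "unitary_diag n V (\<lambda>i. f (e i)) B" by blast
    have "1\<^sub>m n * B = ?B * 1\<^sub>m n"
      using unitary_diagD[OF A]
      by (intro unitary_diag_intertwine[OF V(1) A _ _ V(2) unitary_diag_map[OF A]]) auto
    thus "B = ?B" using unitary_diagD[OF V(2)] unitary_diagD[OF unitary_diag_map[OF A, of f]] by simp
  qed
  thus ?thesis using unitary_diag_map[OF A] by simp
qed

lemma unitary_diag_unique:
  "unitary_diag n U d A \<Longrightarrow> unitary_diag n U d' B \<Longrightarrow> (\<And>i. i < n \<Longrightarrow> d i = d' i) \<Longrightarrow> A = B"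
proof -
  assume *: "unitary_diag n U d A" "unitary_diag n U d' B" "\<And>i. i < n \<Longrightarrow> d i = d' i"
  have "mat_diag n (\<lambda>i. complex_of_real (d i)) = mat_diag n (\<lambda>i. complex_of_real (d' i))"
    using *(3) by (intro eq_matI) (auto simp: mat_diag_def)
  thus "A = B" using *(1,2) by (simp add: unitary_diag_def)
qed

lemma fun_calc_hermitian [simp]:
  assumes "A \<in> hermitian_mats n"
  shows "fun_calc f A \<in> hermitian_mats n"
proof -
  obtain U d where "unitary_diag n U d A" using hermitian_unitary_diag[OF assms] by blast
  thus ?thesis using fun_calc_unitary_diag unitary_diag_hermitian by blast
qed

lemma fun_calc_intertwine:
  assumes "A \<in> hermitian_mats n" "B \<in> hermitian_mats n" "K \<in> carrier_mat n n" "K * A = B * K"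
  shows "K * fun_calc f A = fun_calc f B * K"
proof -
  obtain U d V e where *: "unitary_diag n U d A" "unitary_diag n V e B"
    using hermitian_unitary_diag assms(1,2) by blast
  show ?thesis
    by (rule unitary_diag_intertwine[OF * assms(3,4) fun_calc_unitary_diag[OF *(1)]
          fun_calc_unitary_diag[OF *(2)]])
qed

lemma unitary_diag_mult:
  assumes "unitary_diag n U d A" "unitary_diag n U e B"
  shows "unitary_diag n U (\<lambda>i. d i * e i) (A * B)"
proof -
  note U = unitary_diagD[OF assms(1)] and B = unitary_diagD[OF assms(2)]
  have "A * B = U * (mat_diag n (\<lambda>i. complex_of_real (d i)) * mat_diag n (\<lambda>i. complex_of_real (e i))) * mat_adjoint U"
    unfolding U(5) B(5) using U(1)
    by (simp add: square_simps[where n=n] unitary_cancel[OF U(1,3)] del: mat_diag_diag)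
  thus ?thesis using U by (simp add: unitary_diag_def)
qed

lemma fun_calc_mult:
  assumes "A \<in> hermitian_mats n"
  shows "fun_calc f A * fun_calc g A = fun_calc (\<lambda>x. f x * g x) A"
proof -
  obtain U d where *: "unitary_diag n U d A" using hermitian_unitary_diag[OF assms] by blast
  show ?thesis
    using unitary_diag_mult[OF fun_calc_unitary_diag[OF *] fun_calc_unitary_diag[OF *]]
      fun_calc_unitary_diag[OF *] by (rule unitary_diag_unique) simp
qed

lemma fun_calc_compose:
  assumes "A \<in> hermitian_mats n"
  shows "fun_calc g (fun_calc f A) = fun_calc (\<lambda>x. g (f x)) A"
proof -
  obtain U d where *: "unitary_diag n U d A" using hermitian_unitary_diag[OF assms] by blast
  show ?thesis
    using fun_calc_unitary_diag[OF fun_calc_unitary_diag[OF *]]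
      fun_calc_unitary_diag[OF *] by (rule unitary_diag_unique) simp
qed

lemma fun_calc_id:
  assumes "A \<in> hermitian_mats n"
  shows "fun_calc (\<lambda>x. x) A = A"
proof -
  obtain U d where *: "unitary_diag n U d A" using hermitian_unitary_diag[OF assms] by blast
  show ?thesis
    using fun_calc_unitary_diag[OF *] * by (rule unitary_diag_unique) simp
qed

lemma fun_calc_1:
  assumes "A \<in> hermitian_mats n"
  shows "fun_calc (\<lambda>_. 1) A = 1\<^sub>m n"
proof -
  obtain U d where *: "unitary_diag n U d A" using hermitian_unitary_diag[OF assms] by blast
  show ?thesis
    using fun_calc_unitary_diag[OF *] unitary_diag_one[OF *] by (rule unitary_diag_unique) simp
qed

lemma unitary_diag_smult:
  assumes "unitary_diag n U d A"
  shows "unitary_diag n U (\<lambda>i. c * d i) (complex_of_real c \<cdot>\<^sub>m A)"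
proof -
  note U = unitary_diagD[OF assms]
  have "mat_diag n (\<lambda>i. complex_of_real (c * d i)) = complex_of_real c \<cdot>\<^sub>m mat_diag n (\<lambda>i. complex_of_real (d i))"
    by (intro eq_matI) (auto simp: mat_diag_def)
  hence "complex_of_real c \<cdot>\<^sub>m A = U * mat_diag n (\<lambda>i. complex_of_real (c * d i)) * mat_adjoint U"
    unfolding U(5) using U(1)
    by (simp add: mult_smult_distrib[of _ n n _ n] mult_smult_assoc_mat[of _ n n _ n])
  thus ?thesis using U by (simp add: unitary_diag_def)
qed

lemma unitary_diag_add:
  assumes "unitary_diag n U d A" "unitary_diag n U e B"
  shows "unitary_diag n U (\<lambda>i. d i + e i) (A + B)"
proof -
  note U = unitary_diagD[OF assms(1)] and B = unitary_diagD[OF assms(2)]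
  have "mat_diag n (\<lambda>i. complex_of_real (d i + e i)) =
      mat_diag n (\<lambda>i. complex_of_real (d i)) + mat_diag n (\<lambda>i. complex_of_real (e i))"
    by (intro eq_matI) (auto simp: mat_diag_def)
  hence "A + B = U * mat_diag n (\<lambda>i. complex_of_real (d i + e i)) * mat_adjoint U"
    unfolding U(5) B(5) using U(1)
    by (simp add: mult_add_distrib_mat[of _ n n _ n] add_mult_distrib_mat[of _ n n _ _ n])
  thus ?thesis using U by (simp add: unitary_diag_def)
qed

subsection \<open>The Loewner order on quadratic forms\<close>

text \<open>The Loewner order, phrased through values of quadratic forms rather than membership of
  the difference in \<open>psd_mats\<close>, so that chaining and sandwiching can be done vector by
  vector.\<close>

definition form_le :: "nat \<Rightarrow> complex mat \<Rightarrow> complex mat \<Rightarrow> bool" where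
  "form_le n A B \<longleftrightarrow> (\<forall>v\<in>carrier_vec n. qform A v \<le> qform B v)"

lemma form_le_trans [trans]: "form_le n A B \<Longrightarrow> form_le n B C \<Longrightarrow> form_le n A C"
  by (force simp: form_le_def)

lemma qform_sandwich:
  assumes "K \<in> carrier_mat n n" "A \<in> carrier_mat n n" "v \<in> carrier_vec n"
  shows "qform (mat_adjoint K * A * K) v = qform A (K *\<^sub>v v)"
proof -
  have Kv: "K *\<^sub>v v \<in> carrier_vec n" "A *\<^sub>v (K *\<^sub>v v) \<in> carrier_vec n"
    using assms by (auto intro!: mult_mat_vec_carrier)
  have "(mat_adjoint K * A * K) *\<^sub>v v = mat_adjoint K *\<^sub>v (A *\<^sub>v (K *\<^sub>v v))"
    using assms Kv by (simp add: square_simps[where n=n])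
  thus ?thesis
    using mat_adjoint_scalar_prod[of "mat_adjoint K" n n "A *\<^sub>v (K *\<^sub>v v)" v] assms Kv
    by (simp add: qform_def)
qed

lemma qform_adjoint_mult:
  assumes "K \<in> carrier_mat n n" "v \<in> carrier_vec n"
  shows "qform (mat_adjoint K * K) v = sqnorm (K *\<^sub>v v)"
  using qform_sandwich[OF assms(1) one_carrier_mat assms(2)] assms
    qform_one[of "K *\<^sub>v v" n] mult_mat_vec_carrier[OF assms]
  by (simp add: right_mult_one_mat[of _ n n])

lemma form_le_sandwich:
  assumes "form_le n A B" "K \<in> carrier_mat n n" "A \<in> carrier_mat n n" "B \<in> carrier_mat n n"
  shows "form_le n (mat_adjoint K * A * K) (mat_adjoint K * B * K)"
  using assms by (auto simp: form_le_def qform_sandwich intro: mult_mat_vec_carrier)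

lemma qform_smult:
  assumes "A \<in> carrier_mat n n" "v \<in> carrier_vec n"
  shows "qform (complex_of_real c \<cdot>\<^sub>m A) v = c * qform A v"
proof -
  have "(complex_of_real c \<cdot>\<^sub>m A) *\<^sub>v v = complex_of_real c \<cdot>\<^sub>v (A *\<^sub>v v)"
    using assms by (intro eq_vecI) auto
  thus ?thesis using assms mult_mat_vec_carrier[OF assms] by (simp add: qform_def)
qed

lemma qform_add:
  assumes "A \<in> carrier_mat n n" "B \<in> carrier_mat n n" "v \<in> carrier_vec n"
  shows "qform (A + B) v = qform A v + qform B v"
  using assms mult_mat_vec_carrier[OF assms(1,3)] mult_mat_vec_carrier[OF assms(2,3)]
  by (simp add: qform_def add_mult_distrib_mat_vec[of _ n n] add_scalar_prod_distrib[of _ n])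

lemma qform_minus:
  assumes "A \<in> carrier_mat n n" "B \<in> carrier_mat n n" "v \<in> carrier_vec n"
  shows "qform (A - B) v = qform A v - qform B v"
  using assms mult_mat_vec_carrier[OF assms(1,3)] mult_mat_vec_carrier[OF assms(2,3)]
  by (simp add: qform_def minus_mult_distrib_mat_vec[of _ n n] minus_scalar_prod_distrib[of _ n])

text \<open>Evaluating the forms at the columns of \<open>U\<close> isolates single eigenvalues.
  Upper bounds on the largest eigenvalue enter the order arguments through this equivalence.\<close>

lemma form_le_scalar_iff:
  assumes "unitary_diag n U d A"
  shows "form_le n A (complex_of_real c \<cdot>\<^sub>m 1\<^sub>m n) \<longleftrightarrow> (\<forall>i<n. d i \<le> c)"
proof -
  have q: "qform (complex_of_real c \<cdot>\<^sub>m 1\<^sub>m n) v = c * sqnorm v" if "v \<in> carrier_vec n" for v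
    using that by (simp add: qform_smult[of _ n] qform_one)
  show ?thesis
  proof
    assume "form_le n A (complex_of_real c \<cdot>\<^sub>m 1\<^sub>m n)"
    thus "\<forall>i<n. d i \<le> c"
      using unitary_diag_col[OF assms] q by (force simp: form_le_def)
  next
    assume d: "\<forall>i<n. d i \<le> c"
    have "qform A v \<le> qform (complex_of_real c \<cdot>\<^sub>m 1\<^sub>m n) v" if v: "v \<in> carrier_vec n" for v
      unfolding q[OF v] qform_unitary_diag[OF assms v]
        qform_unitary_diag[OF unitary_diag_one[OF assms] v, unfolded qform_one[OF v]]
      unfolding sum_distrib_left using d by (intro sum_mono) (simp add: mult_right_mono)
    thus "form_le n A (complex_of_real c \<cdot>\<^sub>m 1\<^sub>m n)" by (simp add: form_le_def)
  qed
qed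

lemma hermitian_sandwich:
  assumes "A \<in> hermitian_mats n" "K \<in> carrier_mat n n"
  shows "mat_adjoint K * A * K \<in> hermitian_mats n"
  using assms hermitian_adjoint[OF assms(1)]
  by (intro hermitian_matsI)
    (auto simp: square_simps[where n=n])

lemma psd_sandwich:
  assumes "A \<in> psd_mats n" "K \<in> carrier_mat n n"
  shows "mat_adjoint K * A * K \<in> psd_mats n"
  using assms hermitian_sandwich[of A n K]
  by (auto simp: psd_mats_iff qform_sandwich intro: mult_mat_vec_carrier)

subsection \<open>Powers of positive semidefinite matrices\<close>

lemma psd_unitary_diag:
  assumes "A \<in> psd_mats n"
  obtains U d where "unitary_diag n U d A" "\<And>i. i < n \<Longrightarrow> 0 \<le> d i"
  using hermitian_unitary_diag[of A n] assms unitary_diag_psd_iff by auto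

lemma pd_unitary_diag:
  assumes "A \<in> pd_mats n"
  obtains U d where "unitary_diag n U d A" "\<And>i. i < n \<Longrightarrow> 0 < d i"
  using hermitian_unitary_diag[of A n] assms unitary_diag_pd_iff by auto

lemma fun_calc_cong_psd:
  assumes "A \<in> psd_mats n" "\<And>x. 0 \<le> x \<Longrightarrow> f x = g x"
  shows "fun_calc f A = fun_calc g A"
proof -
  obtain U d where *: "unitary_diag n U d A" "\<And>i. i < n \<Longrightarrow> 0 \<le> d i"
    using psd_unitary_diag[OF assms(1)] by blast
  show ?thesis
    using fun_calc_unitary_diag[OF *(1)] fun_calc_unitary_diag[OF *(1)]
    by (rule unitary_diag_unique) (use *(2) assms(2) in auto)
qed

lemma fun_calc_cong_pd:
  assumes "A \<in> pd_mats n" "\<And>x. 0 < x \<Longrightarrow> f x = g x"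
  shows "fun_calc f A = fun_calc g A"
proof -
  obtain U d where *: "unitary_diag n U d A" "\<And>i. i < n \<Longrightarrow> 0 < d i"
    using pd_unitary_diag[OF assms(1)] by blast
  show ?thesis
    using fun_calc_unitary_diag[OF *(1)] fun_calc_unitary_diag[OF *(1)]
    by (rule unitary_diag_unique) (use *(2) assms(2) in auto)
qed

text \<open>Since \<open>inverse 0 = 0\<close> and \<open>0 powr r = 0\<close> for every
  \<open>r\<close>, the generalized inverse for negative exponents is absorbed into the single
  function \<open>x powr r\<close>.\<close>

lemma mat_powr_eq_fun_calc:
  assumes "A \<in> psd_mats n"
  shows "mat_powr A r = fun_calc (\<lambda>x. x powr r) A"
proof (cases "r < 0")
  case True
  have "fun_calc (\<lambda>x. x powr (- r)) (fun_calc inverse A) = fun_calc (\<lambda>x. inverse x powr (- r)) A"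
    using assms by (intro fun_calc_compose[of _ n]) simp
  also have "\<dots> = fun_calc (\<lambda>x. x powr r) A"
    using assms by (rule fun_calc_cong_psd) (simp add: powr_minus inverse_powr)
  finally show ?thesis using True by (simp add: mat_powr_def gen_inv_def)
qed (simp add: mat_powr_def)

lemma mat_powr_unitary_diag:
  assumes "unitary_diag n U d A" "\<And>i. i < n \<Longrightarrow> 0 \<le> d i"
  shows "unitary_diag n U (\<lambda>i. d i powr r) (mat_powr A r)"
proof -
  have "A \<in> psd_mats n" using assms by (simp add: unitary_diag_psd_iff)
  thus ?thesis using fun_calc_unitary_diag[OF assms(1)] by (simp add: mat_powr_eq_fun_calc)
qed

lemma mat_powr_psd [simp]:
  assumes "A \<in> psd_mats n"
  shows "mat_powr A r \<in> psd_mats n"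
proof -
  obtain U d where *: "unitary_diag n U d A" "\<And>i. i < n \<Longrightarrow> 0 \<le> d i"
    using psd_unitary_diag[OF assms(1)] by blast
  show ?thesis using unitary_diag_psd_iff[OF mat_powr_unitary_diag[OF *]] by simp
qed

lemma mat_powr_pd [simp]:
  assumes "A \<in> pd_mats n"
  shows "mat_powr A r \<in> pd_mats n"
proof -
  obtain U d where *: "unitary_diag n U d A" "\<And>i. i < n \<Longrightarrow> 0 < d i"
    using pd_unitary_diag[OF assms(1)] by blast
  have "\<And>i. i < n \<Longrightarrow> 0 \<le> d i" using *(2) by (simp add: less_imp_le)
  thus ?thesis using unitary_diag_pd_iff[OF mat_powr_unitary_diag[OF *(1)]] *(2) by force
qed

lemma psd_adjoint: "A \<in> psd_mats n \<Longrightarrow> mat_adjoint A = A"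
  using hermitian_adjoint psd_hermitian by blast

lemma mat_powr_adjoint:
  "A \<in> psd_mats n \<Longrightarrow> mat_adjoint (mat_powr A r) = mat_powr A r"
  by (rule psd_adjoint[of _ n]) simp

text \<open>The exponent law holds on the kernel too, because both sides vanish there whatever the
  signs of \<open>r\<close> and \<open>s\<close>. Cancellation to the identity, in contrast, belongs
  to positive definite matrices.\<close>

lemma mat_powr_mult:
  assumes "A \<in> psd_mats n"
  shows "mat_powr A r * mat_powr A s = mat_powr A (r + s)"
  using assms by (simp add: mat_powr_eq_fun_calc fun_calc_mult[of _ n] powr_add)

lemma mat_powr_mult_left:
  assumes "A \<in> psd_mats n" "X \<in> carrier_mat n n"
  shows "mat_powr A r * (mat_powr A s * X) = mat_powr A (r + s) * X"
  using assms mat_powr_mult[OF assms(1)] mat_powr_psd[OF assms(1)]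
  by (simp flip: square_mult_assoc[of _ n])

lemma mat_powr_powr:
  assumes "A \<in> psd_mats n"
  shows "mat_powr (mat_powr A r) s = mat_powr A (r * s)"
proof -
  have "mat_powr (mat_powr A r) s = fun_calc (\<lambda>x. x powr s) (fun_calc (\<lambda>x. x powr r) A)"
    using assms mat_powr_psd[OF assms] by (simp add: mat_powr_eq_fun_calc[of _ n])
  also have "\<dots> = mat_powr A (r * s)"
    using assms by (simp add: fun_calc_compose[of _ n] mat_powr_eq_fun_calc powr_powr)
  finally show ?thesis .
qed

lemma mat_powr_one [simp]:
  assumes "A \<in> psd_mats n"
  shows "mat_powr A 1 = A"
proof -
  have "mat_powr A 1 = fun_calc (\<lambda>x. x) A"
    unfolding mat_powr_eq_fun_calc[OF assms] by (rule fun_calc_cong_psd[OF assms]) simp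
  thus ?thesis using fun_calc_id[of A n] assms by simp
qed

lemma mat_powr_zero:
  assumes "A \<in> pd_mats n"
  shows "mat_powr A 0 = 1\<^sub>m n"
proof -
  have "mat_powr A 0 = fun_calc (\<lambda>x. 1) A"
    unfolding mat_powr_eq_fun_calc[OF pd_psd[OF assms]] by (rule fun_calc_cong_pd[OF assms]) simp
  thus ?thesis using fun_calc_1[of A n] assms by simp
qed

lemma mat_powr_cancel:
  assumes "A \<in> pd_mats n"
  shows "mat_powr A r * mat_powr A (- r) = 1\<^sub>m n" "mat_powr A (- r) * mat_powr A r = 1\<^sub>m n"
  using mat_powr_mult[OF pd_psd[OF assms]] mat_powr_zero[OF assms] by simp_all

lemma mat_powr_cancel_left:
  assumes "A \<in> pd_mats n" "X \<in> carrier_mat n n"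
  shows "mat_powr A r * (mat_powr A (- r) * X) = X" "mat_powr A (- r) * (mat_powr A r * X) = X"
  using mat_powr_mult_left[OF pd_psd[OF assms(1)] assms(2)] mat_powr_zero[OF assms(1)] assms(2)
  by simp_all

lemma mat_powr_intertwine:
  assumes "A \<in> psd_mats n" "B \<in> psd_mats n" "K \<in> carrier_mat n n" "K * A = B * K"
  shows "K * mat_powr A r = mat_powr B r * K"
  using assms by (simp add: mat_powr_eq_fun_calc[of _ n] fun_calc_intertwine[of _ n])

lemma mat_powr_smult:
  assumes "A \<in> psd_mats n" "0 \<le> c"
  shows "complex_of_real c \<cdot>\<^sub>m A \<in> psd_mats n"
    "mat_powr (complex_of_real c \<cdot>\<^sub>m A) r = complex_of_real (c powr r) \<cdot>\<^sub>m mat_powr A r"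
proof -
  obtain U d where *: "unitary_diag n U d A" "\<And>i. i < n \<Longrightarrow> 0 \<le> d i"
    using psd_unitary_diag[OF assms(1)] by blast
  note cA = unitary_diag_smult[OF *(1), of c]
  show "complex_of_real c \<cdot>\<^sub>m A \<in> psd_mats n"
    using unitary_diag_psd_iff[OF cA] *(2) assms(2) by simp
  have "unitary_diag n U (\<lambda>i. (c * d i) powr r) (mat_powr (complex_of_real c \<cdot>\<^sub>m A) r)"
    by (rule mat_powr_unitary_diag[OF cA]) (use *(2) assms(2) in auto)
  moreover have "unitary_diag n U (\<lambda>i. c powr r * d i powr r) (complex_of_real (c powr r) \<cdot>\<^sub>m mat_powr A r)"
    by (rule unitary_diag_smult[OF mat_powr_unitary_diag[OF *]])
  ultimately show "mat_powr (complex_of_real c \<cdot>\<^sub>m A) r = complex_of_real (c powr r) \<cdot>\<^sub>m mat_powr A r"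
    by (rule unitary_diag_unique) (use *(2) assms(2) in \<open>simp add: powr_mult\<close>)
qed

lemma pd_smult:
  assumes "A \<in> pd_mats n" "0 < c"
  shows "complex_of_real c \<cdot>\<^sub>m A \<in> pd_mats n"
proof -
  obtain U d where *: "unitary_diag n U d A" "\<And>i. i < n \<Longrightarrow> 0 < d i"
    using pd_unitary_diag[OF assms(1)] by blast
  show ?thesis
    using unitary_diag_pd_iff[OF unitary_diag_smult[OF *(1), of c]] *(2) assms(2) by simp
qed

subsection \<open>The Loewner-Heinz inequality\<close>

definition scalar_mat :: "nat \<Rightarrow> real \<Rightarrow> complex mat" where
  "scalar_mat n c = complex_of_real c \<cdot>\<^sub>m 1\<^sub>m n"

lemma one_smult_mat: "1 \<cdot>\<^sub>m A = (A :: complex mat)"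
  by (rule eq_matI) auto

lemma scalar_mat_carrier [simp]: "scalar_mat n c \<in> carrier_mat n n"
  by (simp add: scalar_mat_def)

lemma scalar_mat_mult:
  assumes "A \<in> carrier_mat n n"
  shows "A * scalar_mat n c = complex_of_real c \<cdot>\<^sub>m A" "scalar_mat n c * A = complex_of_real c \<cdot>\<^sub>m A"
  using assms by (simp_all add: scalar_mat_def mult_smult_distrib[of _ n n _ n] mult_smult_assoc_mat[of _ n n _ n])

lemma qform_scalar_mat: "v \<in> carrier_vec n \<Longrightarrow> qform (scalar_mat n c) v = c * sqnorm v"
  by (simp add: scalar_mat_def qform_smult[of _ n] qform_one)

lemma scalar_mat_one: "scalar_mat n 1 = 1\<^sub>m n"
  by (auto simp: scalar_mat_def)

lemma form_le_sandwich_powr: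
  assumes "form_le n X Y" "A \<in> psd_mats n" "X \<in> carrier_mat n n" "Y \<in> carrier_mat n n"
  shows "form_le n (mat_powr A r * X * mat_powr A r) (mat_powr A r * Y * mat_powr A r)"
  using form_le_sandwich[OF assms(1) _ assms(3,4), of "mat_powr A r"] assms(2)
  by (simp add: mat_powr_adjoint)

text \<open>Sandwiching with A^(-r) undoes sandwiching with A^r because \<open>A\<close> is
  invertible. Scalar bounds on a mean are unwrapped and rewrapped in this way around each use of
  Loewner-Heinz.\<close>

lemma form_le_move:
  assumes "A \<in> pd_mats n" "X \<in> carrier_mat n n"
  shows "form_le n (mat_powr A r * X * mat_powr A r) (scalar_mat n c) \<longleftrightarrow>
    form_le n X (complex_of_real c \<cdot>\<^sub>m mat_powr A (- 2 * r))"
proof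
  assume *: "form_le n (mat_powr A r * X * mat_powr A r) (scalar_mat n c)"
  have "form_le n (mat_powr A (- r) * (mat_powr A r * X * mat_powr A r) * mat_powr A (- r))
      (mat_powr A (- r) * scalar_mat n c * mat_powr A (- r))"
    by (rule form_le_sandwich_powr[OF *]) (use assms in \<open>simp_all add: square_mult_closed[of _ n]\<close>)
  thus "form_le n X (complex_of_real c \<cdot>\<^sub>m mat_powr A (- 2 * r))"
    using assms
    by (simp add: square_simps[where n=n] mat_powr_cancel_left mat_powr_cancel mat_powr_mult[of _ n]
        mat_powr_zero scalar_mat_mult[of _ n] mult_smult_assoc_mat[of _ n n _ n])
next
  assume *: "form_le n X (complex_of_real c \<cdot>\<^sub>m mat_powr A (- 2 * r))"
  have "form_le n (mat_powr A r * X * mat_powr A r)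
      (mat_powr A r * (complex_of_real c \<cdot>\<^sub>m mat_powr A (- 2 * r)) * mat_powr A r)"
    by (rule form_le_sandwich_powr[OF *]) (use assms in simp_all)
  moreover have "mat_powr A r * (complex_of_real c \<cdot>\<^sub>m mat_powr A (- 2 * r)) * mat_powr A r = scalar_mat n c"
    using assms
    by (simp add: mult_smult_distrib[of _ n n _ n] mult_smult_assoc_mat[of _ n n _ n]
       mat_powr_mult[of _ n] mat_powr_zero scalar_mat_def)
  ultimately show "form_le n (mat_powr A r * X * mat_powr A r) (scalar_mat n c)" by simp
qed

lemma adjoint_mult_psd:
  assumes "K \<in> carrier_mat n n"
  shows "mat_adjoint K * K \<in> psd_mats n" "K * mat_adjoint K \<in> psd_mats n"
proof -
  have *: "mat_adjoint L * L \<in> psd_mats n" if "L \<in> carrier_mat n n" for L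
    using that by (auto simp: psd_mats_iff qform_adjoint_mult square_simps[where n=n] intro!: hermitian_matsI)
  show "mat_adjoint K * K \<in> psd_mats n" using *[OF assms] .
  show "K * mat_adjoint K \<in> psd_mats n" using *[of "mat_adjoint K"] assms by simp
qed

lemma sqnorm_smult:
  assumes "v \<in> carrier_vec n"
  shows "sqnorm (complex_of_real c \<cdot>\<^sub>v v) = c\<^sup>2 * sqnorm v"
  using assms by (simp add: sqnorm_eq[of _ n] sum_distrib_left norm_mult power_mult_distrib)

text \<open>The two products have the same nonzero eigenvalues: the adjoint of \<open>K\<close>
  sends a unit eigenvector for \<open>d i\<close> to a vector \<open>w\<close> of squared norm
  \<open>d i\<close>, at which the form of the other product is the square of \<open>d i\<close>.
  The eigenvalue 0 is covered by \<open>0 \<le> c\<close>.\<close>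

lemma form_le_adjoint_swap:
  assumes K: "K \<in> carrier_mat n n" and c: "0 \<le> c"
    and le: "form_le n (mat_adjoint K * K) (scalar_mat n c)"
  shows "form_le n (K * mat_adjoint K) (scalar_mat n c)"
proof -
  obtain U d where U: "unitary_diag n U d (K * mat_adjoint K)" and d: "\<And>i. i < n \<Longrightarrow> 0 \<le> d i"
    using psd_unitary_diag[OF adjoint_mult_psd(2)[OF K]] by blast
  have "d i \<le> c" if i: "i < n" for i
  proof -
    note u = unitary_diag_col[OF U i]
    define w where "w = mat_adjoint K *\<^sub>v col U i"
    have w: "w \<in> carrier_vec n" unfolding w_def using K u by (intro square_mult_vec_closed) auto
    have "sqnorm w = d i"
      using qform_adjoint_mult[of "mat_adjoint K" n "col U i"] K u by (simp add: w_def)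
    moreover have "K *\<^sub>v w = complex_of_real (d i) \<cdot>\<^sub>v col U i"
      unfolding u(4)[symmetric] w_def using K u(1) by (simp add: square_simps[where n=n])
    hence "qform (mat_adjoint K * K) w = (d i)\<^sup>2"
      using qform_adjoint_mult[OF K w] sqnorm_smult[OF u(1)] u(3) by simp
    ultimately have "d i * d i \<le> c * d i"
      using le w by (auto simp: form_le_def qform_scalar_mat power2_eq_square)
    thus ?thesis using d[OF i] c by (cases "d i = 0") auto
  qed
  thus ?thesis unfolding scalar_mat_def using form_le_scalar_iff[OF U] by blast
qed

text \<open>If \<open>r\<close> were missing, the points of \<open>S\<close> nearest to it on the
  left and on the right would have their midpoint in \<open>S\<close>, strictly inside the
  gap.\<close>

lemma midpoint_closed_interval:
  fixes S :: "real set"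
  assumes "closed S" "0 \<in> S" "1 \<in> S" and mid: "\<And>s t. s \<in> S \<Longrightarrow> t \<in> S \<Longrightarrow> (s + t) / 2 \<in> S"
    and r: "0 \<le> r" "r \<le> 1"
  shows "r \<in> S"
proof (rule ccontr)
  assume "r \<notin> S"
  define a b where "a = Sup (S \<inter> {..r})" and "b = Inf (S \<inter> {r..})"
  have bd: "bdd_above (S \<inter> {..r})" "bdd_below (S \<inter> {r..})" by auto
  have "a \<in> S \<inter> {..r}" unfolding a_def
    by (rule closed_contains_Sup[OF _ bd(1)]) (use assms in \<open>auto intro!: closed_Int\<close>)
  moreover have "b \<in> S \<inter> {r..}" unfolding b_def
    by (rule closed_contains_Inf[OF _ bd(2)]) (use assms in \<open>auto intro!: closed_Int\<close>)
  ultimately have ab: "a \<in> S" "b \<in> S" "a < r" "r < b"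
    using \<open>r \<notin> S\<close> by (auto simp: less_le)
  have m: "(a + b) / 2 \<in> S" using mid ab by blast
  show False
  proof (cases "(a + b) / 2 \<le> r")
    case True
    hence "(a + b) / 2 \<le> a" unfolding a_def[symmetric] using m bd(1)
      by (metis IntI a_def atMost_iff cSup_upper)
    thus False using ab by simp
  next
    case False
    hence "b \<le> (a + b) / 2" using m bd(2)
      by (metis IntI atLeast_iff b_def cInf_lower linear)
    thus False using ab by simp
  qed
qed

lemma continuous_on_qform_mat_powr:
  assumes A: "A \<in> psd_mats n" and v: "v \<in> carrier_vec n"
  shows "continuous_on S (\<lambda>r. qform (mat_powr A r) v)"
proof -
  obtain U d where U: "unitary_diag n U d A" "\<And>i. i < n \<Longrightarrow> 0 \<le> d i"
    using psd_unitary_diag[OF A] by blast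
  \<comment> \<open>For \<open>x = 0\<close> the function is constantly 0, even at
    \<open>r = 0\<close>, so zero eigenvalues cause no jump.\<close>
  have *: "continuous_on S (\<lambda>r. x powr r)" for x :: real
    by (cases "x = 0") (auto intro!: continuous_intros)
  have "qform (mat_powr A r) v = (\<Sum>i<n. d i powr r * (cmod ((mat_adjoint U *\<^sub>v v) $ i))\<^sup>2)" for r
    using U by (intro qform_unitary_diag[OF _ v] mat_powr_unitary_diag)
  thus ?thesis
    by (simp only:) (intro continuous_intros *)
qed

text \<open>A power of \<open>C\<close> moves an eigenvector of \<open>C\<^bsup>-(s+t)/4\<^esup> B\<^bsup>(s+t)/2\<^esup> C\<^bsup>-(s+t)/4\<^esup>\<close> to one of the
  similar matrix \<open>C\<^bsup>-s/2\<^esup> B\<^bsup>s/2\<^esup> B\<^bsup>t/2\<^esup> C\<^bsup>-t/2\<^esup>\<close>, a product of two contractions.\<close>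

lemma form_le_midpoint:
  assumes B: "B \<in> psd_mats n" and C: "C \<in> pd_mats n"
    and s: "form_le n (mat_powr B s) (mat_powr C s)" and t: "form_le n (mat_powr B t) (mat_powr C t)"
  shows "form_le n (mat_powr B ((s + t) / 2)) (mat_powr C ((s + t) / 2))"
proof -
  define a b where "a = s / 2" and "b = t / 2"
  have Bc [simp]: "mat_powr B r \<in> carrier_mat n n" for r using B by simp
  have Cc [simp]: "mat_powr C r \<in> carrier_mat n n" for r using C by simp
  note sq = square_simps[where n=n]
  note Cm = mat_powr_mult[OF pd_psd[OF C]] mat_powr_mult_left[OF pd_psd[OF C]]
  note Bm = mat_powr_mult[OF B] mat_powr_mult_left[OF B]
  define M where "M = mat_powr C (- (a + b) / 2) * mat_powr B (a + b) * mat_powr C (- (a + b) / 2)"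
  have "M \<in> psd_mats n"
    using psd_sandwich[of "mat_powr B (a + b)" n "mat_powr C (- (a + b) / 2)"] B C
    by (simp add: M_def mat_powr_adjoint[of _ n])
  then obtain U d where U: "unitary_diag n U d M" "\<And>i. i < n \<Longrightarrow> 0 \<le> d i"
    using psd_unitary_diag by blast
  \<comment> \<open>B^r <= C^r evaluated at C^(-r/2) w says that B^(r/2) C^(-r/2) is a contraction.
    It is used for both given exponents.\<close>
  have contr: "sqnorm (mat_powr B (r / 2) *\<^sub>v (mat_powr C (- r / 2) *\<^sub>v w)) \<le> sqnorm w"
    if r: "form_le n (mat_powr B r) (mat_powr C r)" and w: "w \<in> carrier_vec n" for r w
  proof -
    let ?w = "mat_powr C (- r / 2) *\<^sub>v w"
    have w': "?w \<in> carrier_vec n" using w by (simp add: sq)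
    have "sqnorm (mat_powr B (r / 2) *\<^sub>v ?w) = qform (mat_powr B r) ?w"
      using qform_adjoint_mult[of "mat_powr B (r / 2)" n ?w] w' B by (simp add: mat_powr_adjoint Bm)
    also have "\<dots> \<le> qform (mat_powr C r) ?w" using r w' by (simp add: form_le_def)
    also have "\<dots> = qform (mat_powr C (- r / 2) * mat_powr C r * mat_powr C (- r / 2)) w"
      using qform_sandwich[of "mat_powr C (- r / 2)" n "mat_powr C r" w] w C
      by (simp add: mat_powr_adjoint[of _ n])
    also have "mat_powr C (- r / 2) * mat_powr C r * mat_powr C (- r / 2) = 1\<^sub>m n"
      using C by (simp add: Cm mat_powr_zero)
    finally show ?thesis using w by (simp add: qform_one)
  qed
  have "d i \<le> 1" if i: "i < n" for i
  proof -
    note u = unitary_diag_col[OF U(1) i]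
    \<comment> \<open>The exponent is the one of the similarity: -a = (b - a)/2 - (a + b)/2 and -b +
      (b - a)/2 = -(a + b)/2, so \<open>?L * ?R\<close> has \<open>w\<close> as eigenvector for
      \<open>d i\<close>.\<close>
    define w where "w = mat_powr C ((b - a) / 2) *\<^sub>v col U i"
    have w: "w \<in> carrier_vec n" unfolding w_def using u by (simp add: sq)
    have "mat_powr C (- ((b - a) / 2)) *\<^sub>v w = col U i"
      unfolding w_def using u(1) mat_powr_cancel(2)[OF C]
      by (simp flip: square_mult_vec_assoc[of _ n])
    moreover have "mat_powr C (- ((b - a) / 2)) *\<^sub>v 0\<^sub>v n = 0\<^sub>v n"
      using carrier_matD[OF Cc] by (intro eq_vecI) auto
    ultimately have "w \<noteq> 0\<^sub>v n" using u(1,3) sqnorm_eq_0_iff[of "0\<^sub>v n" n] by auto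
    hence pos: "sqnorm w > 0" using sqnorm_eq_0_iff[OF w] sqnorm_nonneg[of w] by linarith
    let ?L = "mat_powr C (- a) * mat_powr B a" and ?R = "mat_powr B b * mat_powr C (- b)"
    have L: "mat_adjoint ?L = mat_powr B a * mat_powr C (- a)"
      using B C by (simp add: sq mat_powr_adjoint[of _ n])
    have "?L *\<^sub>v (?R *\<^sub>v w) = (?L * ?R * mat_powr C ((b - a) / 2)) *\<^sub>v col U i"
      using u(1) by (simp add: w_def sq)
    also have "?L * ?R * mat_powr C ((b - a) / 2) =
        mat_powr C (- a) * (mat_powr B (a + b) * mat_powr C (- b + (b - a) / 2))"
      by (simp add: sq Bm Cm)
    also have "- b + (b - a) / 2 = - (a + b) / 2" by (simp add: field_simps)
    also have "mat_powr C (- a) * (mat_powr B (a + b) * mat_powr C (- (a + b) / 2)) = mat_powr C ((b - a) / 2) * M"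
    proof -
      have "- a = (b - a) / 2 + - (a + b) / 2" by (simp add: field_simps)
      hence "mat_powr C (- a) = mat_powr C ((b - a) / 2 + - (a + b) / 2)" by (rule arg_cong)
      thus ?thesis by (simp only: M_def) (simp add: sq Cm)
    qed
    also have "(mat_powr C ((b - a) / 2) * M) *\<^sub>v col U i = mat_powr C ((b - a) / 2) *\<^sub>v (M *\<^sub>v col U i)"
      using unitary_diagD(2)[OF U(1)] u(1) by (simp add: sq)
    also have "\<dots> = complex_of_real (d i) \<cdot>\<^sub>v w"
      unfolding u(4) w_def using u(1) by (intro mult_mat_vec[of _ n n]) auto
    finally have "(?L *\<^sub>v (?R *\<^sub>v w)) \<bullet>c w = complex_of_real (d i) * (w \<bullet>c w)"
      using w by simp
    moreover have "(?L *\<^sub>v (?R *\<^sub>v w)) \<bullet>c w = (?R *\<^sub>v w) \<bullet>c (mat_powr B a *\<^sub>v (mat_powr C (- a) *\<^sub>v w))"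
      using mat_adjoint_scalar_prod[of ?L n n "?R *\<^sub>v w" w] w unfolding L by (simp add: sq)
    ultimately have "d i * sqnorm w = Re ((?R *\<^sub>v w) \<bullet>c (mat_powr B a *\<^sub>v (mat_powr C (- a) *\<^sub>v w)))"
      by (simp add: sqnorm_def)
    also have "\<dots> \<le> (sqnorm (?R *\<^sub>v w) + sqnorm (mat_powr B a *\<^sub>v (mat_powr C (- a) *\<^sub>v w))) / 2"
      using w by (intro Re_scalar_prod_le[of _ n]) (simp_all add: sq)
    also have "\<dots> \<le> sqnorm w"
      using contr[OF s w] contr[OF t w] w by (simp add: a_def b_def sq)
    finally show ?thesis using pos by simp
  qed
  hence "form_le n M (scalar_mat n 1)" unfolding scalar_mat_def using form_le_scalar_iff[OF U(1), of 1] by simp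
  hence "form_le n (mat_powr B (a + b)) (complex_of_real 1 \<cdot>\<^sub>m mat_powr C (- 2 * (- (a + b) / 2)))"
    unfolding M_def by (subst (asm) form_le_move[OF C]) (simp_all)
  also have "- 2 * (- (a + b) / 2) = a + b" by simp
  also have "a + b = (s + t) / 2" by (simp add: a_def b_def)
  finally show ?thesis by (simp add: one_smult_mat)
qed

text \<open>The admissible exponents form a closed set containing 0 and 1 and closed under
  midpoints, hence all of [0, 1].\<close>

theorem loewner_heinz:
  assumes B: "B \<in> psd_mats n" and C: "C \<in> pd_mats n" and le: "form_le n B C"
    and r: "0 \<le> r" "r \<le> 1"
  shows "form_le n (mat_powr B r) (mat_powr C r)"
proof -
  define S where "S = {r. form_le n (mat_powr B r) (mat_powr C r)}"
  have "S = (\<Inter>v\<in>carrier_vec n. {r. qform (mat_powr B r) v \<le> qform (mat_powr C r) v})"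
    by (auto simp: S_def form_le_def)
  moreover have "closed \<dots>"
    using B C by (intro closed_INT ballI closed_Collect_le continuous_on_qform_mat_powr[of _ n]) auto
  ultimately have "closed S" by simp
  \<comment> \<open>\<open>mat_powr B 0\<close> is the support projection of \<open>B\<close>, with
    eigenvalues 0 and 1, while \<open>mat_powr C 0\<close> is the identity.\<close>
  moreover have "0 \<in> S"
  proof -
    obtain U d where U: "unitary_diag n U d B" "\<And>i. i < n \<Longrightarrow> 0 \<le> d i"
      using psd_unitary_diag[OF B] by blast
    have "form_le n (mat_powr B 0) (complex_of_real 1 \<cdot>\<^sub>m 1\<^sub>m n)"
      using form_le_scalar_iff[OF mat_powr_unitary_diag[OF U, of 0], of 1] by simp
    thus ?thesis using mat_powr_zero[OF C] scalar_mat_one[of n] by (simp add: S_def scalar_mat_def)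
  qed
  moreover have "1 \<in> S" using mat_powr_one[OF B] mat_powr_one[OF pd_psd[OF C]] le by (simp add: S_def)
  ultimately have "r \<in> S"
    by (rule midpoint_closed_interval) (use r form_le_midpoint[OF B C] in \<open>auto simp: S_def\<close>)
  thus ?thesis by (simp add: S_def)
qed

text \<open>Move the outer factors to the right, apply Loewner-Heinz to B <= c A^(-2x), and move
  them back; \<open>0 < c\<close> keeps the right side positive definite. The exponent
  \<open>x\<close> may be negative, as happens below for \<alpha> > 1/2.\<close>

lemma araki:
  assumes A: "A \<in> pd_mats n" and B: "B \<in> psd_mats n" and r: "0 \<le> r" "r \<le> 1" and c: "0 < c"
    and le: "form_le n (mat_powr A x * B * mat_powr A x) (scalar_mat n c)"
  shows "form_le n (mat_powr A (r * x) * mat_powr B r * mat_powr A (r * x)) (scalar_mat n (c powr r))"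
proof -
  have "form_le n B (complex_of_real c \<cdot>\<^sub>m mat_powr A (- 2 * x))"
    using le form_le_move[OF A, of B x c] B by simp
  hence "form_le n (mat_powr B r) (mat_powr (complex_of_real c \<cdot>\<^sub>m mat_powr A (- 2 * x)) r)"
    using A B c r by (intro loewner_heinz pd_smult) auto
  also have "mat_powr (complex_of_real c \<cdot>\<^sub>m mat_powr A (- 2 * x)) r =
      complex_of_real (c powr r) \<cdot>\<^sub>m mat_powr A (- 2 * (r * x))"
    using A c by (simp add: mat_powr_smult(2)[of _ n] mat_powr_powr[of _ n] mult_ac)
  finally show ?thesis using form_le_move[OF A, of "mat_powr B r" "r * x"] B by simp
qed

subsection \<open>Inequalities of Furuta type\<close>

lemma square_mult_zero_vec:
  fixes A :: "complex mat"
  assumes "A \<in> carrier_mat n n"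
  shows "A *\<^sub>v 0\<^sub>v n = 0\<^sub>v n"
proof (rule eq_vecI)
  show "dim_vec (A *\<^sub>v 0\<^sub>v n) = dim_vec (0\<^sub>v n :: complex vec)" using assms by simp
  fix i assume "i < dim_vec (0\<^sub>v n :: complex vec)"
  thus "(A *\<^sub>v 0\<^sub>v n) $ i = 0\<^sub>v n $ i" using assms by (simp add: scalar_prod_def)
qed

lemma sandwich_smult:
  fixes A B C :: "complex mat"
  assumes "A \<in> carrier_mat n n" "B \<in> carrier_mat n n" "C \<in> carrier_mat n n"
  shows "A * (c \<cdot>\<^sub>m B) * C = c \<cdot>\<^sub>m (A * B * C)"
  using mult_smult_distrib[OF assms(1,2), of c]
    mult_smult_assoc_mat[OF square_mult_closed[OF assms(1,2)] assms(3), of c] by simp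

lemma pd_sandwich_powr:
  assumes A: "A \<in> pd_mats n" and B: "B \<in> pd_mats n"
  shows "mat_powr A r * B * mat_powr A r \<in> pd_mats n"
proof -
  have h: "mat_powr A r * B * mat_powr A r \<in> hermitian_mats n"
    using hermitian_sandwich[of B n "mat_powr A r"] A B by (simp add: mat_powr_adjoint[of _ n])
  have "0 < qform (mat_powr A r * B * mat_powr A r) v" if v: "v \<in> carrier_vec n" "v \<noteq> 0\<^sub>v n" for v
  proof -
    let ?w = "mat_powr A r *\<^sub>v v"
    have w: "?w \<in> carrier_vec n" using A v by (intro square_mult_vec_closed) auto
    have "mat_powr A (- r) *\<^sub>v ?w = v"
      using A v(1) mat_powr_cancel(2)[OF A, of r] by (simp flip: square_mult_vec_assoc[of _ n])
    moreover have "mat_powr A (- r) *\<^sub>v 0\<^sub>v n = 0\<^sub>v n"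
      using A by (intro square_mult_zero_vec) simp
    ultimately have "?w \<noteq> 0\<^sub>v n" using v(2) by auto
    hence "0 < qform B ?w" using B w by (auto simp: pd_mats_iff)
    thus ?thesis
      using qform_sandwich[of "mat_powr A r" n B v] A B v by (simp add: mat_powr_adjoint[of _ n])
  qed
  thus ?thesis using h by (auto simp: pd_mats_iff)
qed

lemma psd_sandwich_powr:
  assumes "A \<in> psd_mats n" "B \<in> psd_mats n"
  shows "mat_powr A r * B * mat_powr A r \<in> psd_mats n"
  using psd_sandwich[of B n "mat_powr A r"] assms by (simp add: mat_powr_adjoint[of _ n])

text \<open>With K = X^(s/2) Y^(-s/2), Loewner-Heinz bounds one product of \<open>K\<close> with its
  adjoint by 1, and the claim is the same bound for the product in the other order.\<close>

lemma form_le_powr_antitone: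
  assumes X: "X \<in> pd_mats n" and Y: "Y \<in> pd_mats n" and le: "form_le n X Y" and s: "0 \<le> s" "s \<le> 1"
  shows "form_le n (mat_powr Y (- s)) (mat_powr X (- s))"
proof -
  define K where "K = mat_powr X (s / 2) * mat_powr Y (- s / 2)"
  have [simp]: "mat_powr X r \<in> carrier_mat n n" "mat_powr Y r \<in> carrier_mat n n" for r
    using X Y by simp_all
  note sq = square_simps[where n=n]
  have K: "K \<in> carrier_mat n n" by (simp add: K_def sq)
  have Ka: "mat_adjoint K = mat_powr Y (- s / 2) * mat_powr X (s / 2)"
    unfolding K_def using X Y by (simp add: sq mat_powr_adjoint[of _ n])
  have 1: "mat_adjoint K * K = mat_powr Y (- s / 2) * mat_powr X s * mat_powr Y (- s / 2)"
    unfolding Ka unfolding K_def using mat_powr_mult_left[OF pd_psd[OF X]] by (simp add: sq)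
  have 2: "K * mat_adjoint K = mat_powr X (s / 2) * mat_powr Y (- s) * mat_powr X (s / 2)"
    unfolding Ka unfolding K_def using mat_powr_mult_left[OF pd_psd[OF Y]] by (simp add: sq)
  have "form_le n (mat_powr X s) (mat_powr Y s)"
    using X Y le s by (intro loewner_heinz) auto
  hence "form_le n (mat_adjoint K * K) (scalar_mat n 1)"
    unfolding 1 by (subst form_le_move[OF Y]) (simp_all add: one_smult_mat)
  hence "form_le n (K * mat_adjoint K) (scalar_mat n 1)"
    using K by (intro form_le_adjoint_swap) auto
  thus ?thesis
    unfolding 2 by (subst (asm) form_le_move[OF X]) (simp_all add: one_smult_mat)
qed

text \<open>\<open>K\<close> intertwines the two products and hence their powers. With 0 < s < 1 the
  inner exponent is negative, which is what brings antitonicity into the Furuta step.\<close>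

lemma mat_powr_adjoint_mult:
  assumes K: "K \<in> carrier_mat n n"
  shows "mat_powr (mat_adjoint K * K) s = mat_adjoint K * mat_powr (K * mat_adjoint K) (s - 1) * K"
proof -
  note psd = adjoint_mult_psd[OF K]
  note c = psd_carrier[OF mat_powr_psd[OF psd(1)]] psd_carrier[OF mat_powr_psd[OF psd(2)]]
  have "K * mat_powr (mat_adjoint K * K) (s - 1) = mat_powr (K * mat_adjoint K) (s - 1) * K"
    using K by (intro mat_powr_intertwine[OF psd]) (simp_all add: square_simps[where n=n])
  hence "mat_adjoint K * mat_powr (K * mat_adjoint K) (s - 1) * K =
      (mat_adjoint K * K) * mat_powr (mat_adjoint K * K) (s - 1)"
    using K c by (simp add: square_simps[where n=n])
  also have "\<dots> = mat_powr (mat_adjoint K * K) s"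
    using mat_powr_mult[OF psd(1), of 1 "s - 1"] psd(1) by simp
  finally show ?thesis by simp
qed

text \<open>Since r <= 1, Loewner-Heinz gives B^(p+r) <= Z, and 0 <= s <= 1 reverses this to Z^(-s)
  <= B^(-(p+r)s). By \<open>mat_powr_adjoint_mult\<close> the left side of the claim is Z^(-s)
  sandwiched by \<open>K\<close>.\<close>

lemma furuta_step:
  assumes A: "A \<in> pd_mats n" and B: "B \<in> pd_mats n" and le: "form_le n B A"
    and p: "1 \<le> p" and r: "0 \<le> r" "r \<le> 1"
  shows "form_le n (mat_powr (mat_powr A (r / 2) * mat_powr B p * mat_powr A (r / 2)) (1 / p))
    (mat_powr A (1 + r / p))"
proof -
  define K where "K = mat_powr B (p / 2) * mat_powr A (r / 2)"
  define Z where "Z = K * mat_adjoint K"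
  define s where "s = 1 - 1 / p"
  have s: "0 \<le> s" "s \<le> 1" using p by (auto simp: s_def field_simps)
  have [simp]: "mat_powr A r \<in> carrier_mat n n" "mat_powr B r \<in> carrier_mat n n" for r
    using A B by simp_all
  note sq = square_simps[where n=n]
  note Am = mat_powr_mult[OF pd_psd[OF A]] mat_powr_mult_left[OF pd_psd[OF A]]
  note Bm = mat_powr_mult[OF pd_psd[OF B]] mat_powr_mult_left[OF pd_psd[OF B]]
  have K: "K \<in> carrier_mat n n" by (simp add: K_def sq)
  have Ka: "mat_adjoint K = mat_powr A (r / 2) * mat_powr B (p / 2)"
    unfolding K_def using A B by (simp add: sq mat_powr_adjoint[of _ n])
  have 1: "mat_adjoint K * K = mat_powr A (r / 2) * mat_powr B p * mat_powr A (r / 2)"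
    unfolding Ka unfolding K_def by (simp add: sq Bm)
  have Z: "Z = mat_powr B (p / 2) * mat_powr A r * mat_powr B (p / 2)"
    unfolding Z_def Ka unfolding K_def by (simp add: sq Am)
  have Zpd: "Z \<in> pd_mats n" unfolding Z using A B by (intro pd_sandwich_powr) auto
  have "form_le n (mat_powr B r) (mat_powr A r)"
    using A B le r by (intro loewner_heinz) auto
  hence "form_le n (mat_powr B (p / 2) * mat_powr B r * mat_powr B (p / 2)) Z"
    unfolding Z using B by (intro form_le_sandwich_powr) auto
  also have "mat_powr B (p / 2) * mat_powr B r * mat_powr B (p / 2) = mat_powr B (p + r)"
    by (simp add: sq Bm)
  finally have "form_le n (mat_powr Z (- s)) (mat_powr (mat_powr B (p + r)) (- s))"
    using B Zpd s by (intro form_le_powr_antitone) auto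
  also have "mat_powr (mat_powr B (p + r)) (- s) = mat_powr B ((p + r) * - s)"
    using B by (intro mat_powr_powr[of _ n]) simp
  finally have "form_le n (mat_adjoint K * mat_powr Z (- s) * K) (mat_adjoint K * mat_powr B ((p + r) * - s) * K)"
    using K Zpd by (intro form_le_sandwich) auto
  also have "mat_adjoint K * mat_powr Z (- s) * K = mat_powr (mat_adjoint K * K) (1 / p)"
    using mat_powr_adjoint_mult[OF K, of "1 / p"] by (simp add: Z_def s_def)
  also have "mat_adjoint K * mat_powr B ((p + r) * - s) * K =
      mat_powr A (r / 2) * mat_powr B (p / 2 + ((p + r) * - s + p / 2)) * mat_powr A (r / 2)"
    unfolding Ka unfolding K_def by (simp add: sq Bm)
  also have "p / 2 + ((p + r) * - s + p / 2) = 1 - r * s"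
    using p by (simp add: s_def field_simps)
  \<comment> \<open>The exponent collapses to 1 - rs because p - ps = 1, and it lies in [0, 1], so
    Loewner-Heinz applies to B <= A once more.\<close>
  also have "form_le n (mat_powr A (r / 2) * mat_powr B (1 - r * s) * mat_powr A (r / 2))
     (mat_powr A (r / 2) * mat_powr A (1 - r * s) * mat_powr A (r / 2))"
  proof -
    have "0 \<le> r * s" "r * s \<le> 1" using r s by (auto intro: mult_le_one)
    thus ?thesis using A B le by (intro form_le_sandwich_powr loewner_heinz) auto
  qed
  also have "mat_powr A (r / 2) * mat_powr A (1 - r * s) * mat_powr A (r / 2) =
      mat_powr A (r / 2 + (1 - r * s + r / 2))"
    by (simp add: sq Am)
  also have "r / 2 + (1 - r * s + r / 2) = 1 + r / p"
    using p by (simp add: s_def field_simps)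
  finally show ?thesis unfolding 1 .
qed

text \<open>For r > 1 the bound for t = r - 1 says X^(1/p) <= A1, a pair to which the step applies
  again. The induction runs on an integer bound for \<open>r\<close>.\<close>

lemma furuta_pd:
  assumes A: "A \<in> pd_mats n" and B: "B \<in> pd_mats n" and le: "form_le n B A"
    and p: "1 \<le> p" and r: "0 \<le> r"
  shows "form_le n (mat_powr (mat_powr A (r / 2) * mat_powr B p * mat_powr A (r / 2)) (1 / p))
    (mat_powr A (1 + r / p))"
proof -
  have "r \<le> real m \<Longrightarrow> ?thesis" for m
    using r
  proof (induction m arbitrary: r)
    case 0
    thus ?case using furuta_step[OF A B le p, of r] by simp
  next
    case (Suc m)
    show ?case
    proof (cases "r \<le> 1")
      case True
      thus ?thesis using furuta_step[OF A B le p] Suc by simp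
    next
      case False
      define t where "t = r - 1"
      define A1 where "A1 = mat_powr A (1 + t / p)"
      define X where "X = mat_powr A (t / 2) * mat_powr B p * mat_powr A (t / 2)"
      \<comment> \<open>Chosen so that A1^u = A. It is at most 1, as the step requires, and
        sandwiching \<open>X\<close> with A1^(u/2) = A^(1/2) raises t to r = t + 1.\<close>
      define u where "u = 1 / (1 + t / p)"
      have t: "0 \<le> t" "t \<le> real m" using False Suc by (auto simp: t_def)
      have tp: "1 + t / p \<ge> 1" using t p by simp
      hence u: "0 \<le> u" "u \<le> 1" "(1 + t / p) * u = 1" by (auto simp: u_def)
      have X: "X \<in> pd_mats n" unfolding X_def using A B by (intro pd_sandwich_powr) auto
      have A1: "A1 \<in> pd_mats n" using A by (simp add: A1_def)
      have "form_le n (mat_powr X (1 / p)) A1"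
        unfolding X_def A1_def by (rule Suc.IH) (use t in auto)
      hence *: "form_le n (mat_powr (mat_powr A1 (u / 2) * mat_powr (mat_powr X (1 / p)) p * mat_powr A1 (u / 2)) (1 / p))
          (mat_powr A1 (1 + u / p))"
        using A1 X u p by (intro furuta_step) auto
      have Xp: "mat_powr (mat_powr X (1 / p)) p = X"
        using X p by (simp add: mat_powr_powr[of _ n] mat_powr_one[of _ n])
      have "(1 + t / p) * (u / 2) = 1 / 2" using u(3) by simp
      hence Au: "mat_powr A1 (u / 2) = mat_powr A (1 / 2)"
        using A by (simp only: A1_def mat_powr_powr[OF pd_psd[OF A]])
      have "(1 + t / p) * (1 + u / p) = (1 + t / p) + ((1 + t / p) * u) / p"
        by (simp only: distrib_left mult_1_right times_divide_eq_right)
      also have "\<dots> = 1 + r / p" unfolding u(3) by (simp add: t_def diff_divide_distrib)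
      finally have Ar: "mat_powr A1 (1 + u / p) = mat_powr A (1 + r / p)"
        using A by (simp only: A1_def mat_powr_powr[OF pd_psd[OF A]])
      have Xr: "mat_powr A (1 / 2) * X * mat_powr A (1 / 2) = mat_powr A (r / 2) * mat_powr B p * mat_powr A (r / 2)"
      proof -
        have e: "1 / 2 + t / 2 = r / 2" "t / 2 + 1 / 2 = r / 2" by (auto simp: t_def field_simps)
        show ?thesis
          unfolding X_def using A B
          by (simp add: square_simps[where n=n] mat_powr_mult[of _ n] mat_powr_mult_left[of _ n] e)
      qed
      show ?thesis using * unfolding Xp Au Ar Xr .
    qed
  qed
  moreover obtain m where "r \<le> real m" using real_arch_simple by blast
  ultimately show ?thesis by blast
qed

lemma pd_lower_bound:
  assumes A: "A \<in> pd_mats n"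
  obtains c where "0 < c" "form_le n (scalar_mat n c) A"
proof -
  obtain U d where U: "unitary_diag n U d A" and d: "\<And>i. i < n \<Longrightarrow> 0 < d i"
    using pd_unitary_diag[OF A] by blast
  \<comment> \<open>The inserted 1 keeps the set nonempty when \<open>n = 0\<close>.\<close>
  define c where "c = Min (insert 1 (d ` {..<n}))"
  have c: "c \<le> d i" if "i < n" for i using that by (auto simp: c_def)
  have "qform (scalar_mat n c) v \<le> qform A v" if v: "v \<in> carrier_vec n" for v
    unfolding qform_scalar_mat[OF v] qform_unitary_diag[OF U v]
      qform_unitary_diag[OF unitary_diag_one[OF U] v, unfolded qform_one[OF v]] sum_distrib_left
    using c by (intro sum_mono) (simp add: mult_right_mono)
  moreover have "0 < c" using d by (auto simp: c_def)
  ultimately show ?thesis using that by (auto simp: form_le_def)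
qed

text \<open>For singular \<open>B\<close> and \<open>0 < c \<le> A\<close>, the matrix \<open>z B + (1 - z) c\<close> is positive definite, at most \<open>A\<close>, and its
  \<open>p\<close>-th power is at least \<open>z powr p\<close> times that of \<open>B\<close>; then \<open>z\<close> tends to 1.\<close>

lemma furuta:
  assumes A: "A \<in> pd_mats n" and B: "B \<in> psd_mats n" and le: "form_le n B A"
    and p: "1 \<le> p" and r: "0 \<le> r"
  shows "form_le n (mat_powr (mat_powr A (r / 2) * mat_powr B p * mat_powr A (r / 2)) (1 / p))
    (mat_powr A (1 + r / p))"
proof -
  obtain U d where U: "unitary_diag n U d B" and d: "\<And>i. i < n \<Longrightarrow> 0 \<le> d i"
    using psd_unitary_diag[OF B] by blast
  obtain c where c: "0 < c" "form_le n (scalar_mat n c) A" using pd_lower_bound[OF A] .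
  define X where "X = mat_powr A (r / 2) * mat_powr B p * mat_powr A (r / 2)"
  have X: "X \<in> psd_mats n" unfolding X_def using A B by (intro psd_sandwich_powr) auto
  have main: "form_le n (complex_of_real z \<cdot>\<^sub>m mat_powr X (1 / p)) (mat_powr A (1 + r / p))"
    if z: "0 < z" "z < 1" for z
  proof -
    define k where "k = (1 - z) * c"
    define B' where "B' = complex_of_real z \<cdot>\<^sub>m B + complex_of_real k \<cdot>\<^sub>m 1\<^sub>m n"
    have U': "unitary_diag n U (\<lambda>i. z * d i + k * 1) B'"
      unfolding B'_def by (intro unitary_diag_add unitary_diag_smult U unitary_diag_one[OF U])
    have k: "0 < k" using z c(1) by (simp add: k_def)
    have pos: "0 < z * d i + k" "z * d i \<le> z * d i + k" if "i < n" for i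
      using z k d[OF that] by (auto intro!: add_nonneg_pos)
    have B': "B' \<in> pd_mats n" using unitary_diag_pd_iff[OF U'] pos by simp
    have "form_le n B' A"
      unfolding form_le_def
    proof
      fix v :: "complex vec" assume v: "v \<in> carrier_vec n"
      have "qform B' v = z * qform B v + k * sqnorm v"
        unfolding B'_def using B v by (simp add: qform_add[of _ n] qform_smult[of _ n] qform_one)
      also have "\<dots> \<le> z * qform A v + (1 - z) * qform A v"
      proof (rule add_mono)
        show "z * qform B v \<le> z * qform A v" using le v z by (simp add: form_le_def)
        have "c * sqnorm v \<le> qform A v" using c(2) v by (force simp: form_le_def qform_scalar_mat)
        thus "k * sqnorm v \<le> (1 - z) * qform A v" unfolding k_def using z by simp
      qed
      finally show "qform B' v \<le> qform A v" by (simp add: algebra_simps)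
    qed
    \<comment> \<open>For p > 1 the power is not operator monotone, but the two matrices share the
      eigenvectors \<open>U\<close>, so their eigenvalues can be compared one by one.\<close>
    have *: "form_le n (mat_powr (complex_of_real z \<cdot>\<^sub>m B) p) (mat_powr B' p)"
      unfolding form_le_def
    proof
      fix v :: "complex vec" assume v: "v \<in> carrier_vec n"
      have 1: "unitary_diag n U (\<lambda>i. (z * d i) powr p) (mat_powr (complex_of_real z \<cdot>\<^sub>m B) p)"
        using z d by (intro mat_powr_unitary_diag unitary_diag_smult U) auto
      have 2: "unitary_diag n U (\<lambda>i. (z * d i + k * 1) powr p) (mat_powr B' p)"
        using pos by (intro mat_powr_unitary_diag U') (auto intro: less_imp_le)
      show "qform (mat_powr (complex_of_real z \<cdot>\<^sub>m B) p) v \<le> qform (mat_powr B' p) v"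
        unfolding qform_unitary_diag[OF 1 v] qform_unitary_diag[OF 2 v]
        using z d pos p by (intro sum_mono mult_right_mono powr_mono2) auto
    qed
    have zB: "mat_powr (complex_of_real z \<cdot>\<^sub>m B) p = complex_of_real (z powr p) \<cdot>\<^sub>m mat_powr B p"
      using B z by (simp add: mat_powr_smult(2)[of _ n])
    have zX: "mat_powr A (r / 2) * mat_powr (complex_of_real z \<cdot>\<^sub>m B) p * mat_powr A (r / 2)
        = complex_of_real (z powr p) \<cdot>\<^sub>m X"
      unfolding zB X_def using A B
      by (intro sandwich_smult[of _ n]) simp_all
    have "form_le n (complex_of_real (z powr p) \<cdot>\<^sub>m X) (mat_powr A (r / 2) * mat_powr B' p * mat_powr A (r / 2))"
      unfolding zX[symmetric] using * A B B' mat_powr_smult(1)[of B n z] z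
      by (intro form_le_sandwich_powr) auto
    hence "form_le n (mat_powr (complex_of_real (z powr p) \<cdot>\<^sub>m X) (1 / p))
        (mat_powr (mat_powr A (r / 2) * mat_powr B' p * mat_powr A (r / 2)) (1 / p))"
      using A B' X p mat_powr_smult(1)[OF X] by (intro loewner_heinz pd_sandwich_powr) auto
    also have "mat_powr (complex_of_real (z powr p) \<cdot>\<^sub>m X) (1 / p) = complex_of_real z \<cdot>\<^sub>m mat_powr X (1 / p)"
      using mat_powr_smult(2)[OF X, of "z powr p" "1 / p"] z p by (simp add: powr_powr)
    also have "form_le n (mat_powr (mat_powr A (r / 2) * mat_powr B' p * mat_powr A (r / 2)) (1 / p))
        (mat_powr A (1 + r / p))"
      using A B' \<open>form_le n B' A\<close> p r by (intro furuta_pd)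
    finally show ?thesis .
  qed
  have "qform (mat_powr X (1 / p)) v \<le> qform (mat_powr A (1 + r / p)) v" if v: "v \<in> carrier_vec n" for v
    by (rule field_le_mult_one_interval) (use main v X in \<open>auto simp: form_le_def qform_smult[of _ n]\<close>)
  thus ?thesis by (simp add: form_le_def X_def)
qed

text \<open>Against a scalar only the eigenvalues count, and taking powers is monotone on them for
  every positive exponent. This removes the outer power 1/p of both means.\<close>

lemma mat_powr_le_scalar_iff:
  assumes X: "X \<in> psd_mats n" and p: "0 < p" and c: "0 \<le> c"
  shows "form_le n (mat_powr X (1 / p)) (scalar_mat n c) \<longleftrightarrow> form_le n X (scalar_mat n (c powr p))"
proof -
  obtain U d where U: "unitary_diag n U d X" and d: "\<And>i. i < n \<Longrightarrow> 0 \<le> d i"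
    using psd_unitary_diag[OF X] by blast
  have "d i powr (1 / p) \<le> c \<longleftrightarrow> d i \<le> c powr p" if "i < n" for i
  proof
    assume "d i powr (1 / p) \<le> c"
    hence "(d i powr (1 / p)) powr p \<le> c powr p" using p by (intro powr_mono2) auto
    thus "d i \<le> c powr p" using p d[OF that] by (simp add: powr_powr)
  next
    assume "d i \<le> c powr p"
    hence "d i powr (1 / p) \<le> (c powr p) powr (1 / p)" using p d[OF that] by (intro powr_mono2) auto
    thus "d i powr (1 / p) \<le> c" using p c by (simp add: powr_powr)
  qed
  moreover have "unitary_diag n U (\<lambda>i. d i powr (1 / p)) (mat_powr X (1 / p))"
    using U d by (rule mat_powr_unitary_diag)
  ultimately show ?thesis
    using form_le_scalar_iff[OF U, of "c powr p"] form_le_scalar_iff[of n U _ "mat_powr X (1 / p)" c]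
    by (simp add: scalar_mat_def)
qed

lemma form_le_smult_iff:
  assumes "X \<in> carrier_mat n n" "Y \<in> carrier_mat n n" "0 < c"
  shows "form_le n (complex_of_real (1 / c) \<cdot>\<^sub>m X) Y \<longleftrightarrow> form_le n X (complex_of_real c \<cdot>\<^sub>m Y)"
proof -
  have "qform (complex_of_real (1 / c) \<cdot>\<^sub>m X) v \<le> qform Y v \<longleftrightarrow> qform X v \<le> qform (complex_of_real c \<cdot>\<^sub>m Y) v"
    if "v \<in> carrier_vec n" for v
    unfolding qform_smult[OF assms(1) that] qform_smult[OF assms(2) that]
    using assms(3) by (simp add: field_simps)
  thus ?thesis by (simp add: form_le_def)
qed

text \<open>The case p = q = 1 of part (2): Furuta's inequality for the pair Q <= P, where
  \<open>P\<close> is a negative power of \<open>A\<close> and \<open>Q\<close> a multiple of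
  Y^\<alpha>.\<close>

lemma bebiano_lemos_providencia:
  assumes A: "A \<in> pd_mats n" and B: "B \<in> psd_mats n" and \<alpha>: "0 < \<alpha>" "\<alpha> \<le> 1 / 2" and c: "0 < c"
    and le: "form_le n (mat_powr A (1 / 2 - \<alpha>) * mat_powr (mat_powr A (1 / 2) * B * mat_powr A (1 / 2)) \<alpha>
      * mat_powr A (1 / 2 - \<alpha>)) (scalar_mat n c)"
  shows "form_le n (mat_powr A ((1 - \<alpha>) / 2) * mat_powr B \<alpha> * mat_powr A ((1 - \<alpha>) / 2)) (scalar_mat n c)"
proof -
  define Y where "Y = mat_powr A (1 / 2) * B * mat_powr A (1 / 2)"
  have Y: "Y \<in> psd_mats n" unfolding Y_def using A B by (intro psd_sandwich_powr) auto
  have le': "form_le n (mat_powr Y \<alpha>) (complex_of_real c \<cdot>\<^sub>m mat_powr A (- 2 * (1 / 2 - \<alpha>)))"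
    using le form_le_move[OF A, of "mat_powr Y \<alpha>" "1 / 2 - \<alpha>" c] Y by (simp add: Y_def)
  show ?thesis
  proof (cases "\<alpha> = 1 / 2")
    \<comment> \<open>Here \<open>r\<close> below would divide by zero. The hypothesis is Y^(1/2) <=
      c, that is Y <= c^2, and Araki's inequality with exponent 1/2 finishes.\<close>
    case True
    hence "form_le n (mat_powr Y (1 / 2)) (scalar_mat n c)"
      using le' unfolding True by (simp add: mat_powr_zero[OF A] scalar_mat_def)
    hence "form_le n Y (scalar_mat n (c powr 2))"
      using mat_powr_le_scalar_iff[OF Y, of 2 c] c by simp
    hence "form_le n (mat_powr A (1 / 2 * (1 / 2)) * mat_powr B (1 / 2) * mat_powr A (1 / 2 * (1 / 2)))
        (scalar_mat n ((c powr 2) powr (1 / 2)))"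
      unfolding Y_def using c by (intro araki[OF A B]) auto
    thus ?thesis unfolding True using c by (simp add: powr_powr)
  next
    case False
    define P where "P = mat_powr A (- (1 - 2 * \<alpha>))"
    define Q where "Q = complex_of_real (1 / c) \<cdot>\<^sub>m mat_powr Y \<alpha>"
    \<comment> \<open>Then P^(r/2) = A^(-1/2), and Q^p with p = 1/\<alpha> is a multiple of Y, so
      their sandwich is a multiple of \<open>B\<close>. The exponent of \<open>A\<close> on the
      right becomes -(1 - 2\<alpha>) - \<alpha> = -(1 - \<alpha>).\<close>
    define r where "r = 1 / (1 - 2 * \<alpha>)"
    define p where "p = 1 / \<alpha>"
    have \<alpha>': "1 - 2 * \<alpha> > 0" using False \<alpha> by simp
    have r1: "(1 - 2 * \<alpha>) * r = 1" using \<alpha>' by (simp add: r_def)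
    have P: "P \<in> pd_mats n" using A by (simp add: P_def)
    have Q: "Q \<in> psd_mats n" unfolding Q_def using Y c by (intro mat_powr_smult) auto
    have "form_le n Q P"
      unfolding Q_def P_def using le' c A Y by (subst form_le_smult_iff) (simp_all add: algebra_simps)
    hence *: "form_le n (mat_powr (mat_powr P (r / 2) * mat_powr Q p * mat_powr P (r / 2)) (1 / p)) (mat_powr P (1 + r / p))"
      using \<alpha> \<alpha>' by (intro furuta P Q) (auto simp: p_def r_def field_simps)
    have Pr: "mat_powr P (r / 2) = mat_powr A (- (1 / 2))"
    proof -
      have "- (1 - 2 * \<alpha>) * (r / 2) = - ((1 - 2 * \<alpha>) * r) / 2" by (simp add: algebra_simps)
      hence "- (1 - 2 * \<alpha>) * (r / 2) = - (1 / 2)" unfolding r1 by simp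
      thus ?thesis by (simp only: P_def mat_powr_powr[OF pd_psd[OF A]])
    qed
    have P1: "mat_powr P (1 + r / p) = mat_powr A (- 2 * ((1 - \<alpha>) / 2))"
    proof -
      have "- (1 - 2 * \<alpha>) * (1 + r / p) = - (1 - 2 * \<alpha>) - ((1 - 2 * \<alpha>) * r) * \<alpha>"
        by (simp add: p_def algebra_simps)
      also have "\<dots> = - 2 * ((1 - \<alpha>) / 2)" unfolding r1 by simp
      finally have "- (1 - 2 * \<alpha>) * (1 + r / p) = - 2 * ((1 - \<alpha>) / 2)" .
      thus ?thesis by (simp only: P_def mat_powr_powr[OF pd_psd[OF A]])
    qed
    have Qp: "mat_powr Q p = complex_of_real ((1 / c) powr p) \<cdot>\<^sub>m Y"
    proof -
      have "mat_powr Q p = complex_of_real ((1 / c) powr p) \<cdot>\<^sub>m mat_powr (mat_powr Y \<alpha>) p"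
        unfolding Q_def using Y c by (intro mat_powr_smult(2)[of _ n]) auto
      also have "mat_powr (mat_powr Y \<alpha>) p = Y"
        using Y \<alpha> by (simp add: mat_powr_powr[of _ n] mat_powr_one[of _ n] p_def)
      finally show ?thesis .
    qed
    have "mat_powr A (- (1 / 2)) * Y * mat_powr A (- (1 / 2)) = B"
      unfolding Y_def using A B mat_powr_cancel[OF A] mat_powr_cancel_left[OF A]
      by (simp add: square_simps[where n=n] right_mult_one_mat[of _ n n])
    hence "mat_powr P (r / 2) * mat_powr Q p * mat_powr P (r / 2) = complex_of_real ((1 / c) powr p) \<cdot>\<^sub>m B"
      unfolding Pr Qp using A Y
      by (simp add: sandwich_smult[of _ n])
    moreover have "mat_powr (complex_of_real ((1 / c) powr p) \<cdot>\<^sub>m B) (1 / p) = complex_of_real (1 / c) \<cdot>\<^sub>m mat_powr B \<alpha>"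
      
    proof -
      have "((1 / c) powr p) powr (1 / p) = 1 / c" using c \<alpha> by (simp add: powr_powr p_def)
      thus ?thesis using mat_powr_smult(2)[OF B, of "(1 / c) powr p" "1 / p"] by (simp only: p_def) simp
    qed
    ultimately have "form_le n (complex_of_real (1 / c) \<cdot>\<^sub>m mat_powr B \<alpha>) (mat_powr A (- 2 * ((1 - \<alpha>) / 2)))"
      using * unfolding P1 by (simp only:)
    hence "form_le n (mat_powr B \<alpha>) (complex_of_real c \<cdot>\<^sub>m mat_powr A (- 2 * ((1 - \<alpha>) / 2)))"
      using c A B form_le_smult_iff[of "mat_powr B \<alpha>" n "mat_powr A (- 2 * ((1 - \<alpha>) / 2))" c]
      by (simp only: mat_powr_psd pd_psd psd_carrier)
    thus ?thesis using form_le_move[OF A, of "mat_powr B \<alpha>" "(1 - \<alpha>) / 2" c] B by simp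
  qed
qed

subsection \<open>Largest eigenvalues of the two means\<close>

lemma geo_mean_powr_eq:
  assumes "A \<in> psd_mats n" "B \<in> psd_mats n"
  shows "geo_mean \<alpha> (mat_powr A (- p)) (mat_powr B p) =
    mat_powr A (- p / 2) * mat_powr (mat_powr A (p / 2) * mat_powr B p * mat_powr A (p / 2)) \<alpha>
      * mat_powr A (- p / 2)"
  using assms by (simp add: geo_mean_def mat_powr_powr[of _ n])

lemma geo_mean_powr_psd:
  assumes "A \<in> psd_mats n" "B \<in> psd_mats n"
  shows "geo_mean \<alpha> (mat_powr A (- p)) (mat_powr B p) \<in> psd_mats n"
  unfolding geo_mean_powr_eq[OF assms] using assms by (intro psd_sandwich_powr mat_powr_psd)

lemma SG_tilde_psd:
  assumes "A \<in> psd_mats n" "B \<in> psd_mats n"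
  shows "SG_tilde \<alpha> p A B \<in> psd_mats n"
  unfolding SG_tilde_def Let_def
  using assms geo_mean_powr_psd by (intro mat_powr_psd psd_sandwich_powr) auto

lemma renyi_mean_psd:
  assumes "A \<in> psd_mats n" "B \<in> psd_mats n"
  shows "renyi_mean \<alpha> p A B \<in> psd_mats n"
  unfolding renyi_mean_def using assms by (intro mat_powr_psd psd_sandwich_powr)

lemma renyi_mean_le_iff:
  assumes "A \<in> psd_mats n" "B \<in> psd_mats n" "0 < q" "0 \<le> c"
  shows "form_le n (renyi_mean \<alpha> q A B) (scalar_mat n c) \<longleftrightarrow>
    form_le n (mat_powr A ((1 - \<alpha>) / 2 * q) * mat_powr B (\<alpha> * q) * mat_powr A ((1 - \<alpha>) / 2 * q))
      (scalar_mat n (c powr q))"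
  unfolding renyi_mean_def using assms by (intro mat_powr_le_scalar_iff psd_sandwich_powr mat_powr_psd)

text \<open>With K = A^((1-\<alpha>)p) G^(1/2) the mean is the power 1/p of
  \<open>mat_adjoint K * K\<close>. In the opposite product the outer factors A^(-p/2) of
  \<open>G\<close> merge with A^((1-\<alpha>)p) into A^((1/2-\<alpha>)p).\<close>

lemma SG_tilde_le_iff:
  assumes A: "A \<in> pd_mats n" and B: "B \<in> psd_mats n" and p: "0 < p" and c: "0 \<le> c"
  shows "form_le n (SG_tilde \<alpha> p A B) (scalar_mat n c) \<longleftrightarrow>
    form_le n (mat_powr A ((1 / 2 - \<alpha>) * p)
        * mat_powr (mat_powr A (p / 2) * mat_powr B p * mat_powr A (p / 2)) \<alpha>
        * mat_powr A ((1 / 2 - \<alpha>) * p))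
      (scalar_mat n (c powr p))"
proof -
  define G where "G = geo_mean \<alpha> (mat_powr A (- p)) (mat_powr B p)"
  define K where "K = mat_powr A ((1 - \<alpha>) * p) * mat_powr G (1 / 2)"
  define Y where "Y = mat_powr A (p / 2) * mat_powr B p * mat_powr A (p / 2)"
  note sq = square_simps[where n=n]
  have G: "G \<in> psd_mats n" unfolding G_def using A B by (intro geo_mean_powr_psd) auto
  have [simp]: "mat_powr A r \<in> carrier_mat n n" "mat_powr G r \<in> carrier_mat n n" for r
    using A G by simp_all
  have Y: "Y \<in> psd_mats n" unfolding Y_def using A B by (intro psd_sandwich_powr) auto
  note Am = mat_powr_mult[OF pd_psd[OF A]] mat_powr_mult_left[OF pd_psd[OF A]]
  have K: "K \<in> carrier_mat n n" by (simp add: K_def sq)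
  have Ka: "mat_adjoint K = mat_powr G (1 / 2) * mat_powr A ((1 - \<alpha>) * p)"
    unfolding K_def using A G by (simp add: sq mat_powr_adjoint[of _ n])
  have e: "(1 - \<alpha>) * p + (1 - \<alpha>) * p = 2 * (1 - \<alpha>) * p" by simp
  have 1: "mat_adjoint K * K = mat_powr G (1 / 2) * mat_powr A (2 * (1 - \<alpha>) * p) * mat_powr G (1 / 2)"
    unfolding Ka unfolding K_def by (simp add: sq Am e)
  have "K * mat_adjoint K = mat_powr A ((1 - \<alpha>) * p) * G * mat_powr A ((1 - \<alpha>) * p)"
    unfolding Ka unfolding K_def using G
    by (simp add: sq mat_powr_mult_left[of _ n])
  also have "G = mat_powr A (- p / 2) * mat_powr Y \<alpha> * mat_powr A (- p / 2)"
    unfolding G_def Y_def using A B by (intro geo_mean_powr_eq) auto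
  also have "mat_powr A ((1 - \<alpha>) * p) * \<dots> * mat_powr A ((1 - \<alpha>) * p) =
      mat_powr A ((1 / 2 - \<alpha>) * p) * mat_powr Y \<alpha> * mat_powr A ((1 / 2 - \<alpha>) * p)"
  proof -
    have e: "(1 - \<alpha>) * p + - p / 2 = (1 / 2 - \<alpha>) * p" "- p / 2 + (1 - \<alpha>) * p = (1 / 2 - \<alpha>) * p"
      by (simp_all add: field_simps)
    show ?thesis using Y by (simp only: sq Am e mat_powr_psd psd_carrier \<open>\<And>r. mat_powr A r \<in> carrier_mat n n\<close>)
  qed
  finally have 2: "K * mat_adjoint K =
      mat_powr A ((1 / 2 - \<alpha>) * p) * mat_powr Y \<alpha> * mat_powr A ((1 / 2 - \<alpha>) * p)" .
  have "form_le n (mat_adjoint K * K) (scalar_mat n (c powr p)) \<longleftrightarrow>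
      form_le n (K * mat_adjoint K) (scalar_mat n (c powr p))"
    using form_le_adjoint_swap[of K n "c powr p"] form_le_adjoint_swap[of "mat_adjoint K" n "c powr p"] K
    by auto
  moreover have "SG_tilde \<alpha> p A B = mat_powr (mat_adjoint K * K) (1 / p)"
    unfolding 1 by (simp add: SG_tilde_def Let_def G_def)
  ultimately show ?thesis
    using mat_powr_le_scalar_iff[OF adjoint_mult_psd(1)[OF K] p c] unfolding 2 Y_def by simp
qed

text \<open>Araki's inequality twice: with exponent r = p/(\<alpha>q), which is at most 1 exactly by
  \<open>pq\<close>, to turn B^(\<alpha>q) into B^p, and then with exponent \<alpha> applied to
  \<open>Y\<close>.\<close>

lemma SG_tilde_le_renyi_mean:
  assumes A: "A \<in> pd_mats n" and B: "B \<in> psd_mats n" and \<alpha>: "0 < \<alpha>" "\<alpha> < 1"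
    and p: "0 < p" and q: "0 < q" and pq: "p / q \<le> \<alpha>" and c: "0 < c"
    and le: "form_le n (renyi_mean \<alpha> q A B) (scalar_mat n c)"
  shows "form_le n (SG_tilde \<alpha> p A B) (scalar_mat n c)"
proof -
  define Y where "Y = mat_powr A (p / 2) * mat_powr B p * mat_powr A (p / 2)"
  have Y: "Y \<in> psd_mats n" unfolding Y_def using A B by (intro psd_sandwich_powr) auto
  have [simp]: "mat_powr A r \<in> carrier_mat n n" "mat_powr B r \<in> carrier_mat n n" for r
    using A B by simp_all
  define r where "r = p / (\<alpha> * q)"
  \<comment> \<open>Forced by the exponents: x + p/2 must equal r(1-\<alpha>)q/2 so that the first
    bound is one on A^x Y A^x, and \<alpha>x = (1/2-\<alpha>)p is what the mean requires.\<close>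
  define x where "x = (1 / 2 - \<alpha>) * p / \<alpha>"
  have r: "0 \<le> r" "r \<le> 1" using \<alpha> p q pq by (auto simp: r_def field_simps)
  have "form_le n (mat_powr A ((1 - \<alpha>) / 2 * q) * mat_powr B (\<alpha> * q) * mat_powr A ((1 - \<alpha>) / 2 * q))
      (scalar_mat n (c powr q))"
    using le renyi_mean_le_iff[of A n B q c \<alpha>] A B q c by simp
  hence "form_le n (mat_powr A (r * ((1 - \<alpha>) / 2 * q)) * mat_powr (mat_powr B (\<alpha> * q)) r
      * mat_powr A (r * ((1 - \<alpha>) / 2 * q))) (scalar_mat n ((c powr q) powr r))"
    using A B r c by (intro araki) auto
  also have "mat_powr (mat_powr B (\<alpha> * q)) r = mat_powr B p"
    using B \<alpha> q by (simp add: mat_powr_powr[of _ n] r_def)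
  also have "r * ((1 - \<alpha>) / 2 * q) = x + p / 2"
    using \<alpha> q by (simp add: r_def x_def field_simps)
  also have "(c powr q) powr r = c powr (p / \<alpha>)"
    using \<alpha> q by (simp add: powr_powr r_def)
  also have "mat_powr A (x + p / 2) * mat_powr B p * mat_powr A (x + p / 2) = mat_powr A x * Y * mat_powr A x"
    unfolding Y_def using A
    by (simp add: square_simps[where n=n] mat_powr_mult[of _ n] mat_powr_mult_left[of _ n] add.commute)
  finally have "form_le n (mat_powr A (\<alpha> * x) * mat_powr Y \<alpha> * mat_powr A (\<alpha> * x))
      (scalar_mat n ((c powr (p / \<alpha>)) powr \<alpha>))"
    using A Y \<alpha> c by (intro araki) auto
  moreover have "(c powr (p / \<alpha>)) powr \<alpha> = c powr p" "\<alpha> * x = (1 / 2 - \<alpha>) * p"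
    using \<alpha> by (simp_all add: powr_powr x_def)
  ultimately show ?thesis
    using SG_tilde_le_iff[OF A B p, of c \<alpha>] c by (simp add: Y_def)
qed

text \<open>The preceding inequality for A^p and B^p settles q = p; Araki's inequality with exponent
  q/p then lowers p to q.\<close>

lemma renyi_mean_le_SG_tilde:
  assumes A: "A \<in> pd_mats n" and B: "B \<in> psd_mats n" and \<alpha>: "0 < \<alpha>" "\<alpha> \<le> 1 / 2"
    and q: "0 < q" and qp: "q \<le> p" and c: "0 < c"
    and le: "form_le n (SG_tilde \<alpha> p A B) (scalar_mat n c)"
  shows "form_le n (renyi_mean \<alpha> q A B) (scalar_mat n c)"
proof -
  have p: "0 < p" using q qp by simp
  have [simp]: "mat_powr (mat_powr A p) s = mat_powr A (p * s)" "mat_powr (mat_powr B p) s = mat_powr B (p * s)" for s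
    using A B by (simp_all add: mat_powr_powr[of _ n])
  have "form_le n (mat_powr (mat_powr A p) (1 / 2 - \<alpha>) * mat_powr (mat_powr (mat_powr A p) (1 / 2)
      * mat_powr B p * mat_powr (mat_powr A p) (1 / 2)) \<alpha> * mat_powr (mat_powr A p) (1 / 2 - \<alpha>))
    (scalar_mat n (c powr p))"
    using le SG_tilde_le_iff[OF A B p, of c \<alpha>] c by (simp add: mult.commute)
  hence "form_le n (mat_powr (mat_powr A p) ((1 - \<alpha>) / 2) * mat_powr (mat_powr B p) \<alpha>
      * mat_powr (mat_powr A p) ((1 - \<alpha>) / 2)) (scalar_mat n (c powr p))"
    using A B \<alpha> c by (intro bebiano_lemos_providencia) auto
  hence "form_le n (mat_powr A (p * ((1 - \<alpha>) / 2)) * mat_powr B (p * \<alpha>) * mat_powr A (p * ((1 - \<alpha>) / 2)))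
      (scalar_mat n (c powr p))" by simp
  hence "form_le n (mat_powr A (q / p * (p * ((1 - \<alpha>) / 2))) * mat_powr (mat_powr B (p * \<alpha>)) (q / p)
      * mat_powr A (q / p * (p * ((1 - \<alpha>) / 2)))) (scalar_mat n ((c powr p) powr (q / p)))"
    using A B p q qp c by (intro araki) auto
  also have "mat_powr (mat_powr B (p * \<alpha>)) (q / p) = mat_powr B (\<alpha> * q)"
    using B p by (simp add: mat_powr_powr[of _ n])
  also have "q / p * (p * ((1 - \<alpha>) / 2)) = (1 - \<alpha>) / 2 * q" using p by simp
  also have "(c powr p) powr (q / p) = c powr q" using p by (simp add: powr_powr)
  finally show ?thesis
    using renyi_mean_le_iff[of A n B q c \<alpha>] A B q c by simp
qed

subsection \<open>Compound matrices\<close>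

text \<open>The rows and columns of the \<open>k\<close>-th compound matrix are indexed by the \<open>k\<close>-subsets of \<open>{..<n}\<close>,
  represented as increasing lists.\<close>

definition incr_lists :: "nat \<Rightarrow> nat \<Rightarrow> nat list list" where
  "incr_lists n k = filter (sorted_wrt (<)) (List.n_lists k [0..<n])"

lemma distinct_incr_lists: "distinct (incr_lists n k)"
  by (simp add: incr_lists_def distinct_n_lists)

lemma set_incr_lists:
  "set (incr_lists n k) = {J. length J = k \<and> sorted_wrt (<) J \<and> set J \<subseteq> {..<n}}"
  by (auto simp: incr_lists_def set_n_lists)

lemma nth_incr_lists_less: "J \<in> set (incr_lists n k) \<Longrightarrow> a < k \<Longrightarrow> J ! a < n"
proof -
  assume "J \<in> set (incr_lists n k)" "a < k"
  hence "J ! a \<in> set J" "set J \<subseteq> {..<n}" by (auto simp: set_incr_lists)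
  thus "J ! a < n" by blast
qed

definition minor :: "complex mat \<Rightarrow> nat list \<Rightarrow> nat list \<Rightarrow> complex" where
  "minor A I J = det (mat (length I) (length J) (\<lambda>(a, b). A $$ (I ! a, J ! b)))"

definition compound :: "nat \<Rightarrow> complex mat \<Rightarrow> complex mat" where
  "compound k A = (let L = incr_lists (dim_row A) k
     in mat (length L) (length L) (\<lambda>(i, j). minor A (L ! i) (L ! j)))"

abbreviation compound_dim :: "nat \<Rightarrow> nat \<Rightarrow> nat" where
  "compound_dim n k \<equiv> length (incr_lists n k)"

text \<open>Multilinearity in the rows: the Leibniz formula is expanded over all choices \<phi> of
  an intermediate index for each row.\<close>

lemma det_sum_products:
  fixes f g :: "nat \<Rightarrow> nat \<Rightarrow> 'a :: comm_ring_1"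
  shows "det (mat k k (\<lambda>(a, b). \<Sum>j<n. f a j * g j b)) =
    (\<Sum>\<phi>\<in>{0..<k} \<rightarrow>\<^sub>E {..<n}. (\<Prod>a=0..<k. f a (\<phi> a)) * det (mat k k (\<lambda>(a, b). g (\<phi> a) b)))"
proof -
  let ?P = "{p. p permutes {0..<k}}"
  have "det (mat k k (\<lambda>(a, b). \<Sum>j<n. f a j * g j b)) =
      (\<Sum>p\<in>?P. signof p * (\<Prod>a=0..<k. \<Sum>j<n. f a j * g j (p a)))"
    by (subst det_def'[of _ k]) (auto intro!: sum.cong prod.cong simp: permutes_in_image)
  also have "\<dots> = (\<Sum>p\<in>?P. \<Sum>\<phi>\<in>{0..<k} \<rightarrow>\<^sub>E {..<n}. signof p * (\<Prod>a=0..<k. f a (\<phi> a) * g (\<phi> a) (p a)))"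
    by (simp add: prod_sum_PiE sum_distrib_left)
  also have "\<dots> = (\<Sum>\<phi>\<in>{0..<k} \<rightarrow>\<^sub>E {..<n}. \<Sum>p\<in>?P. signof p * (\<Prod>a=0..<k. f a (\<phi> a) * g (\<phi> a) (p a)))"
    by (rule sum.swap)
  also have "\<dots> = (\<Sum>\<phi>\<in>{0..<k} \<rightarrow>\<^sub>E {..<n}. (\<Prod>a=0..<k. f a (\<phi> a)) * (\<Sum>p\<in>?P. signof p * (\<Prod>a=0..<k. g (\<phi> a) (p a))))"
    by (simp add: prod.distrib sum_distrib_left mult_ac)
  also have "\<dots> = (\<Sum>\<phi>\<in>{0..<k} \<rightarrow>\<^sub>E {..<n}. (\<Prod>a=0..<k. f a (\<phi> a)) * det (mat k k (\<lambda>(a, b). g (\<phi> a) b)))"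
    by (subst det_def'[of _ k]) (auto intro!: sum.cong prod.cong simp: permutes_in_image)
  finally show ?thesis .
qed

text \<open>An injective map is the increasing enumeration of its image after a unique permutation.
  This groups the surviving terms of the expansion by the image \<open>J\<close>;
  \<open>restrict\<close> makes the composites extensional, as the function space demands.\<close>

lemma injective_eq_incr_comp_permutation:
  "bij_betw (\<lambda>(J, \<sigma>). restrict (\<lambda>a. J ! \<sigma> a) {0..<k})
     (set (incr_lists n k) \<times> {\<sigma>. \<sigma> permutes {0..<k}})
     {\<phi> \<in> {0..<k} \<rightarrow>\<^sub>E {..<n}. inj_on \<phi> {0..<k}}"
  (is "bij_betw ?h ?S ?T")
proof (rule bij_betw_imageI)
  have dist: "distinct J" if "sorted_wrt (<) J" for J :: "nat list"
    using that strict_sorted_iff by blast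
  have range: "(\<lambda>a. J ! \<sigma> a) ` {0..<k} = set J" if "length J = k" "\<sigma> permutes {0..<k}" for J :: "nat list" and \<sigma>
  proof -
    have "(\<lambda>a. J ! \<sigma> a) ` {0..<k} = (!) J ` (\<sigma> ` {0..<k})" by (simp add: image_image)
    also have "\<dots> = set J" using permutes_image[OF that(2)] that(1)
      by (auto simp: in_set_conv_nth)
    finally show ?thesis .
  qed
  show "inj_on ?h ?S"
  proof (rule inj_onI, clarify)
    fix J \<sigma> J' \<sigma>'
    assume J: "J \<in> set (incr_lists n k)" "J' \<in> set (incr_lists n k)"
      and \<sigma>: "\<sigma> permutes {0..<k}" "\<sigma>' permutes {0..<k}"
      and eq: "restrict (\<lambda>a. J ! \<sigma> a) {0..<k} = restrict (\<lambda>a. J' ! \<sigma>' a) {0..<k}"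
    have len: "length J = k" "length J' = k" and srt: "sorted_wrt (<) J" "sorted_wrt (<) J'"
      using J by (auto simp: set_incr_lists)
    have e: "J ! \<sigma> a = J' ! \<sigma>' a" if "a < k" for a
      using fun_cong[OF eq, of a] that by simp
    have "set J = set J'"
      unfolding range[OF len(1) \<sigma>(1), symmetric] range[OF len(2) \<sigma>(2), symmetric]
      using e by (intro image_cong) auto
    hence JJ: "J = J'" using srt strict_sorted_equal by blast
    have "\<sigma> a = \<sigma>' a" for a
    proof (cases "a < k")
      case True
      hence "\<sigma> a < k" "\<sigma>' a < k" using permutes_in_image[OF \<sigma>(1)] permutes_in_image[OF \<sigma>(2)] by auto
      thus ?thesis using e[OF True] dist[OF srt(1)] len by (simp add: JJ nth_eq_iff_index_eq)
    next
      case False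
      thus ?thesis using \<sigma> by (simp add: permutes_def)
    qed
    thus "J = J' \<and> \<sigma> = \<sigma>'" using JJ by auto
  qed
  show "?h ` ?S = ?T"
  proof (intro equalityI subsetI)
    fix \<phi> assume "\<phi> \<in> ?h ` ?S"
    then obtain J \<sigma> where J: "J \<in> set (incr_lists n k)" and \<sigma>: "\<sigma> permutes {0..<k}"
      and \<phi>: "\<phi> = restrict (\<lambda>a. J ! \<sigma> a) {0..<k}" by auto
    have len: "length J = k" and d: "distinct J" and sub: "set J \<subseteq> {..<n}"
      using J dist by (auto simp: set_incr_lists)
    have s: "\<sigma> a < k" if "a < k" for a using permutes_in_image[OF \<sigma>, of a] that by simp
    have "inj_on \<phi> {0..<k}"
    proof (rule inj_onI)
      fix a b assume ab: "a \<in> {0..<k}" "b \<in> {0..<k}" "\<phi> a = \<phi> b"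
      hence "\<sigma> a = \<sigma> b" using s d len by (simp add: \<phi> nth_eq_iff_index_eq)
      thus "a = b" using permutes_inj[OF \<sigma>] by (simp add: inj_eq)
    qed
    moreover have "\<phi> \<in> {0..<k} \<rightarrow>\<^sub>E {..<n}"
      using s len sub nth_mem by (fastforce simp: \<phi>)
    ultimately show "\<phi> \<in> ?T" by simp
  next
    fix \<phi> assume \<phi>: "\<phi> \<in> ?T"
    define J where "J = sorted_list_of_set (\<phi> ` {0..<k})"
    have card: "card (\<phi> ` {0..<k}) = k" using \<phi> by (simp add: card_image)
    have len: "length J = k" using card by (simp add: J_def)
    have setJ: "set J = \<phi> ` {0..<k}" by (simp add: J_def)
    have J: "J \<in> set (incr_lists n k)"
      using len setJ \<phi> by (auto simp: set_incr_lists J_def)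
    have bij: "bij_betw ((!) J) {0..<k} (\<phi> ` {0..<k})"
      using bij_betw_nth[of J "{0..<k}" "\<phi> ` {0..<k}"] len setJ by (simp add: J_def atLeast0LessThan)
    \<comment> \<open>The position of \<open>\<phi> a\<close> in the sorted image;
      \<open>\<sigma>\<close> extends it by the identity, since \<open>permutes\<close> requires
      fixed points outside.\<close>
    define \<tau> where "\<tau> = inv_into {0..<k} ((!) J) \<circ> \<phi>"
    define \<sigma> where "\<sigma> = (\<lambda>a. if a \<in> {0..<k} then \<tau> a else a)"
    have "bij_betw \<tau> {0..<k} {0..<k}"
      unfolding \<tau>_def using \<phi> bij_betw_inv_into[OF bij]
      by (intro bij_betw_trans[of \<phi> _ "\<phi> ` {0..<k}"]) (auto simp: bij_betw_def)
    hence "bij_betw \<sigma> {0..<k} {0..<k}"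
      by (rule bij_betw_cong[THEN iffD1, rotated]) (simp add: \<sigma>_def)
    hence \<sigma>: "\<sigma> permutes {0..<k}" by (rule bij_imp_permutes) (simp add: \<sigma>_def)
    have "\<phi> = ?h (J, \<sigma>)"
    proof
      fix a
      show "\<phi> a = ?h (J, \<sigma>) a"
      proof (cases "a < k")
        case True
        have "J ! \<tau> a = \<phi> a"
          unfolding \<tau>_def using True bij_betw_inv_into_right[OF bij, of "\<phi> a"] by simp
        thus ?thesis using True by (simp add: \<sigma>_def)
      next
        case False
        thus ?thesis using \<phi> by (auto simp: PiE_def extensional_def)
      qed
    qed
    thus "\<phi> \<in> ?h ` ?S" using J \<sigma> by blast
  qed
qed

text \<open>Terms with a non-injective \<phi> vanish by equal rows. For a fixed image
  \<open>J\<close>, reordering the rows of the second factor gives the sign that completes the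
  Leibniz sum of the first.\<close>

theorem cauchy_binet:
  assumes A: "A \<in> carrier_mat n n" and B: "B \<in> carrier_mat n n"
    and I: "I \<in> set (incr_lists n k)" and K: "K \<in> set (incr_lists n k)"
  shows "minor (A * B) I K = (\<Sum>J\<in>set (incr_lists n k). minor A I J * minor B J K)"
proof -
  define f where "f = (\<lambda>a j. A $$ (I ! a, j))"
  define g where "g = (\<lambda>j b. B $$ (j, K ! b))"
  let ?P = "{p. p permutes {0..<k}}"
  let ?G = "\<lambda>\<phi>. (\<Prod>a=0..<k. f a (\<phi> a)) * det (mat k k (\<lambda>(a, b). g (\<phi> a) b))"
  have len: "length I = k" "length K = k" using I K by (auto simp: set_incr_lists)
  have lt: "I ! a < n" "K ! a < n" if "a < k" for a
    using nth_incr_lists_less[OF I] nth_incr_lists_less[OF K] that by blast+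
  have "minor (A * B) I K = det (mat k k (\<lambda>(a, b). \<Sum>j<n. f a j * g j b))"
    unfolding minor_def len f_def g_def using A B lt
    by (intro arg_cong[of _ _ det] eq_matI) (auto simp: scalar_prod_def atLeast0LessThan)
  also have "\<dots> = (\<Sum>\<phi>\<in>{0..<k} \<rightarrow>\<^sub>E {..<n}. ?G \<phi>)" by (rule det_sum_products)
  also have "\<dots> = (\<Sum>\<phi>\<in>{\<phi> \<in> {0..<k} \<rightarrow>\<^sub>E {..<n}. inj_on \<phi> {0..<k}}. ?G \<phi>)"
  proof (rule sum.mono_neutral_right)
    show "\<forall>\<phi>\<in>({0..<k} \<rightarrow>\<^sub>E {..<n}) - {\<phi> \<in> {0..<k} \<rightarrow>\<^sub>E {..<n}. inj_on \<phi> {0..<k}}. ?G \<phi> = 0"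
    proof
      fix \<phi> assume "\<phi> \<in> ({0..<k} \<rightarrow>\<^sub>E {..<n}) - {\<phi> \<in> {0..<k} \<rightarrow>\<^sub>E {..<n}. inj_on \<phi> {0..<k}}"
      then obtain a b where ab: "a < k" "b < k" "a \<noteq> b" "\<phi> a = \<phi> b" by (auto simp: inj_on_def)
      have "det (mat k k (\<lambda>(a, b). g (\<phi> a) b)) = 0"
        by (rule det_identical_rows[of _ k a b]) (use ab in \<open>auto intro!: eq_vecI\<close>)
      thus "?G \<phi> = 0" by simp
    qed
  qed (auto intro: finite_PiE)
  also have "\<dots> = (\<Sum>(J, \<sigma>)\<in>set (incr_lists n k) \<times> ?P. ?G (restrict (\<lambda>a. J ! \<sigma> a) {0..<k}))"
    using sum.reindex_bij_betw[OF injective_eq_incr_comp_permutation[of k n], of ?G]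
    by (simp add: case_prod_unfold)
  also have "\<dots> = (\<Sum>J\<in>set (incr_lists n k). \<Sum>\<sigma>\<in>?P. ?G (restrict (\<lambda>a. J ! \<sigma> a) {0..<k}))"
    by (rule sum.cartesian_product[symmetric])
  also have "\<dots> = (\<Sum>J\<in>set (incr_lists n k). minor A I J * minor B J K)"
  proof (rule sum.cong[OF refl])
    fix J assume "J \<in> set (incr_lists n k)"
    hence lenJ: "length J = k" by (simp add: set_incr_lists)
    have Bm: "mat k k (\<lambda>(a, b). g (J ! a) b) \<in> carrier_mat k k" by simp
    have *: "?G (restrict (\<lambda>a. J ! \<sigma> a) {0..<k}) =
        signof \<sigma> * (\<Prod>a=0..<k. f a (J ! \<sigma> a)) * det (mat k k (\<lambda>(a, b). g (J ! a) b))"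
      if \<sigma>: "\<sigma> permutes {0..<k}" for \<sigma>
    proof -
      have s: "\<sigma> a < k" if "a < k" for a using permutes_in_image[OF \<sigma>, of a] that by simp
      have "mat k k (\<lambda>(a, b). g (restrict (\<lambda>a. J ! \<sigma> a) {0..<k} a) b) =
          mat k k (\<lambda>(a, b). mat k k (\<lambda>(a, b). g (J ! a) b) $$ (\<sigma> a, b))"
        by (rule eq_matI) (auto simp: s)
      thus ?thesis using det_permute_rows[OF Bm \<sigma>] by (simp add: mult_ac)
    qed
    have "(\<Sum>\<sigma>\<in>?P. ?G (restrict (\<lambda>a. J ! \<sigma> a) {0..<k})) =
        (\<Sum>\<sigma>\<in>?P. signof \<sigma> * (\<Prod>a=0..<k. f a (J ! \<sigma> a))) * det (mat k k (\<lambda>(a, b). g (J ! a) b))"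
      unfolding sum_distrib_right by (intro sum.cong refl *) simp
    also have "(\<Sum>\<sigma>\<in>?P. signof \<sigma> * (\<Prod>a=0..<k. f a (J ! \<sigma> a))) = minor A I J"
      unfolding minor_def len lenJ
      by (subst det_def'[of _ k]) (auto intro!: sum.cong prod.cong simp: f_def permutes_in_image)
    also have "det (mat k k (\<lambda>(a, b). g (J ! a) b)) = minor B J K"
      unfolding minor_def len lenJ g_def ..
    finally show "(\<Sum>\<sigma>\<in>?P. ?G (restrict (\<lambda>a. J ! \<sigma> a) {0..<k})) = minor A I J * minor B J K" .
  qed
  finally show ?thesis .
qed

lemma compound_carrier [simp]:
  "A \<in> carrier_mat n n \<Longrightarrow> compound k A \<in> carrier_mat (compound_dim n k) (compound_dim n k)"
  by (simp add: compound_def Let_def)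

lemma compound_index:
  assumes "A \<in> carrier_mat n n" "i < compound_dim n k" "j < compound_dim n k"
  shows "compound k A $$ (i, j) = minor A (incr_lists n k ! i) (incr_lists n k ! j)"
  using assms by (simp add: compound_def Let_def)

lemma compound_mult:
  assumes A: "A \<in> carrier_mat n n" and B: "B \<in> carrier_mat n n"
  shows "compound k (A * B) = compound k A * compound k B"
proof (rule eq_matI)
  note c = compound_carrier[OF A, of k] compound_carrier[OF B, of k]
  have AB: "A * B \<in> carrier_mat n n" using A B by simp
  let ?L = "incr_lists n k"
  fix i j assume "i < dim_row (compound k A * compound k B)" "j < dim_col (compound k A * compound k B)"
  hence ij: "i < length ?L" "j < length ?L" using c by auto
  have "compound k (A * B) $$ (i, j) = (\<Sum>J\<in>set ?L. minor A (?L ! i) J * minor B J (?L ! j))"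
    using compound_index[OF AB ij] ij cauchy_binet[OF A B, of "?L ! i" k "?L ! j"] by simp
  also have "\<dots> = (\<Sum>l<length ?L. minor A (?L ! i) (?L ! l) * minor B (?L ! l) (?L ! j))"
    using sum.reindex_bij_betw[OF bij_betw_nth[OF distinct_incr_lists[of n k] refl refl],
        of "\<lambda>J. minor A (?L ! i) J * minor B J (?L ! j)"] by simp
  also have "\<dots> = (compound k A * compound k B) $$ (i, j)"
    using c ij by (simp add: scalar_prod_def atLeast0LessThan compound_index[OF A] compound_index[OF B])
  finally show "compound k (A * B) $$ (i, j) = (compound k A * compound k B) $$ (i, j)" .
qed (use compound_carrier[OF A, of k] compound_carrier[OF B, of k] compound_carrier[OF mult_carrier_mat[OF A B], of k] in auto)

lemma minor_adjoint:
  assumes A: "A \<in> carrier_mat n n"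
    and I: "I \<in> set (incr_lists n k)" and J: "J \<in> set (incr_lists n k)"
  shows "minor (mat_adjoint A) I J = cnj (minor A J I)"
proof -
  interpret cnj: comm_ring_hom cnj by unfold_locales auto
  have len: "length I = k" "length J = k" using I J by (auto simp: set_incr_lists)
  have lt: "I ! a < n" "J ! a < n" if "a < k" for a
    using nth_incr_lists_less[OF I] nth_incr_lists_less[OF J] that by blast+
  let ?M = "mat k k (\<lambda>(a, b). A $$ (J ! a, I ! b))"
  have "minor (mat_adjoint A) I J = det (transpose_mat (map_mat cnj ?M))"
    unfolding minor_def len using A lt by (intro arg_cong[of _ _ det] eq_matI) auto
  also have "\<dots> = det (map_mat cnj ?M)"
    by (rule det_transpose[of _ k]) simp
  also have "\<dots> = cnj (det ?M)" by (rule cnj.hom_det)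
  finally show ?thesis by (simp add: minor_def len)
qed

lemma compound_adjoint:
  assumes A: "A \<in> carrier_mat n n"
  shows "compound k (mat_adjoint A) = mat_adjoint (compound k A)"
proof (rule eq_matI)
  note c = compound_carrier[OF A, of k]
  have A': "mat_adjoint A \<in> carrier_mat n n" using A by simp
  fix i j assume "i < dim_row (mat_adjoint (compound k A))" "j < dim_col (mat_adjoint (compound k A))"
  hence ij: "i < compound_dim n k" "j < compound_dim n k" using c by auto
  show "compound k (mat_adjoint A) $$ (i, j) = mat_adjoint (compound k A) $$ (i, j)"
    using c ij compound_index[OF A' ij] compound_index[OF A ij(2,1)]
      minor_adjoint[OF A nth_mem[OF ij(1)] nth_mem[OF ij(2)]] by simp
qed (use compound_carrier[OF A, of k] compound_carrier[OF mat_adjoint_carrier[OF A], of k] in auto)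

text \<open>A diagonal minor is a product of entries. For two different subsets of equal size, some
  index of \<open>I\<close> is outside \<open>J\<close>, and its row in the minor is zero.\<close>

lemma compound_diag:
  "compound k (mat_diag n d) = mat_diag (compound_dim n k) (\<lambda>i. \<Prod>j\<in>set (incr_lists n k ! i). d j)"
proof (rule eq_matI)
  have D: "mat_diag n d \<in> carrier_mat n n" by simp
  note c = compound_carrier[OF D, of k]
  let ?R = "mat_diag (compound_dim n k) (\<lambda>i. \<Prod>j\<in>set (incr_lists n k ! i). d j)"
  fix i j assume "i < dim_row ?R" "j < dim_col ?R"
  hence ij: "i < compound_dim n k" "j < compound_dim n k" by auto
  define I J where "I = incr_lists n k ! i" and "J = incr_lists n k ! j"
  have I: "I \<in> set (incr_lists n k)" and J: "J \<in> set (incr_lists n k)" using ij by (auto simp: I_def J_def)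
  have len: "length I = k" "length J = k" using I J by (auto simp: set_incr_lists)
  have srt: "sorted_wrt (<) I" "sorted_wrt (<) J" using I J by (auto simp: set_incr_lists)
  have lt: "I ! a < n" "J ! a < n" if "a < k" for a
    using nth_incr_lists_less[OF I] nth_incr_lists_less[OF J] that by blast+
  let ?M = "mat k k (\<lambda>(a, b). mat_diag n d $$ (I ! a, J ! b))"
  have cij: "compound k (mat_diag n d) $$ (i, j) = det ?M"
    using compound_index[OF D ij] by (simp add: minor_def len flip: I_def J_def)
  show "compound k (mat_diag n d) $$ (i, j) = ?R $$ (i, j)"
  proof (cases "i = j")
    case True
    hence IJ: "I = J" by (simp add: I_def J_def)
    have dI: "distinct I" using srt strict_sorted_iff by blast
    have "?M = mat_diag k (\<lambda>a. d (I ! a))"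
      using lt dI len by (intro eq_matI) (auto simp: mat_diag_index IJ nth_eq_iff_index_eq)
    moreover have "det (mat_diag k (\<lambda>a. d (I ! a))) = (\<Prod>a=0..<k. d (I ! a))"
      by (subst det_upper_triangular[of _ k])
        (auto simp: mat_diag_def diag_mat_def prod.distinct_set_conv_list[of "[0..<k]", simplified] intro!: arg_cong[of _ _ prod_list])
    moreover have "(\<Prod>a=0..<k. d (I ! a)) = (\<Prod>j\<in>set I. d j)"
      using prod.reindex_bij_betw[OF bij_betw_nth[OF dI refl refl], of d] len
      by (simp add: atLeast0LessThan)
    ultimately show ?thesis using cij ij True by (simp add: mat_diag_index I_def)
  next
    case False
    hence "I \<noteq> J"
      using ij distinct_incr_lists[of n k] by (simp add: I_def J_def nth_eq_iff_index_eq)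
    hence "set I \<noteq> set J" using srt strict_sorted_equal by blast
    moreover have "card (set I) = card (set J)"
      using srt len strict_sorted_iff distinct_card by metis
    ultimately have "\<not> set I \<subseteq> set J" using card_subset_eq[of "set J" "set I"] by auto
    then obtain a where a: "a < k" "I ! a \<notin> set J" using len by (auto simp: in_set_conv_nth subset_iff)
    have "?M $$ (a, b) = 0" if "b < k" for b
      using a that lt len by (auto simp: mat_diag_index)
    hence "det ?M = 0"
      using a(1)
      by (subst laplace_expansion_row[of _ k a]) auto
    thus ?thesis using cij ij False by (simp add: mat_diag_index)
  qed
qed (use carrier_matD[OF compound_carrier[OF mat_diag_dim[of n d], of k]] in auto)

lemma compound_one: "compound k (1\<^sub>m n) = 1\<^sub>m (compound_dim n k)"
  using compound_diag[of k n "\<lambda>_. 1"] by simp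

text \<open>Multiplicativity and compatibility with adjoints carry a diagonalization to a
  diagonalization, so the eigenvalues of the compound are the products over \<open>k\<close>
  different indices.\<close>

lemma unitary_diag_compound:
  assumes "unitary_diag n U d A"
  shows "unitary_diag (compound_dim n k) (compound k U) (\<lambda>i. \<Prod>j\<in>set (incr_lists n k ! i). d j) (compound k A)"
proof -
  note U = unitary_diagD[OF assms]
  have 1: "mat_adjoint (compound k U) * compound k U = 1\<^sub>m (compound_dim n k)"
    using U compound_mult[of "mat_adjoint U" n U k] by (simp add: compound_adjoint[of _ n] compound_one)
  have "compound k A = compound k (U * mat_diag n (\<lambda>i. complex_of_real (d i))) * compound k (mat_adjoint U)"
    unfolding U(5) using U(1) by (intro compound_mult[of _ n]) auto
  also have "compound k (U * mat_diag n (\<lambda>i. complex_of_real (d i))) =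
      compound k U * compound k (mat_diag n (\<lambda>i. complex_of_real (d i)))"
    using U(1) by (intro compound_mult[of _ n]) auto
  also have "compound k (mat_adjoint U) = mat_adjoint (compound k U)"
    using U(1) by (rule compound_adjoint)
  also note compound_diag
  finally show ?thesis using U 1 by (simp add: unitary_diag_def)
qed

lemma compound_psd:
  assumes "A \<in> psd_mats n"
  shows "compound k A \<in> psd_mats (compound_dim n k)"
proof -
  obtain U d where U: "unitary_diag n U d A" and d: "\<And>i. i < n \<Longrightarrow> 0 \<le> d i"
    using psd_unitary_diag[OF assms] by blast
  have "0 \<le> (\<Prod>j\<in>set (incr_lists n k ! i). d j)" if "i < compound_dim n k" for i
    using d nth_mem[OF that] by (intro prod_nonneg) (auto simp: set_incr_lists)
  thus ?thesis using unitary_diag_psd_iff[OF unitary_diag_compound[OF U]] by simp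
qed

lemma compound_pd:
  assumes "A \<in> pd_mats n"
  shows "compound k A \<in> pd_mats (compound_dim n k)"
proof -
  obtain U d where U: "unitary_diag n U d A" and d: "\<And>i. i < n \<Longrightarrow> 0 < d i"
    using pd_unitary_diag[OF assms] by blast
  have "0 < (\<Prod>j\<in>set (incr_lists n k ! i). d j)" if "i < compound_dim n k" for i
    using d nth_mem[OF that] by (intro prod_pos) (auto simp: set_incr_lists)
  thus ?thesis using unitary_diag_pd_iff[OF unitary_diag_compound[OF U]] by simp
qed

text \<open>Both sides are diagonalized by \<open>compound k U\<close>, and a product of powers of
  nonnegative numbers is the power of the product.\<close>

lemma compound_mat_powr:
  assumes "A \<in> psd_mats n"
  shows "compound k (mat_powr A r) = mat_powr (compound k A) r"
proof -
  obtain U d where U: "unitary_diag n U d A" and d: "\<And>i. i < n \<Longrightarrow> 0 \<le> d i"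
    using psd_unitary_diag[OF assms] by blast
  have d': "0 \<le> d j" if "i < compound_dim n k" "j \<in> set (incr_lists n k ! i)" for i j
    using d nth_mem[OF that(1)] that(2) by (auto simp: set_incr_lists)
  have "unitary_diag n U (\<lambda>i. d i powr r) (mat_powr A r)"
    using U d by (rule mat_powr_unitary_diag)
  hence 1: "unitary_diag (compound_dim n k) (compound k U)
      (\<lambda>i. \<Prod>j\<in>set (incr_lists n k ! i). d j powr r) (compound k (mat_powr A r))"
    by (rule unitary_diag_compound)
  have 2: "unitary_diag (compound_dim n k) (compound k U)
      (\<lambda>i. (\<Prod>j\<in>set (incr_lists n k ! i). d j) powr r) (mat_powr (compound k A) r)"
    using unitary_diag_compound[OF U] by (rule mat_powr_unitary_diag) (auto intro!: prod_nonneg d')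
  show ?thesis
    using 1 2 by (rule unitary_diag_unique) (use d' in \<open>auto simp: prod_powr_distrib\<close>)
qed

lemma compound_sandwich:
  assumes "A \<in> carrier_mat n n" "B \<in> carrier_mat n n" "C \<in> carrier_mat n n"
  shows "compound k (A * B * C) = compound k A * compound k B * compound k C"
  using assms compound_mult[of "A * B" n C k] compound_mult[of A n B k]
  by (simp add: square_mult_closed[of _ n])

lemma compound_renyi_mean:
  assumes "A \<in> psd_mats n" "B \<in> psd_mats n"
  shows "compound k (renyi_mean \<alpha> q A B) = renyi_mean \<alpha> q (compound k A) (compound k B)"
  using assms psd_sandwich_powr[of A n "mat_powr B (\<alpha> * q)" "(1 - \<alpha>) / 2 * q"]
  by (simp add: renyi_mean_def compound_mat_powr[of _ n] compound_sandwich[of _ n])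

lemma compound_SG_tilde:
  assumes A: "A \<in> psd_mats n" and B: "B \<in> psd_mats n"
  shows "compound k (SG_tilde \<alpha> p A B) = SG_tilde \<alpha> p (compound k A) (compound k B)"
proof -
  let ?G = "geo_mean \<alpha> (mat_powr A (- p)) (mat_powr B p)"
  have G: "?G \<in> psd_mats n" using A B by (rule geo_mean_powr_psd)
  have "mat_powr (mat_powr A (- p)) (- (1 / 2)) * mat_powr B p * mat_powr (mat_powr A (- p)) (- (1 / 2)) \<in> psd_mats n"
    using A B by (intro psd_sandwich_powr mat_powr_psd)
  hence cG: "compound k ?G = geo_mean \<alpha> (mat_powr (compound k A) (- p)) (mat_powr (compound k B) p)"
    using A B by (simp add: geo_mean_def compound_mat_powr[of _ n] compound_sandwich[of _ n])
  have "mat_powr ?G (1 / 2) * mat_powr A (2 * (1 - \<alpha>) * p) * mat_powr ?G (1 / 2) \<in> psd_mats n"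
    using A G by (intro psd_sandwich_powr mat_powr_psd)
  thus ?thesis
    using A G by (simp add: SG_tilde_def Let_def compound_mat_powr[of _ n] compound_sandwich[of _ n] cG)
qed

subsection \<open>Eigenvalues and log-majorization\<close>

text \<open>Permuting the columns of \<open>U\<close> permutes the eigenvalues; this allows them to
  be sorted decreasingly, as \<open>eigval\<close> lists them.\<close>

lemma unitary_diag_permute:
  assumes U: "unitary_diag n U d A" and \<sigma>: "\<sigma> permutes {..<n}"
  shows "\<exists>V. unitary_diag n V (d \<circ> \<sigma>) A"
proof -
  note U' = unitary_diagD[OF U]
  define V where "V = mat n n (\<lambda>(i, j). U $$ (i, \<sigma> j))"
  have V: "V \<in> carrier_mat n n" by (simp add: V_def)
  have s: "\<sigma> j < n" if "j < n" for j using permutes_in_image[OF \<sigma>, of j] that by simp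
  have "mat_adjoint V * V = 1\<^sub>m n"
  proof (rule eq_matI)
    fix i j assume "i < dim_row (1\<^sub>m n :: complex mat)" "j < dim_col (1\<^sub>m n :: complex mat)"
    hence ij: "i < n" "j < n" by auto
    have "(mat_adjoint V * V) $$ (i, j) = (\<Sum>k<n. cnj (U $$ (k, \<sigma> i)) * U $$ (k, \<sigma> j))"
      using ij V by (simp add: scalar_prod_def atLeast0LessThan V_def)
    also have "\<dots> = (mat_adjoint U * U) $$ (\<sigma> i, \<sigma> j)"
      using s[OF ij(1)] s[OF ij(2)] U'(1) by (simp add: scalar_prod_def atLeast0LessThan)
    also have "\<dots> = (1\<^sub>m n :: complex mat) $$ (i, j)"
      using s[OF ij(1)] s[OF ij(2)] ij permutes_inj[OF \<sigma>] by (simp add: U'(3) inj_eq)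
    finally show "(mat_adjoint V * V) $$ (i, j) = (1\<^sub>m n :: complex mat) $$ (i, j)" .
  qed (use V in auto)
  moreover have "A = V * mat_diag n (\<lambda>i. complex_of_real ((d \<circ> \<sigma>) i)) * mat_adjoint V" (is "_ = ?R")
  proof (rule eq_matI)
    have idx: "(W * mat_diag n (\<lambda>i. complex_of_real (e i)) * mat_adjoint W) $$ (i, j) =
        (\<Sum>k<n. W $$ (i, k) * complex_of_real (e k) * cnj (W $$ (j, k)))"
      if "W \<in> carrier_mat n n" "i < n" "j < n" for W e i j
      using that by (simp add: mat_diag_mult_right[of _ n] scalar_prod_def atLeast0LessThan)
    fix i j assume "i < dim_row ?R" "j < dim_col ?R"
    hence ij: "i < n" "j < n" using V by auto
    have "?R $$ (i, j) = (\<Sum>k<n. U $$ (i, \<sigma> k) * complex_of_real (d (\<sigma> k)) * cnj (U $$ (j, \<sigma> k)))"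
      using ij by (subst idx[OF V ij]) (simp add: V_def)
    also have "\<dots> = (\<Sum>k<n. U $$ (i, k) * complex_of_real (d k) * cnj (U $$ (j, k)))"
      using sum.permute[OF \<sigma>, of "\<lambda>k. U $$ (i, k) * complex_of_real (d k) * cnj (U $$ (j, k))"]
      by (simp add: o_def)
    also have "\<dots> = A $$ (i, j)"
      unfolding U'(5) by (rule idx[OF U'(1) ij, symmetric])
    finally show "A $$ (i, j) = ?R $$ (i, j)" by simp
  qed (use V U'(2) in auto)
  ultimately show ?thesis using V by (auto simp: unitary_diag_def)
qed

lemma hermitian_decreasing_diag:
  assumes "A \<in> hermitian_mats n"
  obtains U d where "unitary_diag n U d A" "\<And>i j. i \<le> j \<Longrightarrow> j < n \<Longrightarrow> d j \<le> d i"
proof -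
  obtain V e where V: "unitary_diag n V e A" using hermitian_unitary_diag[OF assms] by blast
  let ?xs = "map e [0..<n]"
  have "mset (rev (sort ?xs)) = mset ?xs" by simp
  then obtain \<sigma> where \<sigma>: "\<sigma> permutes {..<length ?xs}" "permute_list \<sigma> ?xs = rev (sort ?xs)"
    by (rule mset_eq_permutation)
  have p: "\<sigma> permutes {..<n}" using \<sigma>(1) by simp
  have nth: "(e \<circ> \<sigma>) i = rev (sort ?xs) ! i" if "i < n" for i
  proof -
    have "\<sigma> i < n" using permutes_in_image[OF p, of i] that by simp
    thus ?thesis using that p by (simp add: permute_list_nth flip: \<sigma>(2))
  qed
  obtain U where "unitary_diag n U (e \<circ> \<sigma>) A" using unitary_diag_permute[OF V p] by blast
  moreover have "(e \<circ> \<sigma>) j \<le> (e \<circ> \<sigma>) i" if "i \<le> j" "j < n" for i j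
  proof -
    have "sort ?xs ! (n - Suc j) \<le> sort ?xs ! (n - Suc i)"
      using that by (intro sorted_nth_mono) auto
    thus ?thesis using that by (simp only: nth) (simp add: rev_nth)
  qed
  ultimately show ?thesis using that by blast
qed

lemma proots_char_poly_unitary_diag:
  assumes "unitary_diag n U d A"
  shows "proots (char_poly A) = image_mset (\<lambda>i. complex_of_real (d i)) (mset [0..<n])"
proof -
  note U = unitary_diagD[OF assms]
  let ?D = "mat_diag n (\<lambda>i. complex_of_real (d i))"
  have "similar_mat_wit A ?D U (mat_adjoint U)"
    using U by (intro similar_mat_witI[of _ _ n]) auto
  hence "char_poly A = char_poly ?D"
    by (intro char_poly_similar) (auto simp: similar_mat_def)
  also have "\<dots> = (\<Prod>a\<leftarrow>diag_mat ?D. [:- a, 1:])"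
    by (rule char_poly_upper_triangular[of _ n]) (auto simp: mat_diag_def)
  also have "diag_mat ?D = map (\<lambda>i. complex_of_real (d i)) [0..<n]"
    by (auto simp: diag_mat_def mat_diag_def)
  finally have "char_poly A = prod_list (map (\<lambda>i. [:- complex_of_real (d i), 1:]) [0..<n])"
    by (simp add: o_def)
  moreover have "proots (prod_list (map (\<lambda>i. [:- complex_of_real (d i), 1:]) xs)) =
      image_mset (\<lambda>i. complex_of_real (d i)) (mset xs)" for xs
  proof (induction xs)
    case (Cons x xs)
    have "prod_list (map (\<lambda>i. [:- complex_of_real (d i), 1:]) xs) \<noteq> 0"
      by (auto simp: prod_list_zero_iff)
    hence "proots ([:- complex_of_real (d x), 1:] * prod_list (map (\<lambda>i. [:- complex_of_real (d i), 1:]) xs)) =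
        proots [:- complex_of_real (d x), 1:] + proots (prod_list (map (\<lambda>i. [:- complex_of_real (d i), 1:]) xs))"
      by (intro proots_mult) auto
    thus ?case using Cons by simp
  qed simp
  ultimately show ?thesis by simp
qed

text \<open>The index is shifted because \<open>eigval\<close> counts from 1 and \<open>d\<close>
  from 0.\<close>

lemma eigval_decreasing_diag:
  assumes "unitary_diag n U d A" and dec: "\<And>i j. i \<le> j \<Longrightarrow> j < n \<Longrightarrow> d j \<le> d i"
    and i: "1 \<le> i" "i \<le> n"
  shows "eigval A i = d (i - 1)"
proof -
  let ?xs = "map d [0..<n]"
  have "image_mset Re (proots (char_poly A)) = mset ?xs"
    by (simp add: proots_char_poly_unitary_diag[OF assms(1)] multiset.map_comp o_def del: mset_upt)
  hence "eigval A i = rev (sort ?xs) ! (i - 1)"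
    unfolding eigval_def by (simp only: sorted_list_of_multiset_mset)
  also have "sort ?xs = rev ?xs"
  proof (rule properties_for_sort)
    show "sorted (rev ?xs)"
      unfolding sorted_iff_nth_mono_less using dec by (auto simp: rev_nth)
  qed simp
  finally show ?thesis using i by simp
qed

lemma prod_eigval_decreasing_diag:
  assumes "unitary_diag n U d A" and "\<And>i j. i \<le> j \<Longrightarrow> j < n \<Longrightarrow> d j \<le> d i" and "k \<le> n"
  shows "(\<Prod>i=1..k. eigval A i) = (\<Prod>j<k. d j)"
proof -
  have "(\<Prod>i=1..k. eigval A i) = (\<Prod>i=1..k. d (i - 1))"
    using assms(3) eigval_decreasing_diag[OF assms(1,2)] by (intro prod.cong) auto
  also have "\<dots> = (\<Prod>j<k. d j)"
    by (rule prod.reindex_bij_witness[of _ Suc "\<lambda>i. i - 1"]) auto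
  finally show ?thesis .
qed

lemma eigval_1_le_iff:
  assumes X: "X \<in> hermitian_mats n" and n: "1 \<le> n"
  shows "form_le n X (scalar_mat n c) \<longleftrightarrow> eigval X 1 \<le> c"
proof -
  obtain U d where U: "unitary_diag n U d X" and dec: "\<And>i j. i \<le> j \<Longrightarrow> j < n \<Longrightarrow> d j \<le> d i"
    using hermitian_decreasing_diag[OF X] by blast
  have "eigval X 1 = d 0" using eigval_decreasing_diag[OF U dec, of 1] n by simp
  moreover have "(\<forall>i<n. d i \<le> c) \<longleftrightarrow> d 0 \<le> c" using dec n by (auto intro: order_trans)
  ultimately show ?thesis using form_le_scalar_iff[OF U, of c] by (simp add: scalar_mat_def)
qed

lemma incr_list_nth_ge:
  assumes "sorted_wrt (<) J" "a < length (J :: nat list)"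
  shows "a \<le> J ! a"
  using assms(2)
proof (induction a)
  case (Suc a)
  hence "J ! a < J ! Suc a" using assms(1) by (simp add: sorted_wrt_iff_nth_less)
  thus ?case using Suc by simp
qed simp

text \<open>Among the \<open>k\<close>-subsets \<open>[0..<k]\<close> has the largest product: the
  entry at position a of an increasing list is at least a, and \<open>d\<close> is decreasing and
  nonnegative.\<close>

lemma prod_eigval_le_iff:
  assumes X: "X \<in> psd_mats n" and k: "k \<le> n"
  shows "form_le (compound_dim n k) (compound k X) (scalar_mat (compound_dim n k) c) \<longleftrightarrow>
    (\<Prod>i=1..k. eigval X i) \<le> c"
proof -
  obtain U d where U: "unitary_diag n U d X" and dec: "\<And>i j. i \<le> j \<Longrightarrow> j < n \<Longrightarrow> d j \<le> d i"
    using hermitian_decreasing_diag[of X n] X by auto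
  have d: "0 \<le> d i" if "i < n" for i using unitary_diag_psd_iff[OF U] X that by simp
  let ?L = "incr_lists n k"
  have "(\<forall>i<length ?L. (\<Prod>j\<in>set (?L ! i). d j) \<le> c) \<longleftrightarrow> (\<forall>J\<in>set ?L. (\<Prod>j\<in>set J. d j) \<le> c)"
    by (simp add: all_set_conv_all_nth)
  also have "\<dots> \<longleftrightarrow> (\<Prod>j<k. d j) \<le> c"
  proof
    assume "\<forall>J\<in>set ?L. (\<Prod>j\<in>set J. d j) \<le> c"
    moreover have "[0..<k] \<in> set ?L" using k by (auto simp: set_incr_lists)
    ultimately show "(\<Prod>j<k. d j) \<le> c" by (auto simp: atLeast0LessThan)
  next
    assume c: "(\<Prod>j<k. d j) \<le> c"
    show "\<forall>J\<in>set ?L. (\<Prod>j\<in>set J. d j) \<le> c"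
    proof
      fix J assume J: "J \<in> set ?L"
      hence len: "length J = k" and srt: "sorted_wrt (<) J" by (auto simp: set_incr_lists)
      have "distinct J" using srt strict_sorted_iff by blast
      hence "(\<Prod>j\<in>set J. d j) = (\<Prod>a<k. d (J ! a))"
        using prod.reindex_bij_betw[OF bij_betw_nth[of J, OF _ refl refl], of d] len by simp
      also have "\<dots> \<le> (\<Prod>a<k. d a)"
        using incr_list_nth_ge[OF srt] nth_incr_lists_less[OF J] len
        by (intro prod_mono) (auto intro: d dec)
      finally show "(\<Prod>j\<in>set J. d j) \<le> c" using c by simp
    qed
  qed
  finally show ?thesis
    unfolding scalar_mat_def form_le_scalar_iff[OF unitary_diag_compound[OF U]]
    using prod_eigval_decreasing_diag[OF U dec k] by simp
qed

section \<open>Determinants of the means and the criterion for log-majorization\<close>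

definition real_det :: "complex mat \<Rightarrow> real" where
  "real_det A = Re (det A)"

lemma real_det_unitary_diag:
  assumes "unitary_diag n U d A"
  shows "det A = complex_of_real (\<Prod>i<n. d i)" "real_det A = (\<Prod>i<n. d i)"
proof -
  note U = unitary_diagD[OF assms]
  let ?D = "mat_diag n (\<lambda>i. complex_of_real (d i))"
  have "similar_mat_wit A ?D U (mat_adjoint U)"
    using U by (intro similar_mat_witI[of _ _ n]) auto
  hence "det A = det ?D"
    by (intro det_similar) (auto simp: similar_mat_def)
  also have "\<dots> = prod_list (diag_mat ?D)"
    by (rule det_upper_triangular[of _ n]) (auto simp: mat_diag_def)
  also have "diag_mat ?D = map (\<lambda>i. complex_of_real (d i)) [0..<n]"
    by (auto simp: diag_mat_def mat_diag_def)
  also have "prod_list \<dots> = (\<Prod>i<n. complex_of_real (d i))"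
    using prod.distinct_set_conv_list[of "[0..<n]" "\<lambda>i. complex_of_real (d i)"]
    by (simp add: atLeast0LessThan)
  finally show "det A = complex_of_real (\<Prod>i<n. d i)" by simp
  thus "real_det A = (\<Prod>i<n. d i)" by (simp add: real_det_def del: of_real_prod)
qed

lemma prod_eigval_eq_real_det:
  assumes "X \<in> hermitian_mats n"
  shows "(\<Prod>i=1..n. eigval X i) = real_det X"
proof -
  obtain U d where U: "unitary_diag n U d X" and dec: "\<And>i j. i \<le> j \<Longrightarrow> j < n \<Longrightarrow> d j \<le> d i"
    using hermitian_decreasing_diag[OF assms] by blast
  show ?thesis
    using prod_eigval_decreasing_diag[OF U dec order_refl] real_det_unitary_diag[OF U] by simp
qed

lemma real_det_sandwich:
  assumes "A \<in> hermitian_mats n" "B \<in> hermitian_mats n"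
  shows "real_det (A * B * A) = real_det A * real_det B * real_det A"
proof -
  obtain U d V e where "unitary_diag n U d A" "unitary_diag n V e B"
    using hermitian_unitary_diag assms by blast
  note d = real_det_unitary_diag[OF this(1)] real_det_unitary_diag[OF this(2)]
  have "det (A * B * A) = det A * det B * det A"
    using assms by (simp add: det_mult[of _ n] square_mult_closed[of _ n])
  also have "\<dots> = complex_of_real (real_det A * real_det B * real_det A)"
    by (simp only: d of_real_mult)
  finally show ?thesis by (simp add: real_det_def del: of_real_mult)
qed

lemma real_det_mat_powr:
  assumes "A \<in> psd_mats n"
  shows "real_det (mat_powr A r) = real_det A powr r"
proof -
  obtain U d where U: "unitary_diag n U d A" and d: "\<And>i. i < n \<Longrightarrow> 0 \<le> d i"
    using psd_unitary_diag[OF assms] by blast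
  have "unitary_diag n U (\<lambda>i. d i powr r) (mat_powr A r)"
    using U d by (rule mat_powr_unitary_diag)
  thus ?thesis
    by (simp add: real_det_unitary_diag(2)[OF U] real_det_unitary_diag(2) prod_powr_distrib)
qed

lemma real_det_nonneg: "A \<in> psd_mats n \<Longrightarrow> 0 \<le> real_det A"
  using prod_eigval_eq_real_det[of A n] psd_unitary_diag[of A n] real_det_unitary_diag(2)
  by (metis (no_types, lifting) lessThan_iff prod_nonneg)

lemma sandwich_powr:
  fixes x y :: real
  shows "(x powr s * y * x powr s) powr t = x powr (2 * s * t) * y powr t"
  using powr_add[of x "s * t" "s * t"] by (simp add: powr_mult powr_powr mult.assoc)

text \<open>The value does not depend on \<open>q\<close> and is the same as for
  \<open>SG_tilde\<close>; hence equality at k = n holds for all parameters, in both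
  directions.\<close>

lemma real_det_renyi_mean:
  assumes A: "A \<in> pd_mats n" and B: "B \<in> psd_mats n" and q: "0 < q"
  shows "real_det (renyi_mean \<alpha> q A B) = real_det A powr (1 - \<alpha>) * real_det B powr \<alpha>"
proof -
  have "real_det (renyi_mean \<alpha> q A B) =
      (real_det A powr ((1 - \<alpha>) / 2 * q) * real_det B powr (\<alpha> * q) * real_det A powr ((1 - \<alpha>) / 2 * q)) powr (1 / q)"
    unfolding renyi_mean_def using A B psd_sandwich_powr[of A n "mat_powr B (\<alpha> * q)" "(1 - \<alpha>) / 2 * q"]
    by (simp add: real_det_mat_powr[of _ n] real_det_sandwich[of _ n])
  thus ?thesis using q by (simp add: sandwich_powr powr_powr)
qed

lemma real_det_SG_tilde:
  assumes A: "A \<in> pd_mats n" and B: "B \<in> psd_mats n" and p: "0 < p"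
  shows "real_det (SG_tilde \<alpha> p A B) = real_det A powr (1 - \<alpha>) * real_det B powr \<alpha>"
proof -
  let ?G = "geo_mean \<alpha> (mat_powr A (- p)) (mat_powr B p)" and ?a = "real_det A" and ?b = "real_det B"
  have G: "?G \<in> psd_mats n" using A B by (intro geo_mean_powr_psd) auto
  have Y: "mat_powr A (p / 2) * mat_powr B p * mat_powr A (p / 2) \<in> psd_mats n"
    using A B by (intro psd_sandwich_powr) auto
  have "real_det ?G = ?a powr (- p / 2) * (?a powr (p / 2) * ?b powr p * ?a powr (p / 2)) powr \<alpha> * ?a powr (- p / 2)"
    using A B Y by (simp add: geo_mean_powr_eq[of _ n] real_det_sandwich[of _ n] real_det_mat_powr[of _ n])
  also have "\<dots> = ?a powr (- p / 2) * (?a powr (p * \<alpha>) * ?b powr (p * \<alpha>)) * ?a powr (- p / 2)"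
    by (simp add: sandwich_powr powr_powr)
  also have "\<dots> = ?a powr (- p / 2 + p * \<alpha> + - p / 2) * ?b powr (p * \<alpha>)"
    by (simp only: powr_add mult_ac)
  also have "- p / 2 + p * \<alpha> + - p / 2 = - ((1 - \<alpha>) * p)" by (simp add: algebra_simps)
  finally have g: "real_det ?G = ?a powr (- ((1 - \<alpha>) * p)) * ?b powr (p * \<alpha>)" .
  have g0: "0 \<le> real_det ?G" using G by (rule real_det_nonneg)
  have "real_det (SG_tilde \<alpha> p A B) =
      (real_det ?G powr (1 / 2) * ?a powr (2 * (1 - \<alpha>) * p) * real_det ?G powr (1 / 2)) powr (1 / p)"
    unfolding SG_tilde_def Let_def using A G psd_sandwich_powr[of ?G n "mat_powr A (2 * (1 - \<alpha>) * p)" "1 / 2"]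
    by (simp add: real_det_mat_powr[of _ n] real_det_sandwich[of _ n])
  also have "real_det ?G powr (1 / 2) * ?a powr (2 * (1 - \<alpha>) * p) * real_det ?G powr (1 / 2) =
      real_det ?G * ?a powr (2 * (1 - \<alpha>) * p)"
    using g0 by (simp add: powr_half_sqrt)
  also have "\<dots> = ?a powr (2 * (1 - \<alpha>) * p + - ((1 - \<alpha>) * p)) * ?b powr (p * \<alpha>)"
    unfolding g by (simp only: powr_add) simp
  also have "2 * (1 - \<alpha>) * p + - ((1 - \<alpha>) * p) = (1 - \<alpha>) * p" by (simp add: algebra_simps)
  also have "(?a powr ((1 - \<alpha>) * p) * ?b powr (p * \<alpha>)) powr (1 / p) = ?a powr (1 - \<alpha>) * ?b powr \<alpha>"
    using p by (simp add: powr_mult powr_powr)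
  finally show ?thesis .
qed

text \<open>The implication is available only for \<open>c > 0\<close>, as in \<open>araki\<close>,
  while the eigenvalue product of \<open>Y\<close> can be 0; so it is applied to that product plus
  an arbitrary positive \<open>e\<close>.\<close>

lemma log_majI:
  assumes X: "X \<in> psd_mats n" and Y: "Y \<in> psd_mats n" and det: "real_det X = real_det Y"
    and le: "\<And>k c. 1 \<le> k \<Longrightarrow> k \<le> n \<Longrightarrow> 0 < c \<Longrightarrow>
      form_le (compound_dim n k) (compound k Y) (scalar_mat (compound_dim n k) c) \<Longrightarrow>
      form_le (compound_dim n k) (compound k X) (scalar_mat (compound_dim n k) c)"
  shows "log_maj n X Y"
proof -
  have "(\<Prod>i=1..k. eigval X i) \<le> (\<Prod>i=1..k. eigval Y i)" if k: "1 \<le> k" "k \<le> n" for k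
  proof (rule field_le_epsilon)
    fix e :: real assume e: "0 < e"
    obtain U d where U: "unitary_diag n U d Y" and dec: "\<And>i j. i \<le> j \<Longrightarrow> j < n \<Longrightarrow> d j \<le> d i"
      using hermitian_decreasing_diag[of Y n] Y by auto
    have "0 \<le> (\<Prod>j<k. d j)"
      using unitary_diag_psd_iff[OF U] Y k by (intro prod_nonneg) auto
    moreover have "(\<Prod>i=1..k. eigval Y i) = (\<Prod>j<k. d j)"
      by (rule prod_eigval_decreasing_diag[OF U dec k(2)])
    ultimately have "0 < (\<Prod>i=1..k. eigval Y i) + e" using e by simp
    thus "(\<Prod>i=1..k. eigval X i) \<le> (\<Prod>i=1..k. eigval Y i) + e"
      using le[OF k] e unfolding prod_eigval_le_iff[OF X k(2)] prod_eigval_le_iff[OF Y k(2)] by simp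
  qed
  thus ?thesis
    using X Y det prod_eigval_eq_real_det[of X n] prod_eigval_eq_real_det[of Y n]
    by (auto simp: log_maj_def)
qed

text \<open>The case k = 1 of log-majorization, from which both necessary conditions are
  derived.\<close>

lemma log_maj_form_le:
  assumes "log_maj n X Y" "1 \<le> n" "form_le n Y (scalar_mat n c)"
  shows "form_le n X (scalar_mat n c)"
proof -
  have XY: "X \<in> hermitian_mats n" "Y \<in> hermitian_mats n" using assms(1) by (auto simp: log_maj_def)
  have "(\<Prod>i=1..1. eigval X i) \<le> (\<Prod>i=1..1. eigval Y i)"
    using assms(1,2) unfolding log_maj_def by (meson atLeastAtMost_iff order_refl)
  thus ?thesis
    using assms(3) unfolding eigval_1_le_iff[OF XY(1) assms(2)] eigval_1_le_iff[OF XY(2) assms(2)] by simp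
qed

text \<open>Compounds of \<open>A\<close> and \<open>B\<close> are again positive definite and
  semidefinite, and the scalar implications were proved in every dimension, so they apply to each
  compound.\<close>

lemma SG_tilde_log_maj_renyi_mean_pd:
  assumes A: "A \<in> pd_mats n" and B: "B \<in> psd_mats n" and \<alpha>: "0 < \<alpha>" "\<alpha> < 1"
    and p: "0 < p" and q: "0 < q" and pq: "p / q \<le> \<alpha>"
  shows "log_maj n (SG_tilde \<alpha> p A B) (renyi_mean \<alpha> q A B)"
  using A B
  by (intro log_majI)
    (auto simp: SG_tilde_psd renyi_mean_psd real_det_SG_tilde[OF A B p] real_det_renyi_mean[OF A B q]
      compound_SG_tilde[of _ n] compound_renyi_mean[of _ n] compound_pd compound_psd
      intro: SG_tilde_le_renyi_mean[OF _ _ \<alpha> p q pq])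

lemma renyi_mean_log_maj_SG_tilde_pd:
  assumes A: "A \<in> pd_mats n" and B: "B \<in> psd_mats n" and \<alpha>: "0 < \<alpha>" "\<alpha> \<le> 1 / 2"
    and q: "0 < q" and qp: "q \<le> p"
  shows "log_maj n (renyi_mean \<alpha> q A B) (SG_tilde \<alpha> p A B)"
  using A B q qp
  by (intro log_majI)
    (auto simp: SG_tilde_psd renyi_mean_psd real_det_SG_tilde[OF A B] real_det_renyi_mean[OF A B q]
      compound_SG_tilde[of _ n] compound_renyi_mean[of _ n] compound_pd compound_psd
      intro: renyi_mean_le_SG_tilde[OF _ _ \<alpha> q qp])

subsection \<open>Reduction to positive definite first argument\<close>

lemma square_mat_eqI:
  fixes A B :: "complex mat"
  assumes A: "A \<in> carrier_mat n n" and B: "B \<in> carrier_mat n n"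
    and eq: "\<And>v. v \<in> carrier_vec n \<Longrightarrow> A *\<^sub>v v = B *\<^sub>v v"
  shows "A = B"
proof (rule mat_col_eqI)
  fix i assume "i < dim_col B"
  hence i: "i < n" using B by simp
  have "X *\<^sub>v unit_vec n i = col X i" if "X \<in> carrier_mat n n" for X :: "complex mat"
    using that i by (intro eq_vecI) auto
  thus "col A i = col B i" using eq[of "unit_vec n i"] A B by simp
qed (use A B in auto)

text \<open>The vector u - Qu lies in the kernel of \<open>Q\<close>, hence in that of
  \<open>P\<close>.\<close>

lemma mult_idempotent_absorb:
  fixes P Q :: "complex mat"
  assumes P: "P \<in> carrier_mat n n" and Q: "Q \<in> carrier_mat n n" "Q * Q = Q"
    and ker: "\<And>v. v \<in> carrier_vec n \<Longrightarrow> Q *\<^sub>v v = 0\<^sub>v n \<Longrightarrow> P *\<^sub>v v = 0\<^sub>v n"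
  shows "P * Q = P"
proof (rule square_mat_eqI)
  fix u :: "complex vec" assume u: "u \<in> carrier_vec n"
  have Qu: "Q *\<^sub>v u \<in> carrier_vec n" using Q(1) u by (rule mult_mat_vec_carrier)
  have Pu: "P *\<^sub>v u \<in> carrier_vec n" using P u by (rule mult_mat_vec_carrier)
  have PQu: "P *\<^sub>v (Q *\<^sub>v u) \<in> carrier_vec n" using P Qu by (rule mult_mat_vec_carrier)
  have "Q *\<^sub>v (u - Q *\<^sub>v u) = Q *\<^sub>v u - Q *\<^sub>v (Q *\<^sub>v u)"
    using Q(1) u Qu by (rule mult_minus_distrib_mat_vec)
  also have "Q *\<^sub>v (Q *\<^sub>v u) = Q *\<^sub>v u"
    using Q u by (simp flip: square_mult_vec_assoc[of _ n])
  finally have "Q *\<^sub>v (u - Q *\<^sub>v u) = 0\<^sub>v n" using Qu by simp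
  hence "P *\<^sub>v (u - Q *\<^sub>v u) = 0\<^sub>v n" using u Qu by (intro ker) auto
  moreover have "P *\<^sub>v (u - Q *\<^sub>v u) = P *\<^sub>v u - P *\<^sub>v (Q *\<^sub>v u)"
    using P u Qu by (rule mult_minus_distrib_mat_vec)
  ultimately have z: "P *\<^sub>v u - P *\<^sub>v (Q *\<^sub>v u) = 0\<^sub>v n" by simp
  have "P *\<^sub>v (Q *\<^sub>v u) = P *\<^sub>v u"
  proof (rule eq_vecI)
    fix j assume "j < dim_vec (P *\<^sub>v u)"
    hence "j < n" using carrier_vecD[OF Pu] by simp
    thus "(P *\<^sub>v (Q *\<^sub>v u)) $ j = (P *\<^sub>v u) $ j"
      using arg_cong[OF z, of "\<lambda>v. v $ j"] carrier_vecD[OF Pu] carrier_vecD[OF PQu]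
      by (simp del: index_mult_mat_vec dim_mult_mat_vec)
  qed (use carrier_vecD[OF Pu] carrier_vecD[OF PQu] in simp)
  thus "(P * Q) *\<^sub>v u = P *\<^sub>v u" using P Q u by (simp add: square_mult_vec_assoc[of _ n])
qed (use P Q in auto)

text \<open>Equal kernels give P = PQ and Q = QP; taking the adjoint of the first yields P = QP = Q.
  The description in \<open>support_proj\<close> thereby has a unique solution.\<close>

lemma idempotent_kernel_unique:
  assumes P: "P \<in> carrier_mat n n" "mat_adjoint P = P" "P * P = P"
    and Q: "Q \<in> carrier_mat n n" "mat_adjoint Q = Q" "Q * Q = (Q :: complex mat)"
    and ker: "mat_kernel P = mat_kernel Q"
  shows "P = Q"
proof -
  have ker': "P *\<^sub>v v = 0\<^sub>v n \<longleftrightarrow> Q *\<^sub>v v = 0\<^sub>v n" if "v \<in> carrier_vec n" for v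
    using ker that P(1) Q(1) by (auto simp: mat_kernel_def set_eq_iff)
  have "P = P * Q" using mult_idempotent_absorb[OF P(1) Q(1,3)] ker' by simp
  hence "P = mat_adjoint (P * Q)" using P by simp
  also have "\<dots> = Q * P" using P Q by (simp add: square_adjoint_mult[of _ n])
  also have "\<dots> = Q" using mult_idempotent_absorb[OF Q(1) P(1,3)] ker' by simp
  finally show ?thesis .
qed

text \<open>Since \<open>0 powr 0 = 0\<close>, the power with exponent 0 is the support projection, not the identity.\<close>

lemma mat_powr_zero_kernel:
  assumes A: "A \<in> psd_mats n"
  shows "mat_kernel (mat_powr A 0) = mat_kernel A"
proof -
  have c: "A \<in> carrier_mat n n" "mat_powr A r \<in> carrier_mat n n" for r using A by simp_all
  have k: "mat_kernel X \<subseteq> mat_kernel (Y * X)" if "X \<in> carrier_mat n n" "Y \<in> carrier_mat n n" for X Y :: "complex mat"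
    using that by (auto simp: mat_kernel_def square_mult_vec_assoc[of _ n] square_mult_zero_vec)
  have "mat_powr A 0 = mat_powr A (- 1) * A" "A = A * mat_powr A 0"
    using mat_powr_mult[OF A, of "- 1" 1] mat_powr_mult[OF A, of 1 0] A by simp_all
  thus ?thesis using k[OF c(1) c(2)[of "- 1"]] k[OF c(2)[of 0] c(1)] by auto
qed

lemma support_proj_eq:
  assumes A: "A \<in> psd_mats n"
  shows "support_proj A = mat_powr A 0"
proof -
  have n: "dim_row A = n" using A psd_carrier by blast
  show ?thesis
    unfolding support_proj_def n
  proof (rule the_equality)
    show *: "mat_powr A 0 \<in> carrier_mat n n \<and> mat_adjoint (mat_powr A 0) = mat_powr A 0 \<and>
        mat_powr A 0 * mat_powr A 0 = mat_powr A 0 \<and> mat_kernel (mat_powr A 0) = mat_kernel A"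
      using A by (simp add: mat_powr_adjoint[of _ n] mat_powr_mult[of _ n] mat_powr_zero_kernel[of _ n])
    fix P assume P: "P \<in> carrier_mat n n \<and> mat_adjoint P = P \<and> P * P = P \<and> mat_kernel P = mat_kernel A"
    have "mat_kernel P = mat_kernel (mat_powr A 0)" using P * by simp
    thus "P = mat_powr A 0"
      using P * idempotent_kernel_unique[of P n "mat_powr A 0"] by blast
  qed
qed

text \<open>If the support projection of \<open>A\<close> kills \<open>v\<close>, the smaller
  projection has form 0 at \<open>v\<close>; for a projection the form is the squared norm of the
  image, so \<open>v\<close> is also in the kernel of \<open>B\<close>.\<close>

lemma support_absorb:
  assumes A: "A \<in> psd_mats n" and B: "B \<in> psd_mats n"
    and le: "loewner_le (support_proj B) (support_proj A)"
  shows "B * mat_powr A 0 = B"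
proof (rule mult_idempotent_absorb)
  have c: "mat_powr A 0 \<in> carrier_mat n n" "mat_powr B 0 \<in> carrier_mat n n" using A B by simp_all
  show "B \<in> carrier_mat n n" "mat_powr A 0 \<in> carrier_mat n n" using A B by simp_all
  show "mat_powr A 0 * mat_powr A 0 = mat_powr A 0" using A by (simp add: mat_powr_mult[of _ n])
  fix v :: "complex vec" assume v: "v \<in> carrier_vec n" and z: "mat_powr A 0 *\<^sub>v v = 0\<^sub>v n"
  have "mat_powr A 0 - mat_powr B 0 \<in> psd_mats n"
    using le c A B by (simp add: loewner_le_def support_proj_eq[of _ n])
  hence "qform (mat_powr B 0) v \<le> qform (mat_powr A 0) v"
    using c v by (auto simp: psd_mats_iff qform_minus[of _ n])
  also have "\<dots> = 0" using z v by (simp add: qform_def)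
  also have "qform (mat_powr B 0) v = sqnorm (mat_powr B 0 *\<^sub>v v)"
    using qform_adjoint_mult[OF c(2) v] B by (simp add: mat_powr_adjoint[of _ n] mat_powr_mult[of _ n])
  finally have "mat_powr B 0 *\<^sub>v v = 0\<^sub>v n"
    using sqnorm_eq_0_iff[of "mat_powr B 0 *\<^sub>v v" n] sqnorm_nonneg[of "mat_powr B 0 *\<^sub>v v"] c v
    by (simp add: square_mult_vec_closed)
  moreover have "B *\<^sub>v v = B *\<^sub>v (mat_powr B 0 *\<^sub>v v)"
    using B c v mat_powr_mult[OF B, of 1 0] by (simp add: mat_powr_one[of _ n] flip: square_mult_vec_assoc[of _ n])
  ultimately show "B *\<^sub>v v = 0\<^sub>v n" using B by (simp add: square_mult_zero_vec)
qed

text \<open>Adding the projection onto the kernel of \<open>A\<close> makes \<open>A\<close> positive definite without changing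
  either mean, because all factors involving \<open>B\<close> live on the support of \<open>A\<close>.\<close>

definition fill_kernel :: "complex mat \<Rightarrow> complex mat" where
  "fill_kernel A = fun_calc (\<lambda>x. if x = 0 then 1 else x) A"

lemma fill_kernel_pd:
  assumes "A \<in> psd_mats n"
  shows "fill_kernel A \<in> pd_mats n"
proof -
  obtain U d where U: "unitary_diag n U d A" and d: "\<And>i. i < n \<Longrightarrow> 0 \<le> d i"
    using psd_unitary_diag[OF assms] by blast
  show ?thesis
    unfolding fill_kernel_def
    using unitary_diag_pd_iff[OF fun_calc_unitary_diag[OF U, of "\<lambda>x. if x = 0 then 1 else x"]] d
    by (auto simp: less_le)
qed

text \<open>On eigenvalues: the factor \<open>x powr 0\<close> is 0 at 0, cancelling the filled-in
  1, and 1 elsewhere.\<close>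

lemma mat_powr_fill_kernel:
  assumes A: "A \<in> psd_mats n"
  shows "mat_powr (fill_kernel A) r * mat_powr A 0 = mat_powr A r"
    "mat_powr A 0 * mat_powr (fill_kernel A) r = mat_powr A r"
proof -
  have h: "A \<in> hermitian_mats n" using A by simp
  have F: "mat_powr (fill_kernel A) r = fun_calc (\<lambda>x. (if x = 0 then 1 else x) powr r) A"
    using fill_kernel_pd[OF A] h
    by (simp add: mat_powr_eq_fun_calc[of _ n] fun_calc_compose[of _ n] fill_kernel_def)
  show "mat_powr (fill_kernel A) r * mat_powr A 0 = mat_powr A r"
    "mat_powr A 0 * mat_powr (fill_kernel A) r = mat_powr A r"
    unfolding F mat_powr_eq_fun_calc[OF A] fun_calc_mult[OF h]
    by (rule fun_calc_cong_psd[OF A]; simp)+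
qed

text \<open>Every power, whatever its exponent, can be written with \<open>X\<close> as its last
  factor.\<close>

lemma supported_mat_powr:
  assumes X: "X \<in> psd_mats n" and S: "S \<in> carrier_mat n n" and XS: "X * S = X"
  shows "mat_powr X r * S = mat_powr X r"
proof -
  have X': "mat_powr X r = mat_powr X (r - 1) * X"
    using mat_powr_mult[OF X, of "r - 1" 1] X by (simp add: mat_powr_one[of _ n])
  show ?thesis unfolding X' using X S XS by (simp add: square_mult_assoc[of _ n])
qed

lemma supported_mult_fill_kernel:
  assumes A: "A \<in> psd_mats n" and X: "X \<in> psd_mats n" and XS: "X * mat_powr A 0 = X"
  shows "mat_powr A r * X = mat_powr (fill_kernel A) r * X"
    "X * mat_powr A r = X * mat_powr (fill_kernel A) r"
proof -
  have c: "mat_powr A s \<in> carrier_mat n n" "mat_powr (fill_kernel A) s \<in> carrier_mat n n" "X \<in> carrier_mat n n" for s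
    using A X fill_kernel_pd[OF A] by simp_all
  have SX: "mat_powr A 0 * X = X"
    using arg_cong[OF XS, of mat_adjoint] A X c
    by (simp add: square_adjoint_mult[of _ n] mat_powr_adjoint[of _ n] psd_adjoint[of _ n])
  have "mat_powr A r * X = mat_powr (fill_kernel A) r * mat_powr A 0 * X"
    by (simp only: mat_powr_fill_kernel(1)[OF A])
  thus "mat_powr A r * X = mat_powr (fill_kernel A) r * X"
    using c SX by (simp add: square_mult_assoc[of _ n])
  have "X * mat_powr A r = X * mat_powr A 0 * mat_powr (fill_kernel A) r"
    using c mat_powr_fill_kernel(2)[OF A, of r] by (simp add: square_mult_assoc[of _ n])
  thus "X * mat_powr A r = X * mat_powr (fill_kernel A) r" using XS by simp
qed

text \<open>The second equation says that the sandwich is again supported where \<open>A\<close> is,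
  so the replacement can be repeated for nested sandwiches.\<close>

lemma supported_sandwich:
  assumes A: "A \<in> psd_mats n" and X: "X \<in> psd_mats n" and XS: "X * mat_powr A 0 = X"
  shows "mat_powr A r * X * mat_powr A r = mat_powr (fill_kernel A) r * X * mat_powr (fill_kernel A) r"
    "mat_powr A r * X * mat_powr A r * mat_powr A 0 = mat_powr A r * X * mat_powr A r"
proof -
  have c: "mat_powr A s \<in> carrier_mat n n" "mat_powr (fill_kernel A) s \<in> carrier_mat n n" "X \<in> carrier_mat n n" for s
    using A X fill_kernel_pd[OF A] by simp_all
  show "mat_powr A r * X * mat_powr A r = mat_powr (fill_kernel A) r * X * mat_powr (fill_kernel A) r"
    using c supported_mult_fill_kernel[OF assms] by (simp add: square_mult_assoc[of _ n])
  show "mat_powr A r * X * mat_powr A r * mat_powr A 0 = mat_powr A r * X * mat_powr A r"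
    using A c by (simp add: square_simps[where n=n] mat_powr_mult[of _ n])
qed

text \<open>Each power of \<open>A\<close> stands next to a matrix living on the support of
  \<open>A\<close>: first a power of \<open>B\<close>, then a power of \<open>Y\<close>, and finally
  a power of \<open>G\<close>. The replacement is carried through these stages in turn.\<close>

lemma means_fill_kernel:
  assumes A: "A \<in> psd_mats n" and B: "B \<in> psd_mats n"
    and le: "loewner_le (support_proj B) (support_proj A)"
  shows "renyi_mean \<alpha> q (fill_kernel A) B = renyi_mean \<alpha> q A B"
    "SG_tilde \<alpha> p (fill_kernel A) B = SG_tilde \<alpha> p A B"
proof -
  let ?F = "fill_kernel A" and ?S = "mat_powr A 0"
  have F: "?F \<in> psd_mats n" using fill_kernel_pd[OF A] by simp
  have S: "?S \<in> carrier_mat n n" using A by simp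
  note BS = supported_mat_powr[OF B S support_absorb[OF assms]]
  show "renyi_mean \<alpha> q ?F B = renyi_mean \<alpha> q A B"
    unfolding renyi_mean_def using supported_sandwich(1)[OF A _ BS] B by simp
  define Y where "Y = mat_powr A (p / 2) * mat_powr B p * mat_powr A (p / 2)"
  have Y: "Y \<in> psd_mats n" unfolding Y_def using A B by (intro psd_sandwich_powr) auto
  have YF: "Y = mat_powr ?F (p / 2) * mat_powr B p * mat_powr ?F (p / 2)"
    unfolding Y_def using B by (intro supported_sandwich(1)[OF A _ BS]) auto
  have "Y * ?S = Y" unfolding Y_def using B by (intro supported_sandwich(2)[OF A _ BS]) auto
  note YS = supported_mat_powr[OF Y S this]
  define G where "G = mat_powr A (- p / 2) * mat_powr Y \<alpha> * mat_powr A (- p / 2)"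
  have G: "G \<in> psd_mats n" unfolding G_def using A Y by (intro psd_sandwich_powr) auto
  have GF: "G = mat_powr ?F (- p / 2) * mat_powr Y \<alpha> * mat_powr ?F (- p / 2)"
    unfolding G_def using Y by (intro supported_sandwich(1)[OF A _ YS]) auto
  have "G * ?S = G" unfolding G_def using Y by (intro supported_sandwich(2)[OF A _ YS]) auto
  note GS = supported_mat_powr[OF G S this]
  have 1: "geo_mean \<alpha> (mat_powr A (- p)) (mat_powr B p) = G"
    unfolding G_def Y_def using A B by (rule geo_mean_powr_eq)
  have 2: "geo_mean \<alpha> (mat_powr ?F (- p)) (mat_powr B p) = G"
    unfolding GF YF using F B by (rule geo_mean_powr_eq)
  have "mat_powr G (1 / 2) * mat_powr A (2 * (1 - \<alpha>) * p) = mat_powr G (1 / 2) * mat_powr ?F (2 * (1 - \<alpha>) * p)"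
    using G by (intro supported_mult_fill_kernel(2)[OF A _ GS]) auto
  thus "SG_tilde \<alpha> p ?F B = SG_tilde \<alpha> p A B"
    unfolding SG_tilde_def Let_def 1 2 by simp
qed

subsection \<open>Necessity: nearly rank-one pairs of size two\<close>

text \<open>\<open>B\<close> has eigenvalue 1 on the range of \<open>P\<close> and \<open>e\<close>
  on its kernel, so one matrix serves all exponents: B^s differs from \<open>P\<close> only by e^s
  on the kernel.\<close>

lemma idempotent_perturbation:
  assumes P: "P \<in> hermitian_mats n" "P * P = P" and e: "0 < e"
  defines "B \<equiv> fun_calc (\<lambda>t. if t = 0 then e else t) P"
  shows "B \<in> pd_mats n" "form_le n P (mat_powr B s)"
    "form_le n (mat_powr B s) (P + scalar_mat n (e powr s))"
proof -
  obtain U d where U: "unitary_diag n U d P" using hermitian_unitary_diag[OF P(1)] by blast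
  have d: "d i = 0 \<or> d i = 1" if i: "i < n" for i
  proof -
    have "qform (P * P) (col U i) = d i * d i"
      by (rule unitary_diag_col(2)[OF unitary_diag_mult[OF U U] i])
    hence "d i = d i * d i" using unitary_diag_col(2)[OF U i] by (simp add: P(2))
    thus ?thesis by simp
  qed
  have UB: "unitary_diag n U (\<lambda>i. if d i = 0 then e else d i) B"
    unfolding B_def by (rule fun_calc_unitary_diag[OF U])
  have pos: "0 < (if d i = 0 then e else d i)" if "i < n" for i using d[OF that] e by auto
  show "B \<in> pd_mats n" using unitary_diag_pd_iff[OF UB] pos by blast
  have UBs: "unitary_diag n U (\<lambda>i. (if d i = 0 then e else d i) powr s) (mat_powr B s)"
    using UB by (rule mat_powr_unitary_diag) (use pos in \<open>simp add: less_imp_le\<close>)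
  show "form_le n P (mat_powr B s)"
    unfolding form_le_def
  proof
    fix v :: "complex vec" assume v: "v \<in> carrier_vec n"
    show "qform P v \<le> qform (mat_powr B s) v"
      unfolding qform_unitary_diag[OF U v] qform_unitary_diag[OF UBs v]
      using d by (intro sum_mono mult_right_mono) fastforce+
  qed
  have UP: "unitary_diag n U (\<lambda>i. d i + e powr s * 1) (P + scalar_mat n (e powr s))"
    unfolding scalar_mat_def
    by (intro unitary_diag_add U unitary_diag_smult unitary_diag_one[OF U])
  show "form_le n (mat_powr B s) (P + scalar_mat n (e powr s))"
    unfolding form_le_def
  proof
    fix v :: "complex vec" assume v: "v \<in> carrier_vec n"
    show "qform (mat_powr B s) v \<le> qform (P + scalar_mat n (e powr s)) v"
      unfolding qform_unitary_diag[OF UP v] qform_unitary_diag[OF UBs v]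
      using d by (intro sum_mono mult_right_mono) fastforce+
  qed
qed

section \<open>Rank-one matrices of size two\<close>

text \<open>The equation forces every eigenvalue to be 0 or \<open>t\<close>. In the last claim the
  nonzero entry excludes the zero matrix, so that \<open>t\<close> does occur.\<close>

lemma scaled_idempotent:
  assumes X: "X \<in> psd_mats n" and XX: "X * X = complex_of_real t \<cdot>\<^sub>m X" and t: "0 < t"
  shows "mat_powr X s = complex_of_real (t powr (s - 1)) \<cdot>\<^sub>m X" (is ?powr)
    and "form_le n X (scalar_mat n t)" (is ?le)
    and "form_le n X (scalar_mat n c) \<Longrightarrow> X $$ (i, j) \<noteq> 0 \<Longrightarrow> i < n \<Longrightarrow> j < n \<Longrightarrow> t \<le> c"
proof -
  obtain U d where U: "unitary_diag n U d X" and d0: "\<And>i. i < n \<Longrightarrow> 0 \<le> d i"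
    using psd_unitary_diag[OF X] by blast
  have d: "d i = 0 \<or> d i = t" if i: "i < n" for i
  proof -
    have "qform (X * X) (col U i) = d i * d i"
      by (rule unitary_diag_col(2)[OF unitary_diag_mult[OF U U] i])
    moreover have "qform (X * X) (col U i) = t * d i"
      unfolding XX by (rule unitary_diag_col(2)[OF unitary_diag_smult[OF U] i])
    ultimately show ?thesis by auto
  qed
  have "unitary_diag n U (\<lambda>i. d i powr s) (mat_powr X s)"
    using U d0 by (rule mat_powr_unitary_diag)
  moreover have "unitary_diag n U (\<lambda>i. t powr (s - 1) * d i) (complex_of_real (t powr (s - 1)) \<cdot>\<^sub>m X)"
    by (rule unitary_diag_smult[OF U])
  ultimately show ?powr
    by (rule unitary_diag_unique) (use d t in \<open>fastforce simp: powr_diff\<close>)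
  show ?le unfolding scalar_mat_def form_le_scalar_iff[OF U] using d t by fastforce
  assume le: "form_le n X (scalar_mat n c)" and nz: "X $$ (i, j) \<noteq> 0" "i < n" "j < n"
  have "\<exists>i<n. d i \<noteq> 0"
  proof (rule ccontr)
    assume "\<not> (\<exists>i<n. d i \<noteq> 0)"
    hence "X = complex_of_real 0 \<cdot>\<^sub>m X"
      by (intro unitary_diag_unique[OF U unitary_diag_smult[OF U]]) auto
    moreover have "(complex_of_real 0 \<cdot>\<^sub>m X) $$ (i, j) = 0" using nz psd_carrier[OF X] by simp
    ultimately show False using nz by metis
  qed
  then obtain i where "i < n" "d i = t" using d by blast
  thus "t \<le> c" using le unfolding scalar_mat_def form_le_scalar_iff[OF U] by auto
qed

definition diag2 :: "real \<Rightarrow> complex mat" where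
  "diag2 a = mat_diag 2 (\<lambda>i. complex_of_real (if i = 0 then a else 1))"

text \<open>The projection onto the unit vector v = (sqrt w, sqrt (1 - w)); \<open>w\<close> is the
  weight of \<open>v\<close> on the eigenvalue \<open>a\<close> of \<open>diag2 a\<close>.\<close>

definition proj2 :: "real \<Rightarrow> complex mat" where
  "proj2 w = mat 2 2 (\<lambda>(i, j). complex_of_real
     (if i = 0 \<and> j = 0 then w else if i = 1 \<and> j = 1 then 1 - w else sqrt (w * (1 - w))))"

lemma diag2_carrier [simp]: "diag2 a \<in> carrier_mat 2 2"
  by (simp add: diag2_def)

lemma proj2_carrier [simp]: "proj2 w \<in> carrier_mat 2 2"
  by (simp add: proj2_def)

lemma diag2_unitary_diag: "unitary_diag 2 (1\<^sub>m 2) (\<lambda>i. if i = 0 then a else 1) (diag2 a)"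
  by (simp add: unitary_diag_def diag2_def)

lemma diag2_adjoint: "mat_adjoint (diag2 a) = diag2 a"
  using hermitian_adjoint[OF unitary_diag_hermitian[OF diag2_unitary_diag]] .

lemma diag2_pd: "0 < a \<Longrightarrow> diag2 a \<in> pd_mats 2"
  using unitary_diag_pd_iff[OF diag2_unitary_diag[of a]] by simp

lemma diag2_powr:
  assumes "0 < a"
  shows "mat_powr (diag2 a) s = diag2 (a powr s)"
proof -
  have "unitary_diag 2 (1\<^sub>m 2) (\<lambda>i. (if i = 0 then a else 1) powr s) (mat_powr (diag2 a) s)"
    using diag2_unitary_diag by (rule mat_powr_unitary_diag) (use assms in auto)
  thus ?thesis
    using diag2_unitary_diag by (rule unitary_diag_unique) auto
qed

lemma diag2_mult: "diag2 a * diag2 b = diag2 (a * b)"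
  unfolding diag2_def mat_diag_diag by (intro arg_cong[of _ _ "mat_diag 2"] ext) simp

lemma diag2_le: "form_le 2 (diag2 a) (scalar_mat 2 (max a 1))"
  unfolding scalar_mat_def form_le_scalar_iff[OF diag2_unitary_diag] by auto

text \<open>For a projection onto a unit vector v, compression of D gives <v, D v> times the
  projection.\<close>

lemma proj2_diag2_proj2:
  assumes w: "0 < w" "w < 1"
  shows "proj2 w * diag2 a * proj2 w = complex_of_real (w * a + (1 - w)) \<cdot>\<^sub>m proj2 w"
proof (rule eq_matI)
  have s: "complex_of_real (sqrt (w * (1 - w))) * complex_of_real (sqrt (w * (1 - w))) =
      complex_of_real w * (1 - complex_of_real w)"
  proof -
    have "sqrt (w * (1 - w)) * sqrt (w * (1 - w)) = w * (1 - w)" using w by simp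
    from arg_cong[OF this, of complex_of_real] show ?thesis
      by (simp only: of_real_mult of_real_diff of_real_1)
  qed
  fix i j assume "i < dim_row (complex_of_real (w * a + (1 - w)) \<cdot>\<^sub>m proj2 w)"
    "j < dim_col (complex_of_real (w * a + (1 - w)) \<cdot>\<^sub>m proj2 w)"
  hence ij: "i < 2" "j < 2" by (auto simp: proj2_def)
  hence c: "i = 0 \<or> i = 1" "j = 0 \<or> j = 1" by auto
  define r where "r = complex_of_real (sqrt (w * (1 - w)))"
  have rr: "r * r = complex_of_real w * (1 - complex_of_real w)" unfolding r_def by (rule s)
  have e: "proj2 w $$ (0, 0) = complex_of_real w" "proj2 w $$ (0, Suc 0) = r"
    "proj2 w $$ (Suc 0, 0) = r" "proj2 w $$ (Suc 0, Suc 0) = 1 - complex_of_real w"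
    by (simp_all add: proj2_def r_def)
  have dims: "dim_row (proj2 w) = 2" "dim_col (proj2 w) = 2" by (simp_all add: proj2_def)
  have "(proj2 w * diag2 a * proj2 w) $$ (i, j) =
      proj2 w $$ (i, 0) * complex_of_real a * proj2 w $$ (0, j) + proj2 w $$ (i, Suc 0) * proj2 w $$ (Suc 0, j)"
    using ij dims unfolding diag2_def
    by (simp add: mat_diag_index scalar_prod_def numeral_2_eq_2)
  also have "\<dots> = complex_of_real (w * a + (1 - w)) * proj2 w $$ (i, j)"
  proof -
    have "W * b * W + r * r = (W * b + (1 - W)) * W" "r * b * r + (1 - W) * (1 - W) = (W * b + (1 - W)) * (1 - W)"
      "W * b * r + r * (1 - W) = (W * b + (1 - W)) * r" "r * b * W + (1 - W) * r = (W * b + (1 - W)) * r"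
      if "r * r = W * (1 - W)" for W b :: complex
    proof -
      show "W * b * W + r * r = (W * b + (1 - W)) * W" unfolding that by (simp add: algebra_simps)
      have "r * b * r = b * (r * r)" by (simp add: mult_ac)
      thus "r * b * r + (1 - W) * (1 - W) = (W * b + (1 - W)) * (1 - W)"
        unfolding that by (simp add: algebra_simps)
    qed (simp_all add: algebra_simps)
    note f = this[OF rr]
    have "complex_of_real (w * a + (1 - w)) =
        complex_of_real w * complex_of_real a + (1 - complex_of_real w)" by simp
    thus ?thesis using c by (elim disjE) (simp_all only: e f One_nat_def)
  qed
  finally show "(proj2 w * diag2 a * proj2 w) $$ (i, j) =
      (complex_of_real (w * a + (1 - w)) \<cdot>\<^sub>m proj2 w) $$ (i, j)"
    using ij dims by simp
qed (auto simp: proj2_def diag2_def)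

lemma proj2_hermitian: "proj2 w \<in> hermitian_mats 2"
  by (intro hermitian_matsI eq_matI) (auto simp: proj2_def)

lemma proj2_idempotent:
  assumes w: "0 < w" "w < 1"
  shows "proj2 w * proj2 w = proj2 w"
proof -
  have "diag2 1 = 1\<^sub>m 2" by (simp add: diag2_def)
  thus ?thesis
    using proj2_diag2_proj2[OF w, of 1] by (simp add: one_smult_mat right_mult_one_mat[of _ 2 2])
qed

lemma proj2_psd:
  assumes w: "0 < w" "w < 1"
  shows "proj2 w \<in> psd_mats 2"
  using adjoint_mult_psd(1)[OF proj2_carrier, of w] hermitian_adjoint[OF proj2_hermitian, of w]
    proj2_idempotent[OF w] by simp

text \<open>The product of u = (b sqrt w, sqrt (1 - w)) with its adjoint; the only possibly nonzero
  eigenvalue is the squared length of u.\<close>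

definition rank1 :: "real \<Rightarrow> real \<Rightarrow> complex mat" where
  "rank1 w b = diag2 b * proj2 w * diag2 b"

lemma rank1_psd:
  assumes w: "0 < w" "w < 1"
  shows "rank1 w b \<in> psd_mats 2"
  using psd_sandwich[OF proj2_psd[OF w] diag2_carrier, of b] by (simp add: rank1_def diag2_adjoint)

lemma rank1_sandwich: "diag2 a * rank1 w b * diag2 a = rank1 w (a * b)"
proof -
  have "diag2 a * rank1 w b * diag2 a = (diag2 a * diag2 b) * proj2 w * (diag2 b * diag2 a)"
    by (simp add: rank1_def square_simps[where n=2])
  thus ?thesis by (simp add: diag2_mult rank1_def mult.commute)
qed

lemma rank1_square:
  assumes w: "0 < w" "w < 1"
  shows "rank1 w b * rank1 w b = complex_of_real (w * b\<^sup>2 + (1 - w)) \<cdot>\<^sub>m rank1 w b"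
proof -
  have "rank1 w b * rank1 w b = diag2 b * (proj2 w * (diag2 b * diag2 b) * proj2 w) * diag2 b"
    by (simp add: rank1_def square_simps[where n=2])
  also have "\<dots> = diag2 b * (complex_of_real (w * b\<^sup>2 + (1 - w)) \<cdot>\<^sub>m proj2 w) * diag2 b"
    by (simp only: diag2_mult proj2_diag2_proj2[OF w] power2_eq_square)
  also have "\<dots> = complex_of_real (w * b\<^sup>2 + (1 - w)) \<cdot>\<^sub>m rank1 w b"
    unfolding rank1_def by (rule sandwich_smult[of _ 2]) simp_all
  finally show ?thesis .
qed

lemma rank1_index:
  assumes w: "w < 1"
  shows "rank1 w b $$ (1, 1) \<noteq> 0"
proof -
  have "rank1 w b $$ (1, 1) = 1 - complex_of_real w"
    unfolding rank1_def diag2_def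
    by (simp add: mat_diag_mult_right[of _ 2] mat_diag_mult_left[of _ 2 2] proj2_def)
  thus ?thesis using w by simp
qed

lemma rank1_le:
  assumes w: "0 < w" "w < 1"
  shows "form_le 2 (rank1 w b) (scalar_mat 2 (w * b\<^sup>2 + (1 - w)))"
    and "form_le 2 (rank1 w b) (scalar_mat 2 c) \<Longrightarrow> w * b\<^sup>2 + (1 - w) \<le> c"
proof -
  have t: "0 < w * b\<^sup>2 + (1 - w)" using w by (intro add_nonneg_pos) auto
  note s = scaled_idempotent(2,3)[OF rank1_psd[OF w] rank1_square[OF w] t]
  show "form_le 2 (rank1 w b) (scalar_mat 2 (w * b\<^sup>2 + (1 - w)))" by (rule s(1))
  show "w * b\<^sup>2 + (1 - w) \<le> c" if "form_le 2 (rank1 w b) (scalar_mat 2 c)"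
    using s(2)[OF that rank1_index[OF w(2)]] by simp
qed

text \<open>Since u <= u^r on [0, 1], the fractions a/(a+b) and b/(a+b), which sum to 1, have powers
  summing to at least 1.\<close>

lemma powr_subadditive:
  fixes a b r :: real
  assumes "0 \<le> a" "0 \<le> b" "0 \<le> r" "r \<le> 1"
  shows "(a + b) powr r \<le> a powr r + b powr r"
proof (cases "a + b = 0")
  case True
  hence "a = 0" "b = 0" using assms by auto
  thus ?thesis by simp
next
  case False
  hence s: "a + b > 0" using assms by simp
  have u: "u \<le> u powr r" if "0 \<le> u" "u \<le> 1" for u :: real
  proof (cases "u = 0")
    case False
    thus ?thesis using powr_mono'[of r 1 u] that assms by simp
  qed simp
  have "(a + b) powr r * (a / (a + b)) \<le> (a + b) powr r * (a / (a + b)) powr r"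
    using s assms by (intro mult_left_mono u) (auto simp: field_simps)
  moreover have "(a + b) powr r * (b / (a + b)) \<le> (a + b) powr r * (b / (a + b)) powr r"
    using s assms by (intro mult_left_mono u) (auto simp: field_simps)
  moreover have "(a + b) powr r * (a / (a + b)) powr r = a powr r"
    "(a + b) powr r * (b / (a + b)) powr r = b powr r"
    using s by (simp_all flip: powr_mult)
  moreover have "(a + b) powr r * (a / (a + b)) + (a + b) powr r * (b / (a + b)) = (a + b) powr r"
    using s by (simp flip: distrib_left add_divide_distrib)
  ultimately show ?thesis by linarith
qed

lemma form_le_add_scalar:
  assumes X: "X \<in> carrier_mat n n" and D: "D \<in> carrier_mat n n" and c: "0 \<le> c"
    and le: "form_le n X (scalar_mat n a)" "form_le n D (scalar_mat n b)"
  shows "form_le n (X + complex_of_real c \<cdot>\<^sub>m D) (scalar_mat n (a + c * b))"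
  unfolding form_le_def
proof
  fix v :: "complex vec" assume v: "v \<in> carrier_vec n"
  have "qform (X + complex_of_real c \<cdot>\<^sub>m D) v = qform X v + c * qform D v"
    using X D v by (simp add: qform_add[of _ n] qform_smult[of _ n])
  also have "\<dots> \<le> a * sqnorm v + c * (b * sqnorm v)"
    using le c v by (intro add_mono mult_left_mono) (auto simp: form_le_def qform_scalar_mat)
  finally show "qform (X + complex_of_real c \<cdot>\<^sub>m D) v \<le> qform (scalar_mat n (a + c * b)) v"
    using v by (simp add: qform_scalar_mat algebra_simps)
qed

lemma sandwich_add_scalar:
  assumes "D \<in> carrier_mat n n" "X \<in> carrier_mat n n"
  shows "D * (X + scalar_mat n c) * D = D * X * D + complex_of_real c \<cdot>\<^sub>m (D * D)"
proof -
  have "D * (X + scalar_mat n c) = D * X + complex_of_real c \<cdot>\<^sub>m D"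
    using assms by (simp add: mult_add_distrib_mat[of _ n n _ n] scalar_mat_mult)
  thus ?thesis
    using assms add_mult_distrib_mat[of "D * X" n n "complex_of_real c \<cdot>\<^sub>m D" D n]
      mult_smult_assoc_mat[of D n n D n "complex_of_real c"]
    by simp
qed

section \<open>Bounds for the means by moments\<close>

text \<open>The number <v, A^s v> for \<open>A = diag2 x\<close> and the unit vector v of
  \<open>proj2 w\<close>.\<close>

definition moment :: "real \<Rightarrow> real \<Rightarrow> real \<Rightarrow> real" where
  "moment x w s = w * x powr s + (1 - w)"

lemma moment_pos:
  assumes w: "0 < w" "w < 1"
  shows "0 < moment x w s"
  using w by (auto simp: moment_def intro!: add_nonneg_pos)

lemma moment_half:
  assumes x: "0 < x"
  shows "w * (x powr s)\<^sup>2 + (1 - w) = moment x w (2 * s)"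
  using x by (simp add: moment_def power2_eq_square flip: powr_add)

lemma sandwich_proj2:
  assumes x: "0 < x"
  shows "mat_powr (diag2 x) s * proj2 w * mat_powr (diag2 x) s = rank1 w (x powr s)"
  using x by (simp add: diag2_powr rank1_def)

text \<open>A power of a rank-one matrix is a multiple of it; the factor is a power of its
  eigenvalue \<open>moment x w p\<close>. The remaining powers of \<open>A\<close> only rescale the
  spanning vector.\<close>

lemma SG_tilde_rank1:
  assumes x: "0 < x" and w: "0 < w" "w < 1"
  shows "mat_powr (diag2 x) ((1 / 2 - \<alpha>) * p) * mat_powr (rank1 w (x powr (p / 2))) \<alpha> * mat_powr (diag2 x) ((1 / 2 - \<alpha>) * p) =
    complex_of_real (moment x w p powr (\<alpha> - 1)) \<cdot>\<^sub>m rank1 w (x powr ((1 - \<alpha>) * p))"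
proof -
  have "mat_powr (rank1 w (x powr (p / 2))) \<alpha> =
      complex_of_real (moment x w p powr (\<alpha> - 1)) \<cdot>\<^sub>m rank1 w (x powr (p / 2))"
    using scaled_idempotent(1)[OF rank1_psd[OF w] rank1_square[OF w], of "x powr (p / 2)" \<alpha>]
      moment_pos[OF w, of x p] by (simp add: moment_half[OF x])
  hence "mat_powr (diag2 x) ((1 / 2 - \<alpha>) * p) * mat_powr (rank1 w (x powr (p / 2))) \<alpha> * mat_powr (diag2 x) ((1 / 2 - \<alpha>) * p)
     = complex_of_real (moment x w p powr (\<alpha> - 1)) \<cdot>\<^sub>m
       (diag2 (x powr ((1 / 2 - \<alpha>) * p)) * rank1 w (x powr (p / 2)) * diag2 (x powr ((1 / 2 - \<alpha>) * p)))"
    using x rank1_psd[OF w] by (simp add: diag2_powr sandwich_smult[of _ 2])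
  also have "(1 / 2 - \<alpha>) * p + p / 2 = (1 - \<alpha>) * p" by (simp add: algebra_simps)
  hence "x powr ((1 / 2 - \<alpha>) * p) * x powr (p / 2) = x powr ((1 - \<alpha>) * p)"
    by (simp only: powr_add[symmetric])
  hence "diag2 (x powr ((1 / 2 - \<alpha>) * p)) * rank1 w (x powr (p / 2)) * diag2 (x powr ((1 / 2 - \<alpha>) * p)) =
      rank1 w (x powr ((1 - \<alpha>) * p))"
    by (simp only: rank1_sandwich)
  finally show ?thesis .
qed

text \<open>The left side is the p-th power of the largest eigenvalue for the projection itself. As
  B^p lies above the projection, monotonicity carries this value over without an error term.\<close>

lemma SG_tilde_lower:
  assumes \<alpha>: "0 < \<alpha>" "\<alpha> < 1" and p: "0 < p" and x: "0 < x" and w: "0 < w" "w < 1"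
    and B: "B \<in> pd_mats 2" and PB: "form_le 2 (proj2 w) (mat_powr B p)" and c: "0 \<le> c"
    and le: "form_le 2 (SG_tilde \<alpha> p (diag2 x) B) (scalar_mat 2 c)"
  shows "moment x w p powr (\<alpha> - 1) * moment x w (2 * (1 - \<alpha>) * p) \<le> c powr p"
proof -
  let ?A = "diag2 x" and ?m = "moment x w p powr (\<alpha> - 1)"
  have A: "?A \<in> pd_mats 2" using diag2_pd[OF x] .
  define Y where "Y = mat_powr ?A (p / 2) * mat_powr B p * mat_powr ?A (p / 2)"
  have Y: "Y \<in> pd_mats 2" unfolding Y_def using A B by (intro pd_sandwich_powr) auto
  have "form_le 2 (rank1 w (x powr (p / 2))) Y"
    unfolding sandwich_proj2[OF x, symmetric] Y_def using A B PB by (intro form_le_sandwich_powr) auto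
  hence "form_le 2 (mat_powr (rank1 w (x powr (p / 2))) \<alpha>) (mat_powr Y \<alpha>)"
    using Y rank1_psd[OF w] \<alpha> by (intro loewner_heinz) auto
  hence "form_le 2 (complex_of_real ?m \<cdot>\<^sub>m rank1 w (x powr ((1 - \<alpha>) * p)))
      (mat_powr ?A ((1 / 2 - \<alpha>) * p) * mat_powr Y \<alpha> * mat_powr ?A ((1 / 2 - \<alpha>) * p))"
    unfolding SG_tilde_rank1[OF x w, symmetric] using A Y rank1_psd[OF w] by (intro form_le_sandwich_powr) auto
  also have "form_le 2 \<dots> (scalar_mat 2 (c powr p))"
    using le SG_tilde_le_iff[OF A pd_psd[OF B] p c, of \<alpha>] by (simp add: Y_def)
  finally have le': "form_le 2 (complex_of_real ?m \<cdot>\<^sub>m rank1 w (x powr ((1 - \<alpha>) * p))) (scalar_mat 2 (c powr p))" .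
  have m: "0 < ?m" using moment_pos[OF w, of x p] by simp
  have "form_le 2 (rank1 w (x powr ((1 - \<alpha>) * p))) (scalar_mat 2 (c powr p / ?m))"
    unfolding form_le_def
  proof
    fix v :: "complex vec" assume v: "v \<in> carrier_vec 2"
    have "?m * qform (rank1 w (x powr ((1 - \<alpha>) * p))) v \<le> c powr p * sqnorm v"
      using le' v rank1_psd[OF w] by (auto simp: form_le_def qform_smult[of _ 2] qform_scalar_mat)
    thus "qform (rank1 w (x powr ((1 - \<alpha>) * p))) v \<le> qform (scalar_mat 2 (c powr p / ?m)) v"
      using v m by (simp add: qform_scalar_mat field_simps)
  qed
  hence "moment x w (2 * ((1 - \<alpha>) * p)) \<le> c powr p / ?m"
    using rank1_le(2)[OF w] by (simp only: flip: moment_half[OF x])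
  thus ?thesis using m by (simp add: field_simps)
qed

lemma renyi_mean_lower:
  assumes q: "0 < q" and x: "0 < x" and w: "0 < w" "w < 1"
    and B: "B \<in> pd_mats 2" and PB: "form_le 2 (proj2 w) (mat_powr B (\<alpha> * q))" and c: "0 \<le> c"
    and le: "form_le 2 (renyi_mean \<alpha> q (diag2 x) B) (scalar_mat 2 c)"
  shows "moment x w ((1 - \<alpha>) * q) \<le> c powr q"
proof -
  let ?A = "diag2 x" and ?s = "(1 - \<alpha>) / 2 * q"
  have A: "?A \<in> pd_mats 2" using diag2_pd[OF x] .
  have "form_le 2 (rank1 w (x powr ?s)) (mat_powr ?A ?s * mat_powr B (\<alpha> * q) * mat_powr ?A ?s)"
    unfolding sandwich_proj2[OF x, symmetric] using A B PB by (intro form_le_sandwich_powr) auto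
  also have "form_le 2 \<dots> (scalar_mat 2 (c powr q))"
    using le renyi_mean_le_iff[of ?A 2 B q c \<alpha>] A B q c by simp
  finally have "moment x w (2 * ?s) \<le> c powr q"
    using rank1_le(2)[OF w] by (simp only: flip: moment_half[OF x])
  thus ?thesis by simp
qed

lemma renyi_mean_upper:
  assumes q: "0 < q" and x: "0 < x" and w: "0 < w" "w < 1"
    and B: "B \<in> pd_mats 2" and PB: "form_le 2 (mat_powr B (\<alpha> * q)) (proj2 w + scalar_mat 2 e)"
    and e: "0 \<le> e" and c: "0 \<le> c" "moment x w ((1 - \<alpha>) * q) + e * max (x powr ((1 - \<alpha>) * q)) 1 \<le> c powr q"
  shows "form_le 2 (renyi_mean \<alpha> q (diag2 x) B) (scalar_mat 2 c)"
proof -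
  let ?A = "diag2 x" and ?s = "(1 - \<alpha>) / 2 * q"
  have A: "?A \<in> pd_mats 2" using diag2_pd[OF x] .
  have s: "?s + ?s = (1 - \<alpha>) * q" "2 * ?s = (1 - \<alpha>) * q" by simp_all
  have "form_le 2 (mat_powr ?A ?s * mat_powr B (\<alpha> * q) * mat_powr ?A ?s)
      (mat_powr ?A ?s * (proj2 w + scalar_mat 2 e) * mat_powr ?A ?s)"
    using A B PB by (intro form_le_sandwich_powr) auto
  also have "mat_powr ?A ?s * (proj2 w + scalar_mat 2 e) * mat_powr ?A ?s =
      rank1 w (x powr ?s) + complex_of_real e \<cdot>\<^sub>m diag2 (x powr ((1 - \<alpha>) * q))"
    using A by (subst sandwich_add_scalar) (simp_all add: rank1_def diag2_powr x diag2_mult s mult.commute flip: powr_add)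
  also have "form_le 2 \<dots> (scalar_mat 2 (moment x w (2 * ?s) + e * max (x powr ((1 - \<alpha>) * q)) 1))"
    using e rank1_psd[OF w] rank1_le(1)[OF w, of "x powr ?s"]
    by (intro form_le_add_scalar diag2_le) (simp_all only: moment_half[OF x] psd_carrier diag2_carrier)
  also have "form_le 2 \<dots> (scalar_mat 2 (c powr q))"
    unfolding s using c(2) by (auto simp: form_le_def qform_scalar_mat intro!: mult_right_mono)
  finally show ?thesis
    using renyi_mean_le_iff[of ?A 2 B q c \<alpha>] A B q c by simp
qed

text \<open>The error grows to \<delta> on passing to \<open>Y\<close>. It is a scalar and commutes
  with \<open>X\<close>, so subadditivity of the power \<alpha> on eigenvalues turns it into
  \<delta>^\<alpha>, which the outer powers of \<open>A\<close> enlarge by at most the last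
  maximum.\<close>

lemma SG_tilde_upper:
  assumes \<alpha>: "0 < \<alpha>" "\<alpha> < 1" and p: "0 < p" and x: "0 < x" and w: "0 < w" "w < 1"
    and B: "B \<in> pd_mats 2" and PB: "form_le 2 (mat_powr B p) (proj2 w + scalar_mat 2 e)"
    and e: "0 < e"
    and c: "0 \<le> c" "moment x w p powr (\<alpha> - 1) * moment x w (2 * (1 - \<alpha>) * p) +
      (e * max (x powr p) 1) powr \<alpha> * max (x powr ((1 - 2 * \<alpha>) * p)) 1 \<le> c powr p"
  shows "form_le 2 (SG_tilde \<alpha> p (diag2 x) B) (scalar_mat 2 c)"
proof -
  let ?A = "diag2 x" and ?m = "moment x w p powr (\<alpha> - 1)" and ?s = "(1 / 2 - \<alpha>) * p"
  define \<delta> where "\<delta> = e * max (x powr p) 1"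
  have \<delta>: "0 < \<delta>" using e by (simp add: \<delta>_def)
  have A: "?A \<in> pd_mats 2" using diag2_pd[OF x] .
  define X where "X = rank1 w (x powr (p / 2))"
  have X: "X \<in> psd_mats 2" unfolding X_def by (rule rank1_psd[OF w])
  define Y where "Y = mat_powr ?A (p / 2) * mat_powr B p * mat_powr ?A (p / 2)"
  have Y: "Y \<in> pd_mats 2" unfolding Y_def using A B by (intro pd_sandwich_powr) auto
  obtain U d where U: "unitary_diag 2 U d X" and d: "\<And>i. i < 2 \<Longrightarrow> 0 \<le> d i"
    using psd_unitary_diag[OF X] by blast
  have U\<delta>: "unitary_diag 2 U (\<lambda>i. d i + \<delta> * 1) (X + scalar_mat 2 \<delta>)"
    unfolding scalar_mat_def by (intro unitary_diag_add U unitary_diag_smult unitary_diag_one[OF U])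
  have d\<delta>: "0 < d i + \<delta> * 1" if "i < 2" for i using d[OF that] \<delta> by simp
  have X\<delta>: "X + scalar_mat 2 \<delta> \<in> pd_mats 2"
    using unitary_diag_pd_iff[OF U\<delta>] d\<delta> by blast
  have "form_le 2 Y (mat_powr ?A (p / 2) * (proj2 w + scalar_mat 2 e) * mat_powr ?A (p / 2))"
    unfolding Y_def using A B PB by (intro form_le_sandwich_powr) auto
  also have "mat_powr ?A (p / 2) * (proj2 w + scalar_mat 2 e) * mat_powr ?A (p / 2) =
      X + complex_of_real e \<cdot>\<^sub>m diag2 (x powr p)"
    using A by (subst sandwich_add_scalar) (simp_all add: X_def rank1_def diag2_powr x diag2_mult flip: powr_add)
  also have "form_le 2 \<dots> (X + scalar_mat 2 \<delta>)"
    unfolding form_le_def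
  proof
    fix v :: "complex vec" assume v: "v \<in> carrier_vec 2"
    have "qform (diag2 (x powr p)) v \<le> max (x powr p) 1 * sqnorm v"
      using diag2_le[of "x powr p"] v by (simp add: form_le_def qform_scalar_mat)
    hence "e * qform (diag2 (x powr p)) v \<le> \<delta> * sqnorm v"
      unfolding \<delta>_def mult.assoc using e by (intro mult_left_mono) auto
    thus "qform (X + complex_of_real e \<cdot>\<^sub>m diag2 (x powr p)) v \<le> qform (X + scalar_mat 2 \<delta>) v"
      using X v by (simp add: qform_add[of _ 2] qform_smult[of _ 2] qform_scalar_mat)
  qed
  finally have "form_le 2 (mat_powr Y \<alpha>) (mat_powr (X + scalar_mat 2 \<delta>) \<alpha>)"
    using Y X\<delta> \<alpha> by (intro loewner_heinz) auto
  also have "form_le 2 \<dots> (mat_powr X \<alpha> + scalar_mat 2 (\<delta> powr \<alpha>))"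
    unfolding form_le_def
  proof
    fix v :: "complex vec" assume v: "v \<in> carrier_vec 2"
    have 1: "unitary_diag 2 U (\<lambda>i. (d i + \<delta> * 1) powr \<alpha>) (mat_powr (X + scalar_mat 2 \<delta>) \<alpha>)"
      using U\<delta> by (rule mat_powr_unitary_diag) (use d\<delta> in \<open>simp add: less_imp_le\<close>)
    have 2: "unitary_diag 2 U (\<lambda>i. d i powr \<alpha> + \<delta> powr \<alpha> * 1) (mat_powr X \<alpha> + scalar_mat 2 (\<delta> powr \<alpha>))"
      unfolding scalar_mat_def
      by (intro unitary_diag_add unitary_diag_smult unitary_diag_one[OF U] mat_powr_unitary_diag[OF U d])
    show "qform (mat_powr (X + scalar_mat 2 \<delta>) \<alpha>) v \<le> qform (mat_powr X \<alpha> + scalar_mat 2 (\<delta> powr \<alpha>)) v"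
      unfolding qform_unitary_diag[OF 1 v] qform_unitary_diag[OF 2 v]
      using d \<delta> \<alpha> by (intro sum_mono mult_right_mono) (auto intro!: powr_subadditive)
  qed
  finally have "form_le 2 (mat_powr ?A ?s * mat_powr Y \<alpha> * mat_powr ?A ?s)
      (mat_powr ?A ?s * (mat_powr X \<alpha> + scalar_mat 2 (\<delta> powr \<alpha>)) * mat_powr ?A ?s)"
    using A X Y by (intro form_le_sandwich_powr) auto
  also have "mat_powr ?A ?s * (mat_powr X \<alpha> + scalar_mat 2 (\<delta> powr \<alpha>)) * mat_powr ?A ?s =
      complex_of_real ?m \<cdot>\<^sub>m rank1 w (x powr ((1 - \<alpha>) * p)) + complex_of_real (\<delta> powr \<alpha>) \<cdot>\<^sub>m diag2 (x powr ((1 - 2 * \<alpha>) * p))"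
  proof -
    have "?s + ?s = (1 - 2 * \<alpha>) * p" by (simp add: algebra_simps)
    hence "mat_powr ?A ?s * mat_powr ?A ?s = diag2 (x powr ((1 - 2 * \<alpha>) * p))"
      by (simp only: diag2_powr[OF x] diag2_mult powr_add[symmetric])
    thus ?thesis
      using A X sandwich_add_scalar[of "mat_powr ?A ?s" 2 "mat_powr X \<alpha>" "\<delta> powr \<alpha>"] SG_tilde_rank1[OF x w]
      by (simp add: X_def)
  qed
  also have "form_le 2 \<dots> (scalar_mat 2 (?m * moment x w (2 * ((1 - \<alpha>) * p)) + \<delta> powr \<alpha> * max (x powr ((1 - 2 * \<alpha>) * p)) 1))"
  proof (intro form_le_add_scalar diag2_le)
    show "form_le 2 (complex_of_real ?m \<cdot>\<^sub>m rank1 w (x powr ((1 - \<alpha>) * p))) (scalar_mat 2 (?m * moment x w (2 * ((1 - \<alpha>) * p))))"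
      unfolding form_le_def
    proof
      fix v :: "complex vec" assume v: "v \<in> carrier_vec 2"
      have "qform (rank1 w (x powr ((1 - \<alpha>) * p))) v \<le> moment x w (2 * ((1 - \<alpha>) * p)) * sqnorm v"
        using rank1_le(1)[OF w, of "x powr ((1 - \<alpha>) * p)"] v
        unfolding moment_half[OF x] by (simp add: form_le_def qform_scalar_mat)
      hence "?m * qform (rank1 w (x powr ((1 - \<alpha>) * p))) v \<le> ?m * (moment x w (2 * ((1 - \<alpha>) * p)) * sqnorm v)"
        by (intro mult_left_mono) auto
      thus "qform (complex_of_real ?m \<cdot>\<^sub>m rank1 w (x powr ((1 - \<alpha>) * p))) v
          \<le> qform (scalar_mat 2 (?m * moment x w (2 * ((1 - \<alpha>) * p)))) v"
        using v rank1_psd[OF w] by (simp only: qform_smult[of _ 2] qform_scalar_mat psd_carrier mult.assoc)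
    qed
  qed (use rank1_psd[OF w] in simp_all)
  also have "form_le 2 \<dots> (scalar_mat 2 (c powr p))"
    using c(2)[unfolded mult.assoc[of 2]]
    by (auto simp: form_le_def qform_scalar_mat \<delta>_def intro!: mult_right_mono)
  finally show ?thesis
    using SG_tilde_le_iff[OF A pd_psd[OF B] p c(1), of \<alpha>] by (simp add: Y_def)
qed

section \<open>Moment inequalities and their limits\<close>

lemma le_powr_limit:
  fixes a b s :: real
  assumes "0 < b" and le: "\<And>\<delta>. 0 < \<delta> \<Longrightarrow> a \<le> (b + \<delta>) powr s"
  shows "a \<le> b powr s"
proof (rule tendsto_lowerbound)
  have "((\<lambda>\<delta>. (b + \<delta>) powr s) \<longlongrightarrow> (b + 0) powr s) (at_right 0)"
    using assms(1) by (intro tendsto_intros) auto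
  thus "((\<lambda>\<delta>. (b + \<delta>) powr s) \<longlongrightarrow> b powr s) (at_right 0)" by simp
  show "\<forall>\<^sub>F \<delta> in at_right 0. a \<le> (b + \<delta>) powr s"
    using le by (auto simp: eventually_at_filter)
qed simp

text \<open>Take \<open>A = diag2 x\<close> and \<open>B\<close> a perturbed \<open>proj2 w\<close>:
  an upper bound on the Renyi mean transfers to the other mean, for which the lower bound is known.
  Then the perturbation tends to 0.\<close>

lemma moment_inequality_upper:
  assumes \<alpha>: "0 < \<alpha>" "\<alpha> < 1" and pq: "0 < p" "0 < q" and x: "0 < x" and w: "0 < w" "w < 1"
    and maj: "\<And>A B. A \<in> pd_mats 2 \<Longrightarrow> B \<in> pd_mats 2 \<Longrightarrow> log_maj 2 (SG_tilde \<alpha> p A B) (renyi_mean \<alpha> q A B)"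
  shows "moment x w p powr (\<alpha> - 1) * moment x w (2 * (1 - \<alpha>) * p) \<le> moment x w ((1 - \<alpha>) * q) powr (p / q)"
proof (rule le_powr_limit)
  let ?T = "moment x w ((1 - \<alpha>) * q)"
  show T: "0 < ?T" by (rule moment_pos[OF w])
  fix \<delta> :: real assume \<delta>: "0 < \<delta>"
  define M where "M = max (x powr ((1 - \<alpha>) * q)) 1"
  have M: "0 < M" by (simp add: M_def)
  \<comment> \<open>B^(\<alpha>q) exceeds the projection by at most e^(\<alpha>q), and the powers of
    \<open>A\<close> enlarge this by at most \<open>M\<close>; the total error is then exactly
    \<delta>.\<close>
  define e where "e = (\<delta> / M) powr (1 / (\<alpha> * q))"
  have e: "0 < e" "e powr (\<alpha> * q) = \<delta> / M" using \<delta> M \<alpha> pq by (simp_all add: e_def powr_powr)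
  define B where "B = fun_calc (\<lambda>t. if t = 0 then e else t) (proj2 w)"
  note B = idempotent_perturbation[OF proj2_hermitian proj2_idempotent[OF w] e(1), folded B_def]
  define c where "c = (?T + \<delta>) powr (1 / q)"
  have "c powr q = ?T + \<delta>" using T \<delta> pq by (simp add: c_def powr_powr)
  moreover have "\<delta> / M * M = \<delta>" using M by simp
  ultimately have "form_le 2 (renyi_mean \<alpha> q (diag2 x) B) (scalar_mat 2 c)"
    using B(3)[of "\<alpha> * q"] \<delta> M unfolding e(2)
    by (intro renyi_mean_upper[OF pq(2) x w B(1)]) (auto simp: M_def[symmetric] c_def)
  hence "form_le 2 (SG_tilde \<alpha> p (diag2 x) B) (scalar_mat 2 c)"
    using log_maj_form_le[OF maj[OF diag2_pd[OF x] B(1)]] by simp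
  hence "moment x w p powr (\<alpha> - 1) * moment x w (2 * (1 - \<alpha>) * p) \<le> c powr p"
    using B(2) by (intro SG_tilde_lower[OF \<alpha> pq(1) x w B(1)]) (auto simp: c_def)
  thus "moment x w p powr (\<alpha> - 1) * moment x w (2 * (1 - \<alpha>) * p) \<le> (?T + \<delta>) powr (p / q)"
    using T \<delta> by (simp add: c_def powr_powr)
qed

lemma moment_inequality_lower:
  assumes \<alpha>: "0 < \<alpha>" "\<alpha> < 1" and pq: "0 < p" "0 < q" and x: "0 < x" and w: "0 < w" "w < 1"
    and maj: "\<And>A B. A \<in> pd_mats 2 \<Longrightarrow> B \<in> pd_mats 2 \<Longrightarrow> log_maj 2 (renyi_mean \<alpha> q A B) (SG_tilde \<alpha> p A B)"
  shows "moment x w ((1 - \<alpha>) * q) \<le> (moment x w p powr (\<alpha> - 1) * moment x w (2 * (1 - \<alpha>) * p)) powr (q / p)"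
proof (rule le_powr_limit)
  let ?L = "moment x w p powr (\<alpha> - 1) * moment x w (2 * (1 - \<alpha>) * p)"
  show L: "0 < ?L" using moment_pos[OF w, of x] by (auto simp: less_imp_neq[symmetric])
  fix \<delta> :: real assume \<delta>: "0 < \<delta>"
  define M where "M = max (x powr p) 1"
  define N where "N = max (x powr ((1 - 2 * \<alpha>) * p)) 1"
  have M: "0 < M" and N: "0 < N" by (simp_all add: M_def N_def)
  \<comment> \<open>The error in B^p is k/M, becomes k in \<open>Y\<close>, k^\<alpha> after the
    power, and k^\<alpha> N = \<delta> after the outer factors.\<close>
  define k where "k = (\<delta> / N) powr (1 / \<alpha>)"
  have k: "0 < k" "k powr \<alpha> = \<delta> / N" using \<delta> N \<alpha> by (simp_all add: k_def powr_powr)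
  define e where "e = (k / M) powr (1 / p)"
  have e: "0 < e" "e powr p = k / M" using k M pq by (simp_all add: e_def powr_powr)
  define B where "B = fun_calc (\<lambda>t. if t = 0 then e else t) (proj2 w)"
  note B = idempotent_perturbation[OF proj2_hermitian proj2_idempotent[OF w] e(1), folded B_def]
  define c where "c = (?L + \<delta>) powr (1 / p)"
  have cp: "c powr p = ?L + \<delta>" using L \<delta> pq by (simp add: c_def powr_powr)
  have "(k / M * M) powr \<alpha> * N = \<delta>" using M N k by simp
  have "form_le 2 (SG_tilde \<alpha> p (diag2 x) B) (scalar_mat 2 c)"
  proof (rule SG_tilde_upper[OF \<alpha> pq(1) x w B(1)])
    show "form_le 2 (mat_powr B p) (proj2 w + scalar_mat 2 (k / M))" using B(3)[of p] unfolding e(2) .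
    show "0 < k / M" "0 \<le> c" using k M by (simp_all add: c_def)
    show "?L + (k / M * max (x powr p) 1) powr \<alpha> * max (x powr ((1 - 2 * \<alpha>) * p)) 1 \<le> c powr p"
      unfolding M_def[symmetric] N_def[symmetric] cp \<open>(k / M * M) powr \<alpha> * N = \<delta>\<close> by simp
  qed
  hence "form_le 2 (renyi_mean \<alpha> q (diag2 x) B) (scalar_mat 2 c)"
    using log_maj_form_le[OF maj[OF diag2_pd[OF x] B(1)]] by simp
  hence "moment x w ((1 - \<alpha>) * q) \<le> c powr q"
    using B(2) by (intro renyi_mean_lower[OF pq(2) x w B(1)]) (auto simp: c_def)
  thus "moment x w ((1 - \<alpha>) * q) \<le> (?L + \<delta>) powr (q / p)"
    using L \<delta> by (simp add: c_def powr_powr)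
qed

lemma powr_tendsto_0_at_top:
  "(c :: real) < 0 \<Longrightarrow> ((\<lambda>x. x powr c) \<longlongrightarrow> 0) at_top"
  by (rule tendsto_neg_powr[OF _ filterlim_ident])

text \<open>With equal weights every moment of positive order tends to 1/2 as x tends to 0, so the
  moment inequality becomes (1/2)^\<alpha> <= (1/2)^(p/q).\<close>

lemma necessary_upper:
  assumes \<alpha>: "0 < \<alpha>" "\<alpha> < 1" and pq: "0 < p" "0 < q"
    and maj: "\<And>A B. A \<in> pd_mats 2 \<Longrightarrow> B \<in> pd_mats 2 \<Longrightarrow> log_maj 2 (SG_tilde \<alpha> p A B) (renyi_mean \<alpha> q A B)"
  shows "p / q \<le> \<alpha>"
proof -
  have lim: "((\<lambda>x. moment x (1 / 2) s) \<longlongrightarrow> 1 / 2) (at_right 0)" if "0 < s" for s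
  proof -
    have "((\<lambda>x::real. x powr s) \<longlongrightarrow> 0 powr s) (at_right 0)"
      using that by (intro tendsto_powr') (auto simp: eventually_at_filter)
    hence "((\<lambda>x. 1 / 2 * x powr s + (1 - 1 / 2)) \<longlongrightarrow> 1 / 2 * 0 powr s + (1 - 1 / 2)) (at_right 0)"
      by (intro tendsto_add tendsto_mult tendsto_const)
    thus ?thesis using that by (simp add: moment_def)
  qed
  have "(1 / 2) powr (\<alpha> - 1) * (1 / 2) \<le> (1 / 2 :: real) powr (p / q)"
  proof (rule tendsto_le)
    show "((\<lambda>x. moment x (1 / 2) ((1 - \<alpha>) * q) powr (p / q)) \<longlongrightarrow> (1 / 2) powr (p / q)) (at_right 0)"
      using \<alpha> pq by (intro tendsto_powr lim tendsto_const) auto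
    show "((\<lambda>x. moment x (1 / 2) p powr (\<alpha> - 1) * moment x (1 / 2) (2 * (1 - \<alpha>) * p)) \<longlongrightarrow>
        (1 / 2) powr (\<alpha> - 1) * (1 / 2)) (at_right 0)"
      using \<alpha> pq by (intro tendsto_mult tendsto_powr lim tendsto_const) auto
    show "\<forall>\<^sub>F x in at_right 0. moment x (1 / 2) p powr (\<alpha> - 1) * moment x (1 / 2) (2 * (1 - \<alpha>) * p)
        \<le> moment x (1 / 2) ((1 - \<alpha>) * q) powr (p / q)"
      using moment_inequality_upper[OF \<alpha> pq _ _ _ maj] by (auto simp: eventually_at_filter)
  qed simp
  hence "(1 / 2) powr \<alpha> \<le> (1 / 2 :: real) powr (p / q)"
    using powr_add[of "1 / 2 :: real" "\<alpha> - 1" 1] by simp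
  hence "2 powr (p / q) \<le> (2 :: real) powr \<alpha>" by (simp add: powr_divide field_simps)
  thus ?thesis by simp
qed

text \<open>The weight \<open>x powr - m\<close> on the large eigenvalue \<open>x\<close> makes the moments of order below \<open>m\<close>
  tend to 1 and those of order above \<open>m\<close> tend to infinity; \<open>m\<close> is chosen to separate the two
  sides of the inequality.\<close>

lemma necessary_lower:
  assumes \<alpha>: "0 < \<alpha>" "\<alpha> < 1" and pq: "0 < p" "0 < q"
    and maj: "\<And>A B. A \<in> pd_mats 2 \<Longrightarrow> B \<in> pd_mats 2 \<Longrightarrow> log_maj 2 (renyi_mean \<alpha> q A B) (SG_tilde \<alpha> p A B)"
  shows "\<alpha> \<le> 1 / 2" "q \<le> 2 * p"
proof -
  have mom: "moment x (x powr - m) s = x powr (s - m) + (1 - x powr - m)" if "0 < x" for x m s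
    using that by (simp add: moment_def add.commute flip: powr_add)
  have w: "0 < x powr - m" "x powr - m < 1" if "1 < x" "0 < m" for x m :: real
    using that powr_less_mono[of "- m" 0 x] by auto
  have ineq: "x powr ((1 - \<alpha>) * q - m) + (1 - x powr - m) \<le>
      ((x powr (p - m) + (1 - x powr - m)) powr (\<alpha> - 1) *
        (x powr (2 * (1 - \<alpha>) * p - m) + (1 - x powr - m))) powr (q / p)"
    if "1 < x" "0 < m" for x m
  proof -
    have x: "0 < x" using that by simp
    show ?thesis using moment_inequality_lower[OF \<alpha> pq x w[OF that] maj] unfolding mom[OF x] .
  qed
  have gt1: "\<forall>\<^sub>F x in at_top. (1::real) < x" by (rule eventually_gt_at_top)
  show half: "\<alpha> \<le> 1 / 2"
  proof (rule ccontr)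
    assume "\<not> \<alpha> \<le> 1 / 2"
    hence \<alpha>2: "2 * (1 - \<alpha>) < 1" by simp
    have "2 * (1 - \<alpha>) * p < p" using \<alpha>2 pq mult_strict_right_mono[of "2 * (1 - \<alpha>)" 1 p] by simp
    \<comment> \<open>The moment of order p now tends to infinity and its power \<alpha> - 1 to 0,
      while the moment of order 2(1-\<alpha>)p stays at most 2: the right side tends to 0, the left
      is at least 1 - x^(-m).\<close>
    then obtain m where m: "2 * (1 - \<alpha>) * p < m" "m < p" using dense by blast
    have m0: "0 < m" using m(1) \<alpha> pq by (smt (verit) mult_pos_pos)
    define k where "k = (p - m) * (\<alpha> - 1)"
    have k: "k < 0" using m \<alpha> by (simp add: k_def mult_pos_neg)
    have "(1::real) - 0 \<le> (2 * 0) powr (q / p)"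
    proof (rule tendsto_le)
      show "((\<lambda>x. (2 * x powr k) powr (q / p)) \<longlongrightarrow> (2 * 0) powr (q / p)) at_top"
        using pq by (intro tendsto_powr' tendsto_intros powr_tendsto_0_at_top k) auto
      show "((\<lambda>x. 1 - x powr - m) \<longlongrightarrow> 1 - 0) at_top"
        using m0 by (intro tendsto_intros powr_tendsto_0_at_top) auto
      show "\<forall>\<^sub>F x in at_top. 1 - x powr - m \<le> (2 * x powr k) powr (q / p)"
        using gt1
      proof eventually_elim
        fix x :: real assume x: "1 < x"
        note wx = w[OF x m0]
        have "(x powr (p - m) + (1 - x powr - m)) powr (\<alpha> - 1) \<le> (x powr (p - m)) powr (\<alpha> - 1)"
          using wx x \<alpha> by (intro powr_mono2') auto
        also have "\<dots> = x powr k" by (simp add: powr_powr k_def)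
        finally have 1: "(x powr (p - m) + (1 - x powr - m)) powr (\<alpha> - 1) \<le> x powr k" .
        have "x powr (2 * (1 - \<alpha>) * p - m) \<le> x powr 0" using x m by (intro powr_mono) auto
        moreover have "x powr 0 = 1" using x by simp
        ultimately have 2: "x powr (2 * (1 - \<alpha>) * p - m) + (1 - x powr - m) \<le> 2" using wx by linarith
        have "1 - x powr - m \<le> x powr ((1 - \<alpha>) * q - m) + (1 - x powr - m)" by simp
        also note ineq[OF x m0]
        also have "((x powr (p - m) + (1 - x powr - m)) powr (\<alpha> - 1) *
            (x powr (2 * (1 - \<alpha>) * p - m) + (1 - x powr - m))) powr (q / p) \<le> (x powr k * 2) powr (q / p)"
          using 1 2 wx pq by (intro powr_mono2 mult_mono mult_nonneg_nonneg) auto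
        finally show "1 - x powr - m \<le> (2 * x powr k) powr (q / p)" by (simp add: mult.commute)
      qed
    qed simp
    thus False using pq by simp
  qed
  show "q \<le> 2 * p"
  proof (rule ccontr)
    assume "\<not> q \<le> 2 * p"
    have "(1 - \<alpha>) * (2 * p) < (1 - \<alpha>) * q" using \<open>\<not> q \<le> 2 * p\<close> \<alpha> by (intro mult_strict_left_mono) auto
    hence "2 * (1 - \<alpha>) * p < (1 - \<alpha>) * q" by (simp only: mult_ac)
    \<comment> \<open>Now the left side grows at least like x^k, whereas \<open>?R\<close>, which
      bounds the right side, tends to 1; dividing by x^k gives the contradiction 1 <= 0.\<close>
    then obtain m where m: "2 * (1 - \<alpha>) * p < m" "m < (1 - \<alpha>) * q" using dense by blast
    have m0: "0 < m" using m(1) \<alpha> pq by (smt (verit) mult_pos_pos)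
    define k where "k = (1 - \<alpha>) * q - m"
    have k: "0 < k" using m by (simp add: k_def)
    let ?R = "\<lambda>x. ((1 - x powr - m) powr (\<alpha> - 1) * (x powr (2 * (1 - \<alpha>) * p - m) + 1)) powr (q / p)"
    have "(1::real) \<le> ((1 - 0) powr (\<alpha> - 1) * (0 + 1)) powr (q / p) * 0"
    proof (rule tendsto_le)
      show "((\<lambda>x. ?R x * x powr - k) \<longlongrightarrow> ((1 - 0) powr (\<alpha> - 1) * (0 + 1)) powr (q / p) * 0) at_top"
        using m m0 k by (intro tendsto_mult tendsto_powr tendsto_add tendsto_diff tendsto_const powr_tendsto_0_at_top) auto
      show "((\<lambda>x. 1 :: real) \<longlongrightarrow> 1) (at_top :: real filter)" by (rule tendsto_const)
      show "\<forall>\<^sub>F x in at_top. 1 \<le> ?R x * x powr - k"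
        using gt1
      proof eventually_elim
        fix x :: real assume x: "1 < x"
        note wx = w[OF x m0]
        have 1: "(x powr (p - m) + (1 - x powr - m)) powr (\<alpha> - 1) \<le> (1 - x powr - m) powr (\<alpha> - 1)"
          using wx x \<alpha> by (intro powr_mono2') auto
        have 2: "(x powr (p - m) + (1 - x powr - m)) powr (\<alpha> - 1) * (x powr (2 * (1 - \<alpha>) * p - m) + (1 - x powr - m))
            \<le> (1 - x powr - m) powr (\<alpha> - 1) * (x powr (2 * (1 - \<alpha>) * p - m) + 1)"
          using wx by (intro mult_mono 1) auto
        have "x powr k \<le> x powr ((1 - \<alpha>) * q - m) + (1 - x powr - m)" using wx by (simp add: k_def)
        also note ineq[OF x m0]
        also have "((x powr (p - m) + (1 - x powr - m)) powr (\<alpha> - 1) *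
            (x powr (2 * (1 - \<alpha>) * p - m) + (1 - x powr - m))) powr (q / p) \<le> ?R x"
          using wx pq by (intro powr_mono2 2 mult_nonneg_nonneg) auto
        finally have "x powr k * x powr - k \<le> ?R x * x powr - k" by (intro mult_right_mono) auto
        thus "1 \<le> ?R x * x powr - k" using x by (simp flip: powr_add)
      qed
    qed simp
    thus False by simp
  qed
qed

text \<open>Positive definite matrices have full support, which makes condition (ii) an instance of
  condition (i).\<close>

lemma loewner_le_support_proj_pd:
  assumes A: "A \<in> pd_mats n" and B: "B \<in> pd_mats n"
  shows "loewner_le (support_proj B) (support_proj A)"
proof -
  have "support_proj A = 1\<^sub>m n" "support_proj B = 1\<^sub>m n"
    using A B by (simp_all add: support_proj_eq[of _ n] mat_powr_zero)
  moreover have "1\<^sub>m n - 1\<^sub>m n \<in> psd_mats n"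
    unfolding psd_mats_iff
    by (auto simp: qform_minus[of _ n] mat_adjoint_minus[of _ n n] intro!: hermitian_matsI)
  ultimately show ?thesis by (simp add: loewner_le_def)
qed

theorem theorem3p6:
  fixes \<alpha> p q :: real
  assumes "0 < \<alpha>" and "\<alpha> < 1" and "p > 0" and "q > 0"
  shows
    "(((\<forall>n\<ge>1. \<forall>A\<in>psd_mats n. \<forall>B\<in>psd_mats n. loewner_le (support_proj B) (support_proj A) \<longrightarrow>
          log_maj n (SG_tilde \<alpha> p A B) (renyi_mean \<alpha> q A B))
       \<longleftrightarrow> (\<forall>A\<in>pd_mats 2. \<forall>B\<in>pd_mats 2. log_maj 2 (SG_tilde \<alpha> p A B) (renyi_mean \<alpha> q A B)))
      \<and> ((\<forall>A\<in>pd_mats 2. \<forall>B\<in>pd_mats 2. log_maj 2 (SG_tilde \<alpha> p A B) (renyi_mean \<alpha> q A B))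
       \<longleftrightarrow> p / q \<le> \<alpha>))
     \<and> (\<alpha> \<le> 1/2 \<and> q \<le> p \<longrightarrow>
        (\<forall>n\<ge>1. \<forall>A\<in>psd_mats n. \<forall>B\<in>psd_mats n. loewner_le (support_proj B) (support_proj A) \<longrightarrow>
          log_maj n (renyi_mean \<alpha> q A B) (SG_tilde \<alpha> p A B)))
     \<and> ((\<forall>A\<in>pd_mats 2. \<forall>B\<in>pd_mats 2. log_maj 2 (renyi_mean \<alpha> q A B) (SG_tilde \<alpha> p A B))
        \<longrightarrow> \<alpha> \<le> 1/2 \<and> p / q \<ge> 1/2)"
proof -
  let ?i = "\<forall>n\<ge>1. \<forall>A\<in>psd_mats n. \<forall>B\<in>psd_mats n. loewner_le (support_proj B) (support_proj A) \<longrightarrow>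
      log_maj n (SG_tilde \<alpha> p A B) (renyi_mean \<alpha> q A B)"
  let ?ii = "\<forall>A\<in>pd_mats 2. \<forall>B\<in>pd_mats 2. log_maj 2 (SG_tilde \<alpha> p A B) (renyi_mean \<alpha> q A B)"
  have "?ii" if "?i"
    using that[rule_format, of 2] loewner_le_support_proj_pd[of _ 2] by simp
  moreover have "p / q \<le> \<alpha>" if "?ii"
    by (rule necessary_upper[OF assms]) (use that in blast)
  moreover have "?i" if pq: "p / q \<le> \<alpha>"
  proof (intro allI ballI impI)
    fix n A B assume A: "A \<in> psd_mats n" and B: "B \<in> psd_mats n"
      and le: "loewner_le (support_proj B) (support_proj A)"
    \<comment> \<open>Filling the kernel of \<open>A\<close> changes neither mean, so the positive
      definite case applies with \<open>B\<close> as it is.\<close>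
    show "log_maj n (SG_tilde \<alpha> p A B) (renyi_mean \<alpha> q A B)"
      using SG_tilde_log_maj_renyi_mean_pd[OF fill_kernel_pd[OF A] B assms pq]
      by (simp add: means_fill_kernel[OF A B le])
  qed
  moreover have "log_maj n (renyi_mean \<alpha> q A B) (SG_tilde \<alpha> p A B)"
    if h: "\<alpha> \<le> 1 / 2" "q \<le> p" and A: "A \<in> psd_mats n" and B: "B \<in> psd_mats n"
      and le: "loewner_le (support_proj B) (support_proj A)" for n A B
    using renyi_mean_log_maj_SG_tilde_pd[OF fill_kernel_pd[OF A] B assms(1) h(1) assms(4) h(2)]
    by (simp add: means_fill_kernel[OF A B le])
  moreover have "\<alpha> \<le> 1 / 2 \<and> p / q \<ge> 1 / 2"
    if "\<forall>A\<in>pd_mats 2. \<forall>B\<in>pd_mats 2. log_maj 2 (renyi_mean \<alpha> q A B) (SG_tilde \<alpha> p A B)"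
    using necessary_lower[OF assms, of] that assms(4) by (auto simp: field_simps)
  ultimately show ?thesis by blast
qed

end
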